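(* For each $n$ let $W_n=(x_{ij,n})_{1\le i,j\le n}$ be a real symmetric random matrix whose entries $\{x_{ij,n}=x_{ji,n}:1\le i\le j\le n\}$ are i.i.d. Suppose there is a sequence $(t_n)_{n\ge1}$ in $[0,\infty]$ such that: (i) For each $k\in\mathbb N$, $$\lim_{n\to\infty}n\,\mathbb E\big[x_{ij,n}^{2k}\mathbf 1_{\{|x_{ij,n}|\le t_n\}}\big]=:C_{2k}<\infty,\qquad \lim_{n\to\infty}n^{\alpha}\,\mathbb E\big[x_{ij,n}^{2k-1}\mathbf 1_{\{|x_{ij,n}|\le t_n\}}\big]=0\ \text{ for every }\alpha<1.$$ (ii) The sequence $\{0,C_2,0,C_4,0,\dots\}$ is the cumulant sequence of a probability distribution $G$ whose moment sequence $\{\beta_k\}$ satisfies Carleman's condition $\sum_{k=1}^\infty\beta_{2k}^{-1/(2k)}=\infty$. Let $y_{ij}=x_{ij,n}\mathbf 1_{\{|x_{ij,n}|\le t_n\}}$ and $Z_n=(y_{ij})_{1\le i,j\le n}$. Then the empirical spectral distribution of $Z_n$ converges weakly almost surely to a probability measure $\mu$ whose moments are $$\beta_k(\mu)=\begin{cases}\displaystyle\sum_{\sigma\in SS(k)}C_\sigma & k\text{ even},\\ 0& k\text{ odd}.\end{cases}$$ Further, the empirical spectral distribution of $W_n$ converges weakly to $\mu$ almost surely (respectively in probability) if $$\frac1n\sum_{i,j=1}^n x_{ij,n}^2\,\mathbf 1_{\{|x_{ij,n}|>t_n\}}\to0\quad\text{almost surely (respectively in probability)}.$$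
   Context: The empirical spectral distribution of an $n\times n$ real symmetric random matrix with eigenvalues $\lambda_1,\dots,\lambda_n$ is the random probability measure $\frac1n\sum_{i=1}^n\delta_{\lambda_i}$. All random variables (for all $n$) live on a common probability space. For a partition $\sigma$, $C_\sigma:=\prod_{V\text{ block of }\sigma}C_{|V|}$ (all blocks of partitions in $SS(2k)$ have even size). Special symmetric partitions $SS(2k)$. Order the blocks of a partition by their smallest elements, $V_1<V_2<\dots<V_r$. The one-block partition of $\{1,\dots,2k\}$ belongs to $SS(2k)$ for each $k\ge 1$, and it is the only element of $SS(2)$. For $k>1$, a partition $\sigma=\{V_1<\dots<V_r\}$ of $\{1,\dots,2k\}$ belongs to $SS(2k)$ if and only if: (1) the last block $V_r$ is a union of even-sized intervals of consecutive integers $V_r=I_1\cup\dots\cup I_l$ (listed increasingly); (2) for $1\le i\le r-1$, $1\le j\le l-1$, the number of elements of $V_i$ lying in $[\min I_j,\max I_{j+1}]\setminus(I_j\cup I_{j+1})$ is even; (3) $\sigma\setminus\{V_r\}$ (if nonempty), viewed as a partition of $\{1,\dots,2k\}\setminus V_r$ relabelled order-preservingly, is special symmetric. (Equivalently in the paper's verbal form: the last block is a union of even-sized sets of consecutive integers, and between two successive elements of any block there are an even number of elements of any other block, equally many in odd and even positions.) *)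

theory Defs
  imports
    "HOL-Probability.Probability"
    "Jordan_Normal_Form.Char_Poly"
begin

text \<open>
  Points of \<open>proots (char_poly A)\<close> are counted with multiplicity and the pmf has total mass 1, so for a real
  symmetric \<open>A\<close> of size \<open>n > 0\<close> this is \<open>1/n\<close> times the sum of the Dirac masses at the \<open>n\<close>
  eigenvalues of \<open>A\<close>. The push-forward only replaces the discrete sigma-algebra of the pmf by the
  Borel one. Nothing is claimed for the empty matrix.
\<close>
definition esd :: "real Matrix.mat \<Rightarrow> real measure" where
  "esd A = distr (measure_pmf (pmf_of_multiset (proots (char_poly A)))) borel (\<lambda>x. x)"

definition tendsto_in_prob :: "'a measure \<Rightarrow> (nat \<Rightarrow> 'a \<Rightarrow> real) \<Rightarrow> real \<Rightarrow> bool" where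
  "tendsto_in_prob M X c \<longleftrightarrow>
     (\<forall>\<epsilon>>0. (\<lambda>n. measure M {\<omega> \<in> space M. \<epsilon> < \<bar>X n \<omega> - c\<bar>}) \<longlonglongrightarrow> 0)"

text \<open>
  Random measures \<open>\<nu> n \<omega>\<close> with a deterministic limit: the in-probability version of
  \<^const>\<open>weak_conv_m\<close>, which is convergence of distribution functions at continuity points.
\<close>
definition weak_conv_in_prob ::
    "'a measure \<Rightarrow> (nat \<Rightarrow> 'a \<Rightarrow> real measure) \<Rightarrow> real measure \<Rightarrow> bool" where
  "weak_conv_in_prob M \<nu> \<mu> \<longleftrightarrow>
     (\<forall>s. isCont (cdf \<mu>) s \<longrightarrow> tendsto_in_prob M (\<lambda>n \<omega>. cdf (\<nu> n \<omega>) s) (cdf \<mu> s))"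

definition moment :: "real measure \<Rightarrow> nat \<Rightarrow> real" where
  "moment \<mu> k = (\<integral>s. s ^ k \<partial>\<mu>)"

definition all_moments_finite :: "real measure \<Rightarrow> bool" where
  "all_moments_finite \<mu> \<longleftrightarrow> (\<forall>k. integrable \<mu> (\<lambda>s. s ^ k))"

text \<open>The multiplicative extension of \<open>c\<close> to partitions.\<close>
definition part_weight :: "(nat \<Rightarrow> real) \<Rightarrow> nat set set \<Rightarrow> real" where
  "part_weight c \<sigma> = (\<Prod>V\<in>\<sigma>. c (card V))"

text \<open>
  Classical cumulants \<open>c 1, c 2, \<dots>\<close> of a law with all moments finite, given by the moment-cumulant
  relation over all set partitions, so that no moment generating function has to exist.
  The value \<open>c 0\<close> is never used, since blocks are nonempty.
\<close>
definition has_cumulants :: "real measure \<Rightarrow> (nat \<Rightarrow> real) \<Rightarrow> bool" where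
  "has_cumulants \<mu> c \<longleftrightarrow> all_moments_finite \<mu> \<and>
     (\<forall>k\<ge>1. moment \<mu> k = (\<Sum>\<sigma> | partition_on {1..k} \<sigma>. part_weight c \<sigma>))"

text \<open>
  The series is taken in \<^typ>\<open>ennreal\<close>, where \<open>inverse 0 = \<infinity>\<close>; thus the degenerate case
  \<open>\<beta>\<^sub>2\<^sub>k = 0\<close> (the Dirac mass at 0) satisfies the condition, as it should.
\<close>
definition carleman :: "(nat \<Rightarrow> real) \<Rightarrow> bool" where
  "carleman \<beta> \<longleftrightarrow> (\<Sum>k. inverse (ennreal (root (2 * Suc k) (\<beta> (2 * Suc k))))) = \<infinity>"

text \<open>The order-preserving relabelling of a finite set \<open>S\<close> by \<open>1, \<dots>, card S\<close>.\<close>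
definition rank_in :: "nat set \<Rightarrow> nat \<Rightarrow> nat" where
  "rank_in S a = card {b \<in> S. b \<le> a}"

definition relabel :: "nat set set \<Rightarrow> nat set set" where
  "relabel \<sigma> = (\<lambda>U. rank_in (\<Union>\<sigma>) ` U) ` \<sigma>"

definition even_interval :: "nat set \<Rightarrow> bool" where
  "even_interval I \<longleftrightarrow> (\<exists>a b. a \<le> b \<and> I = {a..b}) \<and> even (card I)"

text \<open>
  In \<open>step\<close>, \<open>V\<close> is the block with the largest minimum, and \<open>Is\<close> is the increasing list of disjoint
  intervals making it up. The intervals need not be maximal: cutting one into adjacent pieces only
  adds empty gaps, for which the parity condition is trivial. A partition with a single block is
  covered by \<open>one_block\<close>, so \<open>step\<close> asks for another block besides \<open>V\<close>.
\<close>
inductive special_symmetric :: "nat set set \<Rightarrow> bool" where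
  one_block: "k \<ge> 1 \<Longrightarrow> special_symmetric {{1..2 * k}}"
| step: "k > 1 \<Longrightarrow> partition_on {1..2 * k} \<sigma> \<Longrightarrow>
    V \<in> \<sigma> \<Longrightarrow> \<forall>U\<in>\<sigma>. Min U \<le> Min V \<Longrightarrow> \<sigma> - {V} \<noteq> {} \<Longrightarrow>
    V = \<Union>(set Is) \<Longrightarrow> \<forall>I\<in>set Is. even_interval I \<Longrightarrow>
    sorted_wrt (\<lambda>I J. Max I < Min J) Is \<Longrightarrow>
    \<forall>U\<in>\<sigma> - {V}. \<forall>j. Suc j < length Is \<longrightarrow>
      even (card (U \<inter> ({Min (Is ! j)..Max (Is ! Suc j)} - (Is ! j \<union> Is ! Suc j)))) \<Longrightarrow>
    special_symmetric (relabel (\<sigma> - {V})) \<Longrightarrow>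
    special_symmetric \<sigma>"

definition SS :: "nat \<Rightarrow> nat set set set" where
  "SS m = {\<sigma>. partition_on {1..m} \<sigma> \<and> special_symmetric \<sigma>}"

text \<open>The value \<open>t = \<infinity>\<close> (no truncation) is allowed.\<close>
definition truncate_at :: "ennreal \<Rightarrow> real \<Rightarrow> real" where
  "truncate_at t s = s * of_bool (ennreal \<bar>s\<bar> \<le> t)"

text \<open>
  For each size \<open>n\<close>, the \<open>n \<times> n\<close> array \<open>x n\<close>, indexed by \<open>i, j < n\<close>, is symmetric, with
  independent identically distributed entries on and above the diagonal.
\<close>
definition symmetric_iid_arrays ::
    "'a measure \<Rightarrow> (nat \<Rightarrow> nat \<Rightarrow> nat \<Rightarrow> 'a \<Rightarrow> real) \<Rightarrow> bool" where
  "symmetric_iid_arrays M x \<longleftrightarrow> (\<forall>n.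
     (\<forall>i<n. \<forall>j<n. \<forall>\<omega>\<in>space M. x n i j \<omega> = x n j i \<omega>) \<and>
     prob_space.indep_vars M (\<lambda>_. borel) (\<lambda>(i, j). x n i j) {(i, j). i \<le> j \<and> j < n} \<and>
     (\<forall>i j. i \<le> j \<and> j < n \<longrightarrow> distr M borel (x n i j) = distr M borel (x n 0 0)))"

end

theory Submission
  imports Defs
begin

text \<open>
  The moments of the spectral distribution are normalised traces, that is, weighted counts of closed
  walks. A walk contributes in the limit only if it has one vertex more than it has edges, so that it
  runs on a tree, and the partitions of the steps by edges that arise from closed walks on trees are
  exactly the special symmetric ones. Four walks each of which shares an edge with another one have at
  most two components, so the fourth central moments of the normalised traces are \<open>O(n powr (-3/2))\<close>
  and all moments converge almost surely. The limiting moments are dominated by those of \<open>G\<close>, hence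
  Carleman's criterion, proved by Bang's real-variable argument, makes the limit unique.
  The passage to the untruncated matrix uses a coupling of the two spectral distributions by the
  squared inner products of eigenvectors.
\<close>

section \<open>Bang's lemma and Carleman's criterion\<close>

text \<open>All even truncated moments may be of order 1/n, not only the second, so an edge walked
  any even number of times can survive and blocks of every even size appear. Odd moments are only
  known to be smaller than every \<open>n powr (- \<alpha>)\<close> with \<alpha> < 1, so a clean
  1/n bound is not at hand. This suffices because a partition that is not special symmetric costs a
  full factor n in the number of walks, against a loss of \<open>n powr (1 - \<alpha>)\<close> per
  block. The same loss shapes the fluctuations: two walks with a common edge form one component, so
  second moments of the normalised trace are bounded only by roughly 1/n, not summable; four walks
  give two components and roughly 1/n squared, and \<alpha> is tuned to the walk length so that the
  loss costs only half a power of n. The law \<mu> is not built combinatorially but taken as a weak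
  limit along one sample path on which all moments converge. Bang's real-variable argument fits
  because it asks only for log-convex bounds on derivatives on the real line, which absolute moments
  supply; the characteristic function need not be analytic.\<close>

lemma quasi_analytic_ratio_le:
  fixes M :: "nat \<Rightarrow> real"
  assumes pos: "\<And>n. M n > 0" and lc: "\<And>n. (M (Suc n))\<^sup>2 \<le> M n * M (Suc (Suc n))"
    and "n + i \<le> Suc N"
  shows "M (n + i) \<le> M n * (M (Suc N) / M N) ^ i"
proof -
  \<comment> \<open>Log-convexity says that consecutive ratios increase, so each factor of
    \<open>M (n + i) / M n\<close> is at most the last ratio \<open>M (Suc N) / M N\<close>.\<close>
  have inc: "incseq (\<lambda>n. M (Suc n) / M n)"
    by (rule incseq_SucI)
      (use pos lc in \<open>auto simp: divide_simps power2_eq_square mult.commute less_imp_neq[symmetric]\<close>)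
  show ?thesis using assms(3)
  proof (induction i)
    case (Suc i)
    have "M (n + Suc i) = M (n + i) * (M (Suc (n + i)) / M (n + i))"
      using pos[of "n + i"] by simp
    also have "\<dots> \<le> M (n + i) * (M (Suc N) / M N)"
      using incseqD[OF inc, of "n + i" N] Suc.prems pos[of "n + i"] by (intro mult_left_mono) auto
    also have "\<dots> \<le> (M n * (M (Suc N) / M N) ^ i) * (M (Suc N) / M N)"
      using Suc pos[of N] pos[of "Suc N"] by (intro mult_right_mono) (auto intro: divide_nonneg_nonneg less_imp_le)
    finally show ?case by (simp add: mult_ac)
  qed simp
qed

lemma exp_partial_sum_le:
  assumes "x \<ge> (0::real)" shows "(\<Sum>i\<le>d. x ^ i / fact i) \<le> exp x"
proof -
  have "(\<Sum>i\<in>{..d}. x ^ i /\<^sub>R fact i) \<le> (\<Sum>i. x ^ i /\<^sub>R fact i)"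
    using assms summable_exp_generic[of x] by (intro sum_le_suminf) auto
  then show ?thesis by (simp add: exp_def divide_inverse mult.commute scaleR_conv_of_real)
qed

text \<open>The running maximum of the normalised derivatives in Bang's proof of the Denjoy--Carleman theorem.\<close>
primrec bang_sup :: "(nat \<Rightarrow> real \<Rightarrow> real) \<Rightarrow> (nat \<Rightarrow> real) \<Rightarrow> nat \<Rightarrow> real \<Rightarrow> real" where
  "bang_sup f M 0 x = 0"
| "bang_sup f M (Suc N) x = max (bang_sup f M N x) (\<bar>f N x\<bar> / (M N * exp (real N)))"

text \<open>The conjunct \<open>0 \<le> c\<close> accounts for the value 0 of the empty
  maximum.\<close>

lemma bang_sup_le_iff:
  "bang_sup f M N x \<le> c \<longleftrightarrow> 0 \<le> c \<and> (\<forall>n<N. \<bar>f n x\<bar> / (M n * exp (real n)) \<le> c)"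
  by (induction N) (auto simp: less_Suc_eq)

lemma bang_sup_ge: "n < N \<Longrightarrow> \<bar>f n x\<bar> / (M n * exp (real n)) \<le> bang_sup f M N x"
  using bang_sup_le_iff[of f M N x "bang_sup f M N x"] by auto

lemma bang_sup_mono: "k \<le> N \<Longrightarrow> bang_sup f M k x \<le> bang_sup f M N x"
  using bang_sup_le_iff[of f M N x "bang_sup f M N x"] by (subst bang_sup_le_iff) auto

lemma continuous_on_bang_sup:
  assumes "\<And>n. continuous_on S (f n)" and "\<And>n. M n > 0"
  shows "continuous_on S (bang_sup f M N)"
proof (induction N)
  case (Suc N)
  have "(\<lambda>x. bang_sup f M (Suc N) x) = (\<lambda>x. max (bang_sup f M N x) (\<bar>f N x\<bar> / (M N * exp (real N))))"
    by auto
  then show ?case using Suc assms(1)[of N] assms(2)[of N] by (auto intro!: continuous_intros)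
next
  case 0
  have "bang_sup f M 0 = (\<lambda>x. 0)" by auto
  then show ?case by simp
qed

text \<open>Expand each normalised derivative at \<open>x\<close> far enough that the remainder
  carries the derivative of index \<open>Suc N\<close>. The Taylor terms form a partial exponential
  series in a multiple of \<open>h * (M (Suc N) / M N)\<close>, and the floor
  \<open>exp (- real (Suc N))\<close> pays for the remainder, of which only the global bound is
  known.\<close>

lemma bang_step:
  fixes f :: "nat \<Rightarrow> real \<Rightarrow> real" and M :: "nat \<Rightarrow> real"
  assumes der: "\<And>n t. (f n has_real_derivative f (Suc n) t) (at t)"
    and bnd: "\<And>n t. \<bar>f n t\<bar> \<le> M n"
    and pos: "\<And>n. M n > 0" and lc: "\<And>n. (M (Suc n))\<^sup>2 \<le> M n * M (Suc (Suc n))"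
    and h: "h \<ge> 0"
  shows "max (exp (- real (Suc N))) (bang_sup f M (Suc N) (x + h)) \<le>
    max (exp (- real (Suc N))) (bang_sup f M (Suc N) x) * exp (exp 1 * h * (M (Suc N) / M N))"
    (is "_ \<le> ?B * exp ?z")
proof -
  define q where "q = M (Suc N) / M N"
  have q: "q > 0" using pos unfolding q_def by simp
  have z: "?z \<ge> 0" using h q unfolding q_def[symmetric] by simp
  have B0: "?B > 0" by (simp add: less_max_iff_disj)
  have B1: "?B \<le> ?B * exp ?z"
    using mult_left_mono[of 1 "exp ?z" ?B] z B0 by (simp only: one_le_exp_iff mult_1_right less_imp_le)
  have "\<bar>f n (x + h)\<bar> / (M n * exp (real n)) \<le> ?B * exp ?z" if n: "n < Suc N" for n
  proof (cases "h = 0")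
    case True
    have "\<bar>f n (x + h)\<bar> / (M n * exp (real n)) \<le> bang_sup f M (Suc N) x"
      using bang_sup_ge[OF n] True by simp
    also have "\<dots> \<le> ?B" by simp
    finally show ?thesis using B1 by linarith
  next
    case False
    define d where "d = Suc N - n"
    have d: "d > 0" "n + d = Suc N" using n unfolding d_def by auto
    obtain t where t: "f n (x + h) = (\<Sum>m<d. f (n + m) x / fact m * ((x + h) - x) ^ m)
        + f (n + d) t / fact d * ((x + h) - x) ^ d"
      using Taylor_up[of d "\<lambda>m. f (n + m)" "f n" x "x + h" x] d h False der by auto
    have "\<bar>f n (x + h)\<bar> \<le> \<bar>\<Sum>m<d. f (n + m) x / fact m * h ^ m\<bar> + \<bar>f (n + d) t / fact d * h ^ d\<bar>"
      unfolding t by (simp only: add_diff_cancel_left' abs_triangle_ineq)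
    also have "\<dots> \<le> (\<Sum>m<d. \<bar>f (n + m) x / fact m * h ^ m\<bar>) + \<bar>f (n + d) t / fact d * h ^ d\<bar>"
      using sum_abs by (intro add_right_mono)
    also have "\<dots> \<le> (\<Sum>m<d. ?B * (M n * exp (real n)) * (?z ^ m / fact m))
         + ?B * (M n * exp (real n)) * (?z ^ d / fact d)"
    proof (intro add_mono sum_mono)
      fix m assume m: "m \<in> {..<d}"
      have "\<bar>f (n + m) x\<bar> \<le> ?B * (M (n + m) * exp (real (n + m)))"
      proof -
        have "\<bar>f (n + m) x\<bar> / (M (n + m) * exp (real (n + m))) \<le> bang_sup f M (Suc N) x"
          using m d by (intro bang_sup_ge) auto
        also have "\<dots> \<le> ?B" by simp
        finally show ?thesis using pos[of "n + m"] by (simp add: divide_simps mult_ac)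
      qed
      also have "\<dots> \<le> ?B * ((M n * q ^ m) * exp (real (n + m)))"
        using quasi_analytic_ratio_le[of M, OF pos lc, of n m N] m d B0
        by (intro mult_left_mono mult_right_mono) (auto simp: q_def)
      \<comment> \<open>Each derivative beyond \<open>n\<close> costs one factor
        \<open>exp 1\<close> from the weights \<open>exp (real n)\<close>; this is the origin of
        \<open>exp 1\<close> in the growth rate.\<close>
      also have "\<dots> = ?B * (M n * exp (real n)) * (exp 1 * q) ^ m"
        by (simp add: exp_add power_mult_distrib exp_of_nat_mult[symmetric] mult_ac)
      finally have *: "\<bar>f (n + m) x\<bar> \<le> ?B * (M n * exp (real n)) * (exp 1 * q) ^ m" .
      have "\<bar>f (n + m) x / fact m * h ^ m\<bar> = \<bar>f (n + m) x\<bar> * (h ^ m / fact m)"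
        using h by (simp add: abs_mult)
      also have "\<dots> \<le> ?B * (M n * exp (real n)) * (exp 1 * q) ^ m * (h ^ m / fact m)"
        using * h by (intro mult_right_mono) auto
      also have "\<dots> = ?B * (M n * exp (real n)) * (?z ^ m / fact m)"
        unfolding q_def[symmetric] by (simp add: power_mult_distrib mult_ac)
      finally show "\<bar>f (n + m) x / fact m * h ^ m\<bar> \<le> \<dots>" .
    next
      have "\<bar>f (n + d) t\<bar> \<le> M (n + d)" using bnd by auto
      also have "\<dots> \<le> M n * q ^ d"
        using quasi_analytic_ratio_le[of M, OF pos lc, of n d N] d by (auto simp: q_def)
      \<comment> \<open>The floor is calibrated to the order of expansion: since
        \<open>n + d = Suc N\<close>, the weights cancel exactly.\<close>
      also have "\<dots> = exp (- real (Suc N)) * (M n * exp (real n)) * (exp 1 * q) ^ d"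
      proof -
        have "exp (real n) * exp 1 ^ d = exp (real (Suc N))"
          unfolding d(2)[symmetric] by (simp add: exp_add exp_of_nat_mult[symmetric])
        then have "exp (- real (Suc N)) * (exp (real n) * exp 1 ^ d) = 1"
          by (metis exp_minus_inverse mult.commute)
        then show ?thesis by (simp add: power_mult_distrib mult_ac)
      qed
      also have "\<dots> \<le> ?B * (M n * exp (real n)) * (exp 1 * q) ^ d"
        using pos[of n] q by (intro mult_right_mono) auto
      finally have *: "\<bar>f (n + d) t\<bar> \<le> ?B * (M n * exp (real n)) * (exp 1 * q) ^ d" .
      have "\<bar>f (n + d) t / fact d * h ^ d\<bar> = \<bar>f (n + d) t\<bar> * (h ^ d / fact d)"
        using h by (simp add: abs_mult)
      also have "\<dots> \<le> ?B * (M n * exp (real n)) * (exp 1 * q) ^ d * (h ^ d / fact d)"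
        using * h by (intro mult_right_mono) auto
      also have "\<dots> = ?B * (M n * exp (real n)) * (?z ^ d / fact d)"
        unfolding q_def[symmetric] by (simp add: power_mult_distrib mult_ac)
      finally show "\<bar>f (n + d) t / fact d * h ^ d\<bar> \<le> \<dots>" .
    qed
    also have "\<dots> = ?B * (M n * exp (real n)) * (\<Sum>m\<le>d. ?z ^ m / fact m)"
    proof -
      have "(\<Sum>m<d. K * g m) + K * g d = K * (\<Sum>m\<le>d. g m)" for K and g :: "nat \<Rightarrow> real"
        by (simp add: sum_distrib_left lessThan_Suc_atMost[symmetric] distrib_left)
      then show ?thesis .
    qed
    also have "\<dots> \<le> ?B * (M n * exp (real n)) * exp ?z"
      using exp_partial_sum_le[OF z, of d] B0 pos[of n] by (intro mult_left_mono) auto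
    finally show ?thesis using pos[of n] by (simp add: divide_simps mult_ac)
  qed
  moreover have "exp (- real (Suc N)) \<le> ?B * exp ?z" using B1 by simp
  moreover have "0 \<le> ?B * exp ?z" using B0 by simp
  ultimately show ?thesis by (subst max.bounded_iff) (auto simp only: bang_sup_le_iff)
qed

text \<open>At 0 all derivatives vanish, so \<open>B N\<close> starts at its floor
  \<open>exp (- real N)\<close>. By \<open>bang_step\<close>, a rise from
  \<open>exp (- real (Suc k))\<close> to \<open>exp (- real k)\<close> takes a length of at least
  \<open>M k / M (Suc k)\<close> divided by \<open>exp 1\<close>. If \<open>f 0 y\<close> were
  nonzero, \<open>B N y\<close> would stay above a fixed positive level for all positive
  \<open>N\<close>, and the ratios would have bounded partial sums.\<close>

theorem bang_quasi_analytic: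
  fixes f :: "nat \<Rightarrow> real \<Rightarrow> real" and M :: "nat \<Rightarrow> real"
  assumes der: "\<And>n t. (f n has_real_derivative f (Suc n) t) (at t)"
    and bnd: "\<And>n t. \<bar>f n t\<bar> \<le> M n"
    and pos: "\<And>n. M n > 0" and lc: "\<And>n. (M (Suc n))\<^sup>2 \<le> M n * M (Suc (Suc n))"
    and zero: "\<And>n. f n 0 = 0"
    and div: "\<not> summable (\<lambda>n. M n / M (Suc n))"
    and y: "y \<ge> 0"
  shows "f 0 y = 0"
proof (rule ccontr)
  assume nz: "f 0 y \<noteq> 0"
  define B where "B = (\<lambda>N x. max (exp (- real N)) (bang_sup f M N x))"
  have cont: "continuous_on S (B N)" for N S
  proof -
    have "continuous_on S (f n)" for n
      using der by (intro DERIV_continuous_on) (auto intro: has_field_derivative_at_within)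
    then show ?thesis unfolding B_def
      by (intro continuous_intros continuous_on_bang_sup pos)
  qed
  have B_le: "B N x \<le> B k x" if "k \<le> N" for N k x
  proof -
    have "bang_sup f M N x \<le> B k x"
    proof (subst bang_sup_le_iff, intro conjI allI impI)
      show "0 \<le> B k x" by (simp add: B_def le_max_iff_disj)
      fix n assume "n < N"
      show "\<bar>f n x\<bar> / (M n * exp (real n)) \<le> B k x"
      proof (cases "n < k")
        case True
        then show ?thesis using bang_sup_ge[OF True] by (simp add: B_def le_max_iff_disj)
      next
        case False
        have "\<bar>f n x\<bar> / (M n * exp (real n)) \<le> M n / (M n * exp (real n))"
          using bnd pos[of n] by (intro divide_right_mono) auto
        also have "\<dots> = exp (- real n)" using pos[of n] by (simp add: exp_minus divide_simps)
        also have "\<dots> \<le> exp (- real k)" using False by simp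
        also have "\<dots> \<le> B k x" by (simp add: B_def)
        finally show ?thesis .
      qed
    qed
    moreover have "exp (- real N) \<le> B k x" using that by (simp add: B_def le_max_iff_disj)
    moreover have "B N x = max (exp (- real N)) (bang_sup f M N x)" by (simp add: B_def)
    ultimately show ?thesis by (metis max.bounded_iff)
  qed
  have B_ge: "B k x \<le> max (exp (- real k)) (B N x)" if "k \<le> N" for N k x
    using bang_sup_mono[OF that, of f M x] unfolding B_def by auto
  have B0: "B N 0 = exp (- real N)" for N
  proof -
    have "bang_sup f M N 0 \<le> 0" by (subst bang_sup_le_iff) (simp add: zero)
    then show ?thesis unfolding B_def by (simp add: max_def) (smt (verit) exp_gt_zero)
  qed
  have main: "\<forall>x\<ge>0. B N x \<ge> exp (- real k) \<longrightarrow> (\<Sum>j\<in>{k..<N}. M j / M (Suc j)) \<le> exp 1 * x"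
    if "k \<le> N" for N k
    using that
  proof (induction rule: inc_induct)
    case (step k)
    show ?case
    proof (intro allI impI)
      fix x :: real assume x: "x \<ge> 0" "exp (- real k) \<le> B N x"
      have "B N 0 \<le> exp (- real (Suc k))" using B0 step by simp
      moreover have "exp (- real (Suc k)) \<le> exp (- real k)" by simp
      \<comment> \<open>Intermediate value theorem for \<open>B N\<close> on \<open>{0..x}\<close>;
        the rise from \<open>z\<close> to \<open>x\<close> is the length charged to the index
        \<open>k\<close>.\<close>
      ultimately obtain z where z: "0 \<le> z" "z \<le> x" "B N z = exp (- real (Suc k))"
        using IVT'[of "B N" 0 "exp (- real (Suc k))" x] x cont[of "{0..x}" N] by (meson order_trans)
      have IH: "(\<Sum>j\<in>{Suc k..<N}. M j / M (Suc j)) \<le> exp 1 * z"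
        using step.IH z by auto
      \<comment> \<open>\<open>bang_step\<close> controls the stage \<open>Suc k\<close>, whereas
        the crossing was found at stage \<open>N\<close>; by \<open>B_le\<close> and
        \<open>B_ge\<close> the two stages agree above the floor
        \<open>exp (- real (Suc k))\<close>.\<close>
      have "exp (- real k) \<le> B (Suc k) x" using x B_le[of "Suc k" N x] step by auto
      also have "\<dots> \<le> B (Suc k) z * exp (exp 1 * (x - z) * (M (Suc k) / M k))"
        using bang_step[of f M, OF der bnd pos lc, of "x - z" k z] z unfolding B_def by (auto simp del: bang_sup.simps)
      also have "B (Suc k) z \<le> exp (- real (Suc k))" using B_ge[of "Suc k" N z] z step by auto
      finally have "exp (- real k) \<le> exp (- real (Suc k)) * exp (exp 1 * (x - z) * (M (Suc k) / M k))"
        by simp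
      then have "exp (- real k) \<le> exp (- real (Suc k) + exp 1 * (x - z) * (M (Suc k) / M k))"
        by (simp only: exp_add)
      then have "1 \<le> exp 1 * (x - z) * (M (Suc k) / M k)" by simp
      then have "M k / M (Suc k) \<le> exp 1 * (x - z)"
        using pos[of k] pos[of "Suc k"] by (simp add: divide_simps)
      moreover have "(\<Sum>j\<in>{k..<N}. M j / M (Suc j)) = M k / M (Suc k) + (\<Sum>j\<in>{Suc k..<N}. M j / M (Suc j))"
        using step by (subst sum.atLeast_Suc_lessThan) auto
      ultimately show "(\<Sum>j\<in>{k..<N}. M j / M (Suc j)) \<le> exp 1 * x" using IH by (simp add: algebra_simps)
    qed
  qed simp
  define c where "c = \<bar>f 0 y\<bar> / M 0"
  have c: "c > 0" using nz pos[of 0] by (simp add: c_def)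
  obtain m :: nat where m: "exp (- real m) \<le> c"
  proof -
    obtain m :: nat where "- ln c \<le> real m" using real_arch_simple by blast
    then have "exp (- real m) \<le> exp (ln c)" by simp
    with c show ?thesis by (intro that) auto
  qed
  have bdd: "(\<Sum>j\<in>{m..<N}. M j / M (Suc j)) \<le> exp 1 * y" for N
  proof (cases "Suc m \<le> N")
    case True
    have "c \<le> bang_sup f M N y" using bang_sup_ge[of 0 N f y M] True by (auto simp: c_def)
    then have "B N y \<ge> exp (- real m)" using m by (simp add: B_def le_max_iff_disj)
    then show ?thesis using main[of m N] y True by auto
  qed (use y in auto)
  have "summable (\<lambda>j. M (j + m) / M (Suc (j + m)))"
  proof (rule summableI_nonneg_bounded)
    show "0 \<le> M (n + m) / M (Suc (n + m))" for n using pos by (simp add: less_imp_le)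
    show "(\<Sum>i<n. M (i + m) / M (Suc (i + m))) \<le> exp 1 * y" for n
      using bdd[of "n + m"] sum.shift_bounds_nat_ivl[of "\<lambda>j. M j / M (Suc j)" 0 m n]
      by (simp add: atLeast0LessThan)
  qed
  then show False using div summable_iff_shift[of "\<lambda>n. M n / M (Suc n)" m] by simp
qed

section \<open>Carleman's inequality between roots and ratios\<close>

lemma prod_le_mean_power:
  fixes b :: "nat \<Rightarrow> real"
  assumes "\<And>j. j \<in> S \<Longrightarrow> b j > 0" and "finite S" "S \<noteq> {}"
  shows "(\<Prod>j\<in>S. b j) \<le> ((\<Sum>j\<in>S. b j) / real (card S)) ^ card S"
proof -
  define u where "u = (\<Sum>j\<in>S. b j) / real (card S)"
  have card: "card S > 0" using assms by (simp add: card_gt_0_iff)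
  have u: "u > 0" unfolding u_def using assms card by (intro divide_pos_pos sum_pos) auto
  \<comment> \<open>The inequality of arithmetic and geometric means by a tangent line:
    \<open>t \<le> exp (t - 1)\<close> at \<open>t = b j / u\<close>, with \<open>u\<close> the
    mean, so that the exponents sum to zero.\<close>
  have "(\<Prod>j\<in>S. b j) \<le> (\<Prod>j\<in>S. u * exp (b j / u - 1))"
  proof (rule prod_mono)
    fix j assume j: "j \<in> S"
    have "b j / u \<le> exp (b j / u - 1)" using exp_ge_add_one_self[of "b j / u - 1"] by simp
    then show "0 \<le> b j \<and> b j \<le> u * exp (b j / u - 1)" using assms(1)[OF j] u by (simp add: divide_simps mult.commute)
  qed
  also have "\<dots> = u ^ card S * exp (\<Sum>j\<in>S. b j / u - 1)"
    using assms by (simp add: prod.distrib exp_sum)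
  also have "(\<Sum>j\<in>S. b j / u - 1) = 0"
    using u card by (simp add: sum_subtractf sum_divide_distrib[symmetric]) (use u in \<open>simp add: u_def field_simps\<close>)
  finally show ?thesis by (simp add: u_def)
qed

text \<open>A weak form of Stirling's formula: \<open>real n ^ n / fact n\<close> is one term of the
  exponential series at \<open>real n\<close>.\<close>

lemma fact_root_ge:
  assumes "n > 0" shows "real n / exp 1 \<le> root n (fact n)"
proof -
  have "real n ^ n / fact n \<le> (\<Sum>i\<le>n. real n ^ i / fact i)"
    by (rule member_le_sum) auto
  also have "\<dots> \<le> exp (real n)" by (rule exp_partial_sum_le) simp
  finally have "real n ^ n \<le> fact n * exp (real n)" by (simp add: divide_simps mult.commute)
  moreover have "exp (real n) = exp 1 ^ n" by (simp add: exp_of_nat_mult[symmetric])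
  ultimately have "(real n / exp 1) ^ n \<le> fact n" by (simp add: power_divide divide_simps)
  then have "root n ((real n / exp 1) ^ n) \<le> root n (fact n)"
    using assms by (intro real_root_le_mono) auto
  then show ?thesis using assms by (simp add: real_root_power_cancel)
qed

text \<open>Comparison of \<open>1 / n\<^sup>2\<close> with \<open>2 / (n * (n + 1))\<close>, which
  telescopes; the 2 reappears in the constant \<open>2 * exp 1\<close> of Carleman's
  inequality.\<close>

lemma sum_inverse_square_tail_le:
  assumes "j \<ge> 1"
  shows "(\<Sum>n\<in>{j..N}. 1 / (real n)\<^sup>2) \<le> 2 / real j"
proof (cases "j \<le> N")
  case True
  have "(\<Sum>n\<in>{j..N}. 1 / (real n)\<^sup>2) \<le> (\<Sum>n\<in>{j..N}. (-2) / real (Suc n) - (-2) / real n)"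
  proof (rule sum_mono)
    fix n assume "n \<in> {j..N}"
    then have n: "real n \<ge> 1" using assms by auto
    have "1 / (real n)\<^sup>2 = 2 / (2 * (real n)\<^sup>2)" by simp
    also have "\<dots> \<le> 2 / (real n * real (Suc n))"
      using n by (intro divide_left_mono mult_pos_pos) (auto simp: power2_eq_square algebra_simps)
    also have "\<dots> = (-2) / real (Suc n) - (-2) / real n"
      using n by (simp add: field_simps)
    finally show "1 / (real n)\<^sup>2 \<le> (-2) / real (Suc n) - (-2) / real n" .
  qed
  also have "\<dots> = (-2) / real (Suc N) - (-2) / real j"
    using True by (subst sum_Suc_diff) auto
  also have "\<dots> \<le> 2 / real j" by simp
  finally show ?thesis .
qed auto

text \<open>Carleman's inequality turns the root form of Carleman's condition into the ratio form
  needed for Bang's theorem.\<close>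
lemma summable_root_of_summable_ratio:
  fixes M :: "nat \<Rightarrow> real"
  assumes pos: "\<And>n. M n > 0" and M0: "M 0 = 1" and sm: "summable (\<lambda>n. M n / M (Suc n))"
  shows "summable (\<lambda>n. 1 / root (Suc n) (M (Suc n)))"
proof -
  define a where "a j = M (j - 1) / M j" for j
  have a: "a j > 0" for j using pos by (simp add: a_def)
  have prod_a: "(\<Prod>j\<in>{1..n}. a j) = 1 / M n" for n
  proof (induction n)
    case (Suc n)
    then show ?case using pos[of n] pos[of "Suc n"] by (simp add: a_def)
  qed (simp add: M0)
  have root_le: "1 / root n (M n) \<le> exp 1 * (\<Sum>j\<in>{1..n}. real j * a j) / (real n)\<^sup>2" if n: "n \<ge> 1" for n
  proof -
    \<comment> \<open>The weights \<open>j\<close> make the interchange of sums below converge: they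
      lead to tail weights \<open>1 / n\<^sup>2\<close>, at the price of \<open>fact n\<close>,
      whose root is bounded from below by \<open>fact_root_ge\<close>.\<close>
    have "fact n * (1 / M n) = (\<Prod>j\<in>{1..n}. real j * a j)"
      by (simp only: prod.distrib prod_a fact_prod of_nat_prod)
    also have "\<dots> \<le> ((\<Sum>j\<in>{1..n}. real j * a j) / real n) ^ n"
      using prod_le_mean_power[of "{1..n}" "\<lambda>j. real j * a j"] a n by auto
    finally have P: "fact n * (1 / M n) \<le> ((\<Sum>j\<in>{1..n}. real j * a j) / real n) ^ n" .
    have "root n (fact n * (1 / M n)) \<le> root n (((\<Sum>j\<in>{1..n}. real j * a j) / real n) ^ n)"
      by (rule real_root_le_mono[OF _ P]) (use n in simp)
    also have "\<dots> = (\<Sum>j\<in>{1..n}. real j * a j) / real n"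
    proof (rule real_root_power_cancel)
      show "0 \<le> (\<Sum>j\<in>{1..n}. real j * a j) / real n"
        by (intro divide_nonneg_nonneg sum_nonneg mult_nonneg_nonneg less_imp_le[OF a]) auto
    qed (use n in simp)
    finally have 1: "root n (fact n) * (1 / root n (M n)) \<le> (\<Sum>j\<in>{1..n}. real j * a j) / real n"
      using n by (simp add: real_root_mult real_root_divide)
    have "(real n / exp 1) * (1 / root n (M n)) \<le> root n (fact n) * (1 / root n (M n))"
      using fact_root_ge[of n] n pos[of n] by (intro mult_right_mono) (auto simp: less_imp_le)
    with 1 have "(real n / exp 1) * (1 / root n (M n)) \<le> (\<Sum>j\<in>{1..n}. real j * a j) / real n" by linarith
    then have "(exp 1 / real n) * ((real n / exp 1) * (1 / root n (M n))) \<le> (exp 1 / real n) * ((\<Sum>j\<in>{1..n}. real j * a j) / real n)"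
      by (intro mult_left_mono) auto
    moreover have "(exp 1 / real n) * ((real n / exp 1) * (1 / root n (M n))) = 1 / root n (M n)"
      using n by simp
    ultimately have "1 / root n (M n) \<le> (exp 1 / real n) * ((\<Sum>j\<in>{1..n}. real j * a j) / real n)"
      by linarith
    then show ?thesis by (simp add: power2_eq_square)
  qed
  have part: "(\<Sum>n\<in>{1..N}. 1 / root n (M n)) \<le> 2 * exp 1 * (\<Sum>n. M n / M (Suc n))" for N
  proof -
    have "(\<Sum>n\<in>{1..N}. 1 / root n (M n)) \<le> (\<Sum>n\<in>{1..N}. exp 1 * (\<Sum>j\<in>{1..n}. real j * a j) / (real n)\<^sup>2)"
      using root_le by (intro sum_mono) auto
    also have "\<dots> = exp 1 * (\<Sum>n\<in>{1..N}. \<Sum>j\<in>{1..n}. real j * a j * (1 / (real n)\<^sup>2))"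
      by (simp add: sum_distrib_left sum_divide_distrib mult_ac)
    also have "(\<Sum>n\<in>{1..N}. \<Sum>j\<in>{1..n}. real j * a j * (1 / (real n)\<^sup>2))
       = (\<Sum>j\<in>{1..N}. \<Sum>n\<in>{j..N}. real j * a j * (1 / (real n)\<^sup>2))"
    proof -
      have "(\<Sum>n\<in>{1..N}. \<Sum>j\<in>{1..n}. real j * a j * (1 / (real n)\<^sup>2))
        = (\<Sum>n\<in>{1..N}. \<Sum>j | j \<in> {1..N} \<and> j \<le> n. real j * a j * (1 / (real n)\<^sup>2))"
        by (intro sum.cong refl) auto
      also have "\<dots> = (\<Sum>j\<in>{1..N}. \<Sum>n | n \<in> {1..N} \<and> j \<le> n. real j * a j * (1 / (real n)\<^sup>2))"
        by (rule sum.swap_restrict) auto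
      also have "\<dots> = (\<Sum>j\<in>{1..N}. \<Sum>n\<in>{j..N}. real j * a j * (1 / (real n)\<^sup>2))"
        by (intro sum.cong refl) auto
      finally show ?thesis .
    qed
    also have "\<dots> = (\<Sum>j\<in>{1..N}. real j * a j * (\<Sum>n\<in>{j..N}. 1 / (real n)\<^sup>2))"
      by (simp add: sum_distrib_left)
    also have "\<dots> \<le> (\<Sum>j\<in>{1..N}. real j * a j * (2 / real j))"
      using sum_inverse_square_tail_le a by (intro sum_mono mult_left_mono) (auto simp: less_imp_le)
    also have "\<dots> = 2 * (\<Sum>j\<in>{1..N}. a j)"
      by (auto simp add: sum_distrib_left intro!: sum.cong)
    also have "(\<Sum>j\<in>{1..N}. a j) = (\<Sum>j<N. M j / M (Suc j))"
      by (rule sum.reindex_bij_witness[of _ Suc "\<lambda>j. j - 1"]) (auto simp: a_def)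
    also have "\<dots> \<le> (\<Sum>n. M n / M (Suc n))"
      using sm pos by (intro sum_le_suminf) (auto simp: less_imp_le)
    finally show ?thesis by (simp add: mult_left_mono)
  qed
  show ?thesis
  proof (rule summableI_nonneg_bounded)
    show "0 \<le> 1 / root (Suc n) (M (Suc n))" for n using pos by (simp add: less_imp_le)
    show "(\<Sum>i<n. 1 / root (Suc i) (M (Suc i))) \<le> 2 * exp 1 * (\<Sum>n. M n / M (Suc n))" for n
      using part[of n] unfolding One_nat_def sum.atLeast1_atMost_eq .
  qed
qed

section \<open>Cosine transforms of laws with finite moments\<close>

lemma quadratic_nonneg_imp:
  fixes a b c :: real
  assumes "\<And>l. a - 2 * l * b + l\<^sup>2 * c \<ge> 0" and c: "c \<ge> 0"
  shows "b\<^sup>2 \<le> a * c"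
proof (cases "c = 0")
  case True
  have "b = 0"
  proof (rule ccontr)
    assume "b \<noteq> 0"
    \<comment> \<open>At \<open>c = 0\<close> the form is affine in \<open>l\<close> and takes the
      value -1 at this point.\<close>
    then show False using assms(1)[of "(a + 1) / (2 * b)"] True by simp
  qed
  then show ?thesis using True by simp
next
  case False
  then have "c > 0" using c by simp
  then show ?thesis using assms(1)[of "b / c"] by (simp add: field_simps power2_eq_square)
qed

text \<open>All derivatives of cosine are written as shifts by multiples of \<open>pi / 2\<close>,
  so that the derivative of a cosine transform stays in the same family.\<close>

lemma cos_taylor_2:
  fixes a y :: real shows "\<bar>cos (a + y) - cos a - y * cos (a + pi / 2)\<bar> \<le> y\<^sup>2 / 2"
proof -
  have "((\<lambda>y. cos (a + y + real m * (pi / 2))) has_real_derivative cos (a + x + real (Suc m) * (pi / 2))) (at x)" for m x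
  proof -
    have "sin (a + x + real m * (pi / 2)) = - cos (a + x + real (Suc m) * (pi / 2))"
      using minus_sin_cos_eq[of "a + x + real m * (pi / 2)"] by (simp add: algebra_simps add_divide_distrib)
    then show ?thesis by (auto intro!: derivative_eq_intros)
  qed
  then obtain t where "cos (a + y + real 0 * (pi / 2)) = (\<Sum>m<2. cos (a + 0 + real m * (pi / 2)) / fact m * y ^ m)
      + cos (a + t + real 2 * (pi / 2)) / fact 2 * y ^ 2"
    using Maclaurin_all_le[of "\<lambda>m y. cos (a + y + real m * (pi / 2))" "\<lambda>y. cos (a + y + real 0 * (pi / 2))" y 2]
    by blast
  then have t: "cos (a + y) = cos a + y * cos (a + pi / 2) + cos (a + t + pi) / 2 * y\<^sup>2"
    by (simp add: numeral_2_eq_2 mult.commute)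
  have "\<bar>cos (a + t + pi) / 2 * y\<^sup>2\<bar> \<le> 1 / 2 * y\<^sup>2"
    unfolding abs_mult by (intro mult_mono) (auto simp: abs_cos_le_one)
  then show ?thesis unfolding t by simp
qed

text \<open>With this criterion, differentiation under the integral only asks for an integrated
  quadratic error instead of dominated convergence.\<close>

lemma DERIV_of_quadratic_error:
  fixes F :: "real \<Rightarrow> real"
  assumes "\<And>h. \<bar>F (t + h) - F t - h * D\<bar> \<le> K * h\<^sup>2"
  shows "(F has_real_derivative D) (at t)"
proof -
  have "\<bar>(F (t + h) - F t) / h - D\<bar> \<le> K * \<bar>h\<bar>" if "h \<noteq> 0" for h
  proof -
    have "(F (t + h) - F t) / h - D = (F (t + h) - F t - h * D) / h"
      using that by (simp add: field_simps)
    then have "\<bar>(F (t + h) - F t) / h - D\<bar> = \<bar>F (t + h) - F t - h * D\<bar> / \<bar>h\<bar>"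
      by (simp only: abs_divide)
    also have "\<dots> \<le> K * h\<^sup>2 / \<bar>h\<bar>" using assms by (intro divide_right_mono) auto
    also have "\<dots> = K * \<bar>h\<bar>" using that by (simp add: field_simps power2_eq_square)
    finally show ?thesis .
  qed
  then have "\<forall>\<^sub>F h in at 0. norm ((F (t + h) - F t) / h - D) \<le> K * \<bar>h\<bar>"
    by (simp add: eventually_at_filter)
  moreover have "((\<lambda>h. K * \<bar>h\<bar>) \<longlongrightarrow> 0) (at 0)"
    by (intro tendsto_mult_right_zero tendsto_rabs_zero tendsto_ident_at)
  ultimately have "((\<lambda>h. (F (t + h) - F t) / h - D) \<longlongrightarrow> 0) (at 0)"
    by (rule Lim_null_comparison)
  then show ?thesis unfolding DERIV_def by (rule LIM_zero_cancel)
qed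

text \<open>For \<open>n = 0\<close> this is the real part of the characteristic function turned by
  the phase \<open>\<theta>\<close>; the shift by \<open>real n * (pi / 2)\<close> makes index
  \<open>n\<close> its \<open>n\<close>-th derivative in \<open>t\<close>. Everything stays real, as
  Bang's theorem requires.\<close>

definition cos_moment :: "real measure \<Rightarrow> real \<Rightarrow> nat \<Rightarrow> real \<Rightarrow> real" where
  "cos_moment \<mu> \<theta> n t = (\<integral>x. x ^ n * cos (t * x + \<theta> + real n * (pi / 2)) \<partial>\<mu>)"

context
  fixes \<mu> :: "real measure"
  assumes \<mu>: "real_distribution \<mu>" and fin: "\<And>k. integrable \<mu> (\<lambda>s. s ^ k)"
begin

interpretation real_distribution \<mu> by (rule \<mu>)

lemma integrable_cos_moment: "integrable \<mu> (\<lambda>x. x ^ n * cos (t * x + c))"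
proof (rule Bochner_Integration.integrable_bound[OF fin[of n]])
  show "AE x in \<mu>. norm (x ^ n * cos (t * x + c)) \<le> norm (x ^ n)"
    by (rule AE_I2) (auto simp: abs_mult intro!: mult_left_le)
qed simp

lemma integrable_abs_moment: "integrable \<mu> (\<lambda>x. \<bar>x\<bar> ^ n)"
  using fin[of n, THEN integrable_abs] by (simp add: power_abs)

lemma cos_moment_bound: "\<bar>cos_moment \<mu> \<theta> n t\<bar> \<le> (\<integral>x. \<bar>x\<bar> ^ n \<partial>\<mu>)"
  unfolding cos_moment_def
proof (rule order_trans[OF integral_abs_bound])
  show "(\<integral>x. \<bar>x ^ n * cos (t * x + \<theta> + real n * (pi / 2))\<bar> \<partial>\<mu>) \<le> (\<integral>x. \<bar>x\<bar> ^ n \<partial>\<mu>)"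
    using integrable_cos_moment[of n t "\<theta> + real n * (pi / 2)"] integrable_abs_moment
    by (intro integral_mono integrable_abs)
      (auto simp: abs_mult power_abs add.assoc intro!: mult_left_le)
qed

text \<open>The error of the first-order expansion is at most \<open>\<bar>x\<bar> ^ n\<close> times
  \<open>(h * x)\<^sup>2 / 2\<close>, and the absolute moment of order \<open>n + 2\<close> is
  finite.\<close>

lemma cos_moment_deriv:
  "(cos_moment \<mu> \<theta> n has_real_derivative cos_moment \<mu> \<theta> (Suc n) t) (at t)"
proof (rule DERIV_of_quadratic_error)
  fix h :: real
  define c where "c = \<theta> + real n * (pi / 2)"
  have S: "\<theta> + real (Suc n) * (pi / 2) = c + pi / 2" unfolding c_def by (simp add: algebra_simps add_divide_distrib)
  note I = integrable_cos_moment
  have I3: "integrable \<mu> (\<lambda>x. x ^ n * x * (h * cos (t * x + (c + pi / 2))))"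
    using integrable_mult_right[OF I[of "Suc n" t "c + pi/2"], of h] by (simp add: mult_ac)
  have E: "h * (\<integral>x. x ^ Suc n * cos (t * x + (c + pi / 2)) \<partial>\<mu>) =
      (\<integral>x. x ^ n * x * (h * cos (t * x + (c + pi / 2))) \<partial>\<mu>)"
    by (subst Bochner_Integration.integral_mult_right_zero[symmetric])
      (simp add: mult_ac del: Bochner_Integration.integral_mult_right_zero)
  let ?I = "\<integral>x. x ^ n * cos ((t + h) * x + c) - x ^ n * cos (t * x + c) - x ^ n * x * (h * cos (t * x + (c + pi / 2))) \<partial>\<mu>"
  have eq: "cos_moment \<mu> \<theta> n (t + h) - cos_moment \<mu> \<theta> n t - h * cos_moment \<mu> \<theta> (Suc n) t =
     (\<integral>x. x ^ n * cos ((t + h) * x + c) - x ^ n * cos (t * x + c) - x ^ n * x * (h * cos (t * x + (c + pi / 2))) \<partial>\<mu>)"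
    unfolding cos_moment_def add.assoc S c_def[symmetric]
    using I[of n "t + h" c] I[of n t c] I3 E by simp
  have "\<bar>?I\<bar> \<le> (\<integral>x. \<bar>x\<bar> ^ (n + 2) * (h\<^sup>2 / 2) \<partial>\<mu>)"
  proof (rule order_trans[OF integral_abs_bound], rule integral_mono)
    show "integrable \<mu> (\<lambda>x. \<bar>x ^ n * cos ((t + h) * x + c) - x ^ n * cos (t * x + c) - x ^ n * x * (h * cos (t * x + (c + pi / 2)))\<bar>)"
      using I[of n "t + h" c] I[of n t c] I3 by simp
    show "integrable \<mu> (\<lambda>x. \<bar>x\<bar> ^ (n + 2) * (h\<^sup>2 / 2))"
      using integrable_abs_moment[of "n + 2"] by simp
    fix x
    have eq: "x ^ n * cos ((t + h) * x + c) - x ^ n * cos (t * x + c) - x ^ n * x * (h * cos (t * x + (c + pi / 2)))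
      = x ^ n * (cos ((t * x + c) + h * x) - cos (t * x + c) - (h * x) * cos ((t * x + c) + pi / 2))"
      by (simp add: algebra_simps)
    have "\<bar>x ^ n * (cos ((t * x + c) + h * x) - cos (t * x + c) - (h * x) * cos ((t * x + c) + pi / 2))\<bar> \<le> \<bar>x\<bar> ^ n * ((h * x)\<^sup>2 / 2)"
      unfolding abs_mult power_abs by (intro mult_left_mono cos_taylor_2) auto
    also have "\<dots> = \<bar>x\<bar> ^ (n + 2) * (h\<^sup>2 / 2)" by (simp add: power_add power_mult_distrib power2_eq_square)
    finally show "\<bar>x ^ n * cos ((t + h) * x + c) - x ^ n * cos (t * x + c) - x ^ n * x * (h * cos (t * x + (c + pi / 2)))\<bar>
      \<le> \<bar>x\<bar> ^ (n + 2) * (h\<^sup>2 / 2)" unfolding eq .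
  qed
  also have "\<dots> = (\<integral>x. \<bar>x\<bar> ^ (n + 2) \<partial>\<mu>) / 2 * h\<^sup>2"
    by (subst Bochner_Integration.integral_mult_left_zero) (simp only: times_divide_eq_right times_divide_eq_left)
  finally show "\<bar>cos_moment \<mu> \<theta> n (t + h) - cos_moment \<mu> \<theta> n t - h * cos_moment \<mu> \<theta> (Suc n) t\<bar>
    \<le> (\<integral>x. \<bar>x\<bar> ^ (n + 2) \<partial>\<mu>) / 2 * h\<^sup>2" unfolding eq .
qed

text \<open>The integral of \<open>\<bar>x\<bar> ^ n * (1 - l * \<bar>x\<bar>)\<^sup>2\<close>. It
  is kept as a quadratic in \<open>l\<close> rather than as log-convexity, because in this form it
  is preserved when two laws are averaged.\<close>

lemma abs_moment_quadratic:
  "(\<integral>x. \<bar>x\<bar> ^ n \<partial>\<mu>) - 2 * l * (\<integral>x. \<bar>x\<bar> ^ Suc n \<partial>\<mu>) + l\<^sup>2 * (\<integral>x. \<bar>x\<bar> ^ Suc (Suc n) \<partial>\<mu>) \<ge> 0"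
proof -
  have "0 \<le> (\<integral>x. \<bar>x\<bar> ^ n * (1 - l * \<bar>x\<bar>)\<^sup>2 \<partial>\<mu>)" by (intro Bochner_Integration.integral_nonneg) auto
  also have "\<dots> = (\<integral>x. \<bar>x\<bar> ^ n - 2 * l * \<bar>x\<bar> ^ Suc n + l\<^sup>2 * \<bar>x\<bar> ^ Suc (Suc n) \<partial>\<mu>)"
    by (intro Bochner_Integration.integral_cong) (auto simp: power2_eq_square algebra_simps)
  also have "\<dots> = (\<integral>x. \<bar>x\<bar> ^ n \<partial>\<mu>) - 2 * l * (\<integral>x. \<bar>x\<bar> ^ Suc n \<partial>\<mu>) + l\<^sup>2 * (\<integral>x. \<bar>x\<bar> ^ Suc (Suc n) \<partial>\<mu>)"
    using integrable_abs_moment[of n] integrable_abs_moment[of "Suc n"] integrable_abs_moment[of "Suc (Suc n)"]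
    by (simp del: power_Suc)
  finally show ?thesis .
qed

lemma char_eq_cos_moment: "char \<mu> t = Complex (cos_moment \<mu> 0 0 t) (cos_moment \<mu> (- pi / 2) 0 t)"
proof (rule complex_eqI)
  have i: "integrable \<mu> (\<lambda>x. iexp (t * x))" by (rule integrable_iexp) auto
  have "Re (char \<mu> t) = (\<integral>x. Re (iexp (t * x)) \<partial>\<mu>)" unfolding char_def using i by simp
  then show "Re (char \<mu> t) = Re (Complex (cos_moment \<mu> 0 0 t) (cos_moment \<mu> (- pi / 2) 0 t))"
    by (simp add: cos_moment_def Re_exp)
  have "Im (char \<mu> t) = (\<integral>x. Im (iexp (t * x)) \<partial>\<mu>)" unfolding char_def using i by simp
  then show "Im (char \<mu> t) = Im (Complex (cos_moment \<mu> 0 0 t) (cos_moment \<mu> (- pi / 2) 0 t))"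
    by (simp add: cos_moment_def Im_exp cos_diff[of _ "pi / 2", simplified])
qed

lemma zero_even_moment_AE:
  assumes "moment \<mu> (2 * k) = 0" "k > 0" shows "AE x in \<mu>. x = 0"
proof -
  have "AE x in \<mu>. x ^ (2 * k) = 0"
    using assms(1) fin[of "2 * k"] unfolding moment_def by (subst (asm) integral_nonneg_eq_0_iff_AE) auto
  then show ?thesis using assms(2) by auto
qed

end

text \<open>Half the difference of the two cosine transforms has all derivatives 0 at 0 because the
  moments agree, so Bang's theorem makes it vanish. The sequence \<open>\<beta>\<close> only has to
  dominate the even moments, so Carleman's condition may be checked on another law with larger
  moments.\<close>

theorem carleman_determinate:
  assumes \<mu>: "real_distribution \<mu>" "all_moments_finite \<mu>"
    and \<nu>: "real_distribution \<nu>" "all_moments_finite \<nu>"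
    and eq: "\<And>k. moment \<mu> k = moment \<nu> k"
    and le: "\<And>k. k > 0 \<Longrightarrow> moment \<mu> (2 * k) \<le> \<beta> (2 * k)"
    and carl: "carleman \<beta>"
  shows "\<mu> = \<nu>"
proof (rule Levy_uniqueness[OF \<mu>(1) \<nu>(1)])
  note \<mu>f = \<mu>(2)[unfolded all_moments_finite_def, rule_format]
  note \<nu>f = \<nu>(2)[unfolded all_moments_finite_def, rule_format]
  interpret \<mu>: real_distribution \<mu> by fact
  interpret \<nu>: real_distribution \<nu> by fact
  show "char \<mu> = char \<nu>"
  \<comment> \<open>A vanishing even moment forces both laws to be the point mass at 0; otherwise
    all bounds \<open>M n\<close> are positive, as Bang's theorem demands.\<close>
  proof (cases "\<exists>k>0. moment \<mu> (2 * k) = 0")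
    case True
    then obtain k where k: "k > 0" "moment \<mu> (2 * k) = 0" "moment \<nu> (2 * k) = 0" using eq by auto
    have "AE x in \<mu>. x = 0" "AE x in \<nu>. x = 0"
      using zero_even_moment_AE[OF \<mu>(1) \<mu>f k(2,1)] zero_even_moment_AE[OF \<nu>(1) \<nu>f k(3,1)] .
    moreover have "char \<rho> t = (\<integral>x. 1 \<partial>\<rho>)" if "real_distribution \<rho>" "AE x in \<rho>. x = 0" for \<rho> t
    proof -
      interpret real_distribution \<rho> by fact
      show ?thesis unfolding char_def
      proof (rule integral_cong_AE)
        show "AE x in \<rho>. iexp (t * x) = 1" using that(2) by eventually_elim simp
      qed auto
    qed
    ultimately have "char \<mu> t = (\<integral>x. 1 \<partial>\<mu>)" "char \<nu> t = (\<integral>x. 1 \<partial>\<nu>)" for t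
      using \<mu>(1) \<nu>(1) by auto
    then show ?thesis using \<mu>.prob_space \<nu>.prob_space by (auto simp: fun_eq_iff)
  next
    case False
    then have nz: "moment \<mu> (2 * k) \<noteq> 0" if "k > 0" for k using that by blast
    have even_abs: "(\<integral>x. \<bar>x\<bar> ^ (2 * k) \<partial>\<rho>) = moment \<rho> (2 * k)" for \<rho> k
      by (simp add: moment_def power_mult)
    \<comment> \<open>Equal moments do not say that the odd absolute moments agree, hence the
      average over both laws; its even terms are the common moments.\<close>
    define M where "M n = ((\<integral>x. \<bar>x\<bar> ^ n \<partial>\<mu>) + (\<integral>x. \<bar>x\<bar> ^ n \<partial>\<nu>)) / 2" for n
    have M_even: "M (2 * k) = moment \<mu> (2 * k)" for k
      unfolding M_def even_abs by (simp add: eq)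
    have M_nn: "M n \<ge> 0" for n unfolding M_def by (simp add: Bochner_Integration.integral_nonneg)
    have lc: "(M (Suc n))\<^sup>2 \<le> M n * M (Suc (Suc n))" for n
    proof (rule quadratic_nonneg_imp[OF _ M_nn])
      fix l show "0 \<le> M n - 2 * l * M (Suc n) + l\<^sup>2 * M (Suc (Suc n))"
        using abs_moment_quadratic[OF \<mu>(1) \<mu>f, of n l] abs_moment_quadratic[OF \<nu>(1) \<nu>f, of n l]
        unfolding M_def by (simp add: field_simps del: power_Suc)
    qed
    have even_pos: "M (2 * k) > 0" for k
    proof (cases "k = 0")
      case False
      then have "M (2 * k) \<noteq> 0" using nz[of k] M_even[of k] by simp
      then show ?thesis using M_nn[of "2 * k"] by simp
    qed (use \<mu>.prob_space \<nu>.prob_space in \<open>simp add: M_def\<close>)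
    have pos: "M n > 0" for n
    proof (cases "even n")
      case True
      then obtain k where "n = 2 * k" by (elim evenE)
      then show ?thesis using even_pos[of k] by simp
    next
      case False
      then obtain k where "n = 2 * k + 1" by (elim oddE)
      then have "Suc n = 2 * (k + 1)" by simp
      then have S: "M (Suc n) > 0" using even_pos[of "k + 1"] by metis
      have "M n \<noteq> 0"
      proof
        assume "M n = 0"
        then have "(M (Suc n))\<^sup>2 \<le> 0" using lc[of n] by simp
        then show False using S by simp
      qed
      then show ?thesis using M_nn[of n] by simp
    qed
    have M0: "M 0 = 1" using \<mu>.prob_space \<nu>.prob_space by (simp add: M_def)
    have div: "\<not> summable (\<lambda>n. M n / M (Suc n))"
    proof
      assume "summable (\<lambda>n. M n / M (Suc n))"
      from summable_root_of_summable_ratio[OF pos M0 this]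
      have sm: "summable (\<lambda>n. 1 / root (Suc n) (M (Suc n)))" .
      \<comment> \<open>\<open>carleman\<close> runs over the even orders only; they form a
        subseries of the root series with nonnegative terms, so summability passes to them.\<close>
      have inj: "inj (\<lambda>k. 2 * k + 1 :: nat)" by (auto simp: inj_def)
      have "(\<lambda>n. 1 / root (Suc n) (M (Suc n))) summable_on UNIV"
        using sm pos by (subst summable_on_UNIV_nonneg_real_iff) (auto simp: less_imp_le)
      then have "(\<lambda>n. 1 / root (Suc n) (M (Suc n))) summable_on range (\<lambda>k. 2 * k + 1)"
        by (rule summable_on_subset_banach) simp
      then have "(\<lambda>k. 1 / root (2 * Suc k) (M (2 * Suc k))) summable_on UNIV"
        by (subst (asm) summable_on_reindex[OF inj]) (simp add: o_def)
      then have sm2: "summable (\<lambda>k. 1 / root (2 * Suc k) (M (2 * Suc k)))"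
        using pos by (subst (asm) summable_on_UNIV_nonneg_real_iff) (auto simp: less_imp_le simp del: mult_Suc_right)
      have rp: "root (2 * Suc k) (M (2 * Suc k)) > 0" for k using pos by (simp del: mult_Suc_right)
      have rle: "root (2 * Suc k) (M (2 * Suc k)) \<le> root (2 * Suc k) (\<beta> (2 * Suc k))" for k
        using le[of "Suc k"] M_even[of "Suc k"] by (simp del: mult_Suc_right)
      have "(\<Sum>k. inverse (ennreal (root (2 * Suc k) (\<beta> (2 * Suc k)))))
         \<le> (\<Sum>k. ennreal (1 / root (2 * Suc k) (M (2 * Suc k))))"
      proof (rule suminf_le)
        fix k
        have b: "root (2 * Suc k) (\<beta> (2 * Suc k)) > 0" using rp[of k] rle[of k] by linarith
        have "inverse (ennreal (root (2 * Suc k) (\<beta> (2 * Suc k)))) = ennreal (1 / root (2 * Suc k) (\<beta> (2 * Suc k)))"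
          unfolding inverse_ennreal[OF b] by (simp only: inverse_eq_divide)
        also have "\<dots> \<le> ennreal (1 / root (2 * Suc k) (M (2 * Suc k)))"
          by (rule ennreal_leI, rule divide_left_mono[OF rle]) (use b rp[of k] in \<open>auto simp del: mult_Suc_right\<close>)
        finally show "inverse (ennreal (root (2 * Suc k) (\<beta> (2 * Suc k)))) \<le> \<dots>" .
      qed auto
      also have "\<dots> = ennreal (\<Sum>k. 1 / root (2 * Suc k) (M (2 * Suc k)))"
        using rp sm2 by (intro suminf_ennreal2) (auto simp: less_imp_le simp del: mult_Suc_right)
      also have "\<dots> < \<infinity>" by simp
      finally show False using carl unfolding carleman_def by simp
    qed
    \<comment> \<open>The sign \<open>s\<close> reflects the argument, since
      \<open>bang_quasi_analytic\<close> covers only \<open>y \<ge> 0\<close>; \<open>s ^ n\<close>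
      comes from the chain rule, and the division by 2 matches the average in
      \<open>M\<close>.\<close>
    define f where "f \<theta> s n t = s ^ n * (cos_moment \<mu> \<theta> n (s * t) - cos_moment \<nu> \<theta> n (s * t)) / 2" for \<theta> s n and t :: real
    have vanish: "f \<theta> s 0 y = 0" if s: "s \<in> {1, -1}" and y: "y \<ge> 0" for \<theta> s y
    proof (rule bang_quasi_analytic[of "f \<theta> s" M])
      fix n t
      have D: "((\<lambda>t. cos_moment \<rho> \<theta> n (s * t)) has_real_derivative cos_moment \<rho> \<theta> (Suc n) (s * t) * s) (at t)"
        if "real_distribution \<rho>" "\<And>k. integrable \<rho> (\<lambda>s. s ^ k)" for \<rho>
        by (rule DERIV_chain2[OF cos_moment_deriv[OF that]]) (auto intro!: derivative_eq_intros)
      show "(f \<theta> s n has_real_derivative f \<theta> s (Suc n) t) (at t)"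
        using DERIV_cdivide[OF DERIV_cmult[OF DERIV_diff[OF D[OF \<mu>(1) \<mu>f] D[OF \<nu>(1) \<nu>f]]], of "s ^ n" 2]
        unfolding f_def by (rule DERIV_cong) (simp add: algebra_simps)
      have "\<bar>s ^ n\<bar> = 1" using s by (auto simp: power_abs)
      then have "\<bar>f \<theta> s n t\<bar> = \<bar>cos_moment \<mu> \<theta> n (s * t) - cos_moment \<nu> \<theta> n (s * t)\<bar> / 2"
        by (simp add: f_def abs_mult)
      then show "\<bar>f \<theta> s n t\<bar> \<le> M n"
        using cos_moment_bound[OF \<mu>(1) \<mu>f, of \<theta> n "s * t"] cos_moment_bound[OF \<nu>(1) \<nu>f, of \<theta> n "s * t"]
        unfolding M_def by (auto intro: divide_right_mono)
      show "f \<theta> s n 0 = 0"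
        using eq[of n] by (simp add: f_def cos_moment_def moment_def)
    qed (rule pos lc div y)+
    have "cos_moment \<mu> \<theta> 0 t = cos_moment \<nu> \<theta> 0 t" for \<theta> t
      using vanish[of 1 t \<theta>] vanish[of "-1" "-t" \<theta>] by (cases "t \<ge> 0") (auto simp: f_def)
    then show ?thesis
      by (auto simp: char_eq_cos_moment[OF \<mu>(1) \<mu>f] char_eq_cos_moment[OF \<nu>(1) \<nu>f])
  qed
qed

section \<open>The method of moments\<close>

text \<open>Rests on \<open>\<bar>u\<bar> \<le> 1 + u\<^sup>2\<close> for
  \<open>u = X \<omega> ^ j\<close>; this is the way from even to odd orders.\<close>

lemma integrable_power_of_double:
  fixes X :: "'a \<Rightarrow> real"
  assumes "prob_space M" "X \<in> borel_measurable M" "integrable M (\<lambda>\<omega>. X \<omega> ^ (2 * j))"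
  shows "integrable M (\<lambda>\<omega>. X \<omega> ^ j)"
proof -
  interpret prob_space M by fact
  note [measurable] = assms(2)
  show ?thesis
  proof (rule Bochner_Integration.integrable_bound[of _ "\<lambda>\<omega>. 1 + X \<omega> ^ (2 * j)"])
    show "integrable M (\<lambda>\<omega>. 1 + X \<omega> ^ (2 * j))" using assms(3) by simp
    have "\<bar>s ^ j\<bar> \<le> 1 + s ^ (2 * j)" for s :: real
    proof -
      have "0 \<le> (\<bar>s ^ j\<bar> - 1)\<^sup>2 + 1 + \<bar>s ^ j\<bar>\<^sup>2" by simp
      moreover have "\<bar>s ^ j\<bar>\<^sup>2 = s ^ (2 * j)" by (simp add: power_even_eq)
      ultimately show ?thesis by (simp add: power2_diff)
    qed
    then show "AE \<omega> in M. norm (X \<omega> ^ j) \<le> norm (1 + X \<omega> ^ (2 * j))" by (auto simp: abs_of_nonneg)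
  qed measurable
qed

text \<open>Weak convergence alone does not carry moments. Finiteness of the even ones comes from
  Fatou's lemma, convergence from truncation: the moments of order \<open>2 * k\<close> converge and
  control the tails of \<open>s ^ k\<close> uniformly in \<open>n\<close>.\<close>

lemma weak_limit_moments:
  assumes \<nu>: "\<And>n. real_distribution (\<nu> n)" "\<And>n. all_moments_finite (\<nu> n)"
    and \<mu>: "real_distribution \<mu>" and wc: "weak_conv_m \<nu> \<mu>"
    and lim: "\<And>k. (\<lambda>n. moment (\<nu> n) k) \<longlonglongrightarrow> m k"
  shows "all_moments_finite \<mu>" and "moment \<mu> k = m k"
proof -
  interpret \<nu>: real_distribution "\<nu> n" for n by fact
  interpret \<mu>: real_distribution \<mu> by fact
  note \<nu>f = \<nu>(2)[unfolded all_moments_finite_def, rule_format]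
  have ev: "integrable \<mu> (\<lambda>s. s ^ (2 * k))" for k
  proof -
    \<comment> \<open>Skorohod's representation turns weak convergence into pointwise convergence,
      to which Fatou's lemma applies.\<close>
    obtain \<Omega> :: "real measure" and Y_seq Y where P: "prob_space \<Omega>"
      "\<And>n. Y_seq n \<in> borel_measurable \<Omega>" "\<And>n. distr \<Omega> borel (Y_seq n) = \<nu> n"
      "Y \<in> borel_measurable \<Omega>" "distr \<Omega> borel Y = \<mu>"
      "\<And>x. x \<in> space \<Omega> \<Longrightarrow> (\<lambda>n. Y_seq n x) \<longlonglongrightarrow> Y x"
      using Skorohod[OF \<nu>(1) \<mu> wc] by force
    note [measurable] = P(2,4)
    have "(\<integral>\<^sup>+ s. ennreal (s ^ (2 * k)) \<partial>\<mu>) = (\<integral>\<^sup>+ x. ennreal (Y x ^ (2 * k)) \<partial>\<Omega>)"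
      unfolding P(5)[symmetric] by (subst nn_integral_distr) auto
    also have "\<dots> = (\<integral>\<^sup>+ x. liminf (\<lambda>n. ennreal (Y_seq n x ^ (2 * k))) \<partial>\<Omega>)"
    proof (rule nn_integral_cong)
      fix x assume "x \<in> space \<Omega>"
      then have "(\<lambda>n. ennreal (Y_seq n x ^ (2 * k))) \<longlonglongrightarrow> ennreal (Y x ^ (2 * k))"
        by (intro tendsto_ennrealI tendsto_power P(6))
      then show "ennreal (Y x ^ (2 * k)) = liminf (\<lambda>n. ennreal (Y_seq n x ^ (2 * k)))"
        by (metis lim_imp_Liminf sequentially_bot)
    qed
    also have "\<dots> \<le> liminf (\<lambda>n. \<integral>\<^sup>+ x. ennreal (Y_seq n x ^ (2 * k)) \<partial>\<Omega>)"
      by (rule nn_integral_liminf) measurable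
    also have "\<dots> = liminf (\<lambda>n. ennreal (moment (\<nu> n) (2 * k)))"
    proof -
      have "(\<integral>\<^sup>+ x. ennreal (Y_seq n x ^ (2 * k)) \<partial>\<Omega>) = ennreal (moment (\<nu> n) (2 * k))" for n
      proof -
        have "(\<integral>\<^sup>+ x. ennreal (Y_seq n x ^ (2 * k)) \<partial>\<Omega>) = (\<integral>\<^sup>+ s. ennreal (s ^ (2 * k)) \<partial>\<nu> n)"
          unfolding P(3)[of n, symmetric] by (subst nn_integral_distr) auto
        also have "\<dots> = ennreal (moment (\<nu> n) (2 * k))"
          unfolding moment_def by (rule nn_integral_eq_integral) (use \<nu>f in auto)
        finally show ?thesis .
      qed
      then show ?thesis by simp
    qed
    also have "\<dots> = ennreal (m (2 * k))"
      using tendsto_ennrealI[OF lim[of "2 * k"]] by (metis lim_imp_Liminf sequentially_bot)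
    finally have "(\<integral>\<^sup>+ s. ennreal (s ^ (2 * k)) \<partial>\<mu>) < \<infinity>"
      by (rule le_less_trans) (simp add: less_top[symmetric])
    then show ?thesis by (intro integrableI_nonneg) auto
  qed
  have fin: "integrable \<mu> (\<lambda>s. s ^ k)" for k
    by (rule integrable_power_of_double[OF \<mu>.prob_space_axioms _ ev]) simp
  then show "all_moments_finite \<mu>" by (simp add: all_moments_finite_def)
  show "moment \<mu> k = m k"
  \<comment> \<open>The truncation error of order \<open>2 / K ^ k\<close> does not tend to 0 at
    \<open>k = 0\<close>, so the total mass is treated apart.\<close>
  proof (cases "k = 0")
    case True
    have "moment (\<nu> n) 0 = 1" for n using \<nu>.prob_space[of n] by (simp add: moment_def)
    then have "(\<lambda>n. moment (\<nu> n) 0) \<longlonglongrightarrow> 1" by simp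
    then have "m 0 = 1" by (rule LIMSEQ_unique[OF lim])
    then show ?thesis using True \<mu>.prob_space by (simp add: moment_def)
  next
    case False
    define c where "c K s = (max (- K) (min K s)) ^ k" for K s :: real
    have c_bd: "\<bar>c K s\<bar> \<le> K ^ k" if "K \<ge> 0" for K s
      unfolding c_def power_abs using that by (intro power_mono) (auto simp: max_def min_def)
    have c_cont: "isCont (c K) s" for K s unfolding c_def by (intro continuous_intros)
    have [measurable]: "c K \<in> borel_measurable borel" for K unfolding c_def by measurable
    \<comment> \<open>Outside \<open>{- K..K}\<close> both terms are at most
      \<open>\<bar>s\<bar> ^ k\<close> in modulus, and \<open>K ^ k \<le> \<bar>s\<bar> ^ k\<close>
      there supplies the second power.\<close>
    have c_diff: "\<bar>s ^ k - c K s\<bar> \<le> 2 / K ^ k * s ^ (2 * k)" if "K > 0" for K s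
    proof (cases "\<bar>s\<bar> \<le> K")
      case True
      then have "max (- K) (min K s) = s" by (simp add: min.absorb2 max.absorb2 abs_le_iff)
      then have "c K s = s ^ k" unfolding c_def by simp
      then show ?thesis using that by simp
    next
      case f: False
      then have Ks: "K ^ k \<le> \<bar>s\<bar> ^ k" using that by (intro power_mono) auto
      have "\<bar>s ^ k - c K s\<bar> \<le> \<bar>s\<bar> ^ k + K ^ k"
        using abs_triangle_ineq4[of "s ^ k" "c K s"] c_bd[of K s] that by (simp add: power_abs)
      also have "\<dots> \<le> 2 * \<bar>s\<bar> ^ k" using Ks by simp
      finally have 1: "\<bar>s ^ k - c K s\<bar> \<le> 2 * \<bar>s\<bar> ^ k" .
      have "\<bar>s\<bar> ^ k * K ^ k \<le> \<bar>s\<bar> ^ k * \<bar>s\<bar> ^ k" using Ks by (intro mult_left_mono) auto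
      also have "\<dots> = s ^ (2 * k)" by (simp add: mult_2 power_add[symmetric] power_even_abs)
      finally have 2: "\<bar>s\<bar> ^ k * K ^ k \<le> s ^ (2 * k)" .
      have "\<bar>s ^ k - c K s\<bar> * K ^ k \<le> 2 * \<bar>s\<bar> ^ k * K ^ k"
        using 1 that by (intro mult_right_mono) auto
      also have "\<dots> \<le> 2 * s ^ (2 * k)" using 2 by simp
      finally show ?thesis using that by (simp add: pos_le_divide_eq)
    qed
    have c_int: "integrable \<rho> (c K)" if "real_distribution \<rho>" "K > 0" for \<rho> K
    proof -
      interpret real_distribution \<rho> by fact
      show ?thesis by (rule integrable_const_bound[of _ "K ^ k"]) (use c_bd[of K] that in auto)
    qed
    have trunc: "\<bar>moment \<rho> k - (\<integral>s. c K s \<partial>\<rho>)\<bar> \<le> 2 / K ^ k * moment \<rho> (2 * k)"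
      if "real_distribution \<rho>" "\<And>k. integrable \<rho> (\<lambda>s. s ^ k)" "K > 0" for \<rho> K
    proof -
      have "moment \<rho> k - (\<integral>s. c K s \<partial>\<rho>) = (\<integral>s. s ^ k - c K s \<partial>\<rho>)"
        unfolding moment_def using that(2) c_int[OF that(1,3)] by simp
      then have "\<bar>moment \<rho> k - (\<integral>s. c K s \<partial>\<rho>)\<bar> \<le> (\<integral>s. \<bar>s ^ k - c K s\<bar> \<partial>\<rho>)"
        using integral_abs_bound by metis
      also have "\<dots> \<le> (\<integral>s. 2 / K ^ k * s ^ (2 * k) \<partial>\<rho>)"
        using that(2)[of k] that(2)[of "2 * k"] c_int[OF that(1,3)] c_diff[OF that(3)]
        by (intro integral_mono) auto
      finally show ?thesis by (simp add: moment_def)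
    qed
    have key: "\<bar>m k - moment \<mu> k\<bar> \<le> (2 * m (2 * k) + 2 * moment \<mu> (2 * k)) / K ^ k" if K: "K > 0" for K
    proof -
      have "(\<lambda>n. \<integral>s. c K s \<partial>\<nu> n) \<longlonglongrightarrow> (\<integral>s. c K s \<partial>\<mu>)"
        by (rule weak_conv_imp_integral_bdd_continuous_conv[OF \<nu>(1) \<mu> wc c_cont, of _ "K ^ k"])
          (use c_bd K in auto)
      then have L: "(\<lambda>n. \<bar>moment (\<nu> n) k - (\<integral>s. c K s \<partial>\<nu> n)\<bar>) \<longlonglongrightarrow> \<bar>m k - (\<integral>s. c K s \<partial>\<mu>)\<bar>"
        by (intro tendsto_rabs tendsto_diff lim)
      have R: "(\<lambda>n. 2 / K ^ k * moment (\<nu> n) (2 * k)) \<longlonglongrightarrow> 2 / K ^ k * m (2 * k)"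
        by (intro tendsto_mult_left lim)
      have "\<bar>m k - (\<integral>s. c K s \<partial>\<mu>)\<bar> \<le> 2 / K ^ k * m (2 * k)"
        by (rule LIMSEQ_le[OF L R]) (use trunc[OF \<nu>(1) \<nu>f K] in auto)
      moreover have "\<bar>moment \<mu> k - (\<integral>s. c K s \<partial>\<mu>)\<bar> \<le> 2 / K ^ k * moment \<mu> (2 * k)"
        by (rule trunc[OF \<mu> fin K])
      ultimately show ?thesis by (simp add: add_divide_distrib)
    qed
    have "((\<lambda>K. (2 * m (2 * k) + 2 * moment \<mu> (2 * k)) / K ^ k) \<longlongrightarrow> 0) at_top"
      using False by (intro tendsto_divide_0[OF tendsto_const] filterlim_at_top_imp_at_infinity
        filterlim_pow_at_top filterlim_ident) auto
    moreover have "\<forall>\<^sub>F K in at_top. \<bar>m k - moment \<mu> k\<bar> \<le> (2 * m (2 * k) + 2 * moment \<mu> (2 * k)) / K ^ k"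
      using eventually_gt_at_top[of 0] by (rule eventually_mono) (rule key)
    ultimately have "\<bar>m k - moment \<mu> k\<bar> \<le> 0"
      by (rule tendsto_lowerbound) simp
    then show ?thesis by simp
  qed
qed

lemma tight_of_moment_2:
  assumes \<nu>: "\<And>n. real_distribution (\<nu> n)" "\<And>n. integrable (\<nu> n) (\<lambda>s. s ^ 2)"
    and lim: "(\<lambda>n. moment (\<nu> n) 2) \<longlonglongrightarrow> (L::real)"
  shows "tight \<nu>"
  unfolding tight_def
proof (intro conjI allI impI \<nu>(1))
  fix \<epsilon> :: real assume \<epsilon>: "\<epsilon> > 0"
  obtain B where B: "B > 0" "\<And>n. \<bar>moment (\<nu> n) 2\<bar> \<le> B"
    using convergent_imp_Bseq[OF convergentI[OF lim]] by (auto simp: Bseq_def)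
  \<comment> \<open>Chosen so that Markov's inequality for \<open>s\<^sup>2\<close> leaves mass at
    most \<open>\<epsilon> / 2\<close> outside the interval, strictly below
    \<open>\<epsilon>\<close>.\<close>
  define a where "a = sqrt (2 * B / \<epsilon>)"
  have a: "a > 0" "a\<^sup>2 = 2 * B / \<epsilon>" using B \<epsilon> by (auto simp: a_def)
  have "1 - \<epsilon> < measure (\<nu> n) {-a<..a}" for n
  proof -
    interpret real_distribution "\<nu> n" by fact
    have "prob (UNIV - {-a<..a}) \<le> prob {s \<in> space (\<nu> n). a\<^sup>2 \<le> s\<^sup>2}"
    proof (rule finite_measure_mono)
      show "UNIV - {-a<..a} \<subseteq> {s \<in> space (\<nu> n). a\<^sup>2 \<le> s\<^sup>2}"
        using a(1) by (auto simp: abs_le_square_iff[symmetric])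
    qed simp
    also have "\<dots> \<le> expectation (\<lambda>s. s\<^sup>2) / a\<^sup>2"
      by (rule integral_Markov_inequality_measure[OF \<nu>(2)]) (use a(1) in auto)
    also have "\<dots> \<le> B / a\<^sup>2" using B(2)[of n] a(1) by (intro divide_right_mono) (auto simp: moment_def)
    also have "\<dots> = \<epsilon> / 2" using a B \<epsilon> by simp
    finally have "prob (UNIV - {-a<..a}) < \<epsilon>" using \<epsilon> by simp
    then show ?thesis using prob_compl[of "{-a<..a}"] by simp
  qed
  then show "\<exists>a b. a < b \<and> (\<forall>n. 1 - \<epsilon> < measure (\<nu> n) {a<..b})"
    using a(1) by (intro exI[of _ "-a"] exI[of _ a]) auto
qed

text \<open>By tightness some subsequence converges weakly, and its limit already has the right
  moments; uniqueness of that limit is a separate question.\<close>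

theorem moment_limit_exists:
  assumes \<nu>: "\<And>n. real_distribution (\<nu> n)" "\<And>n. all_moments_finite (\<nu> n)"
    and lim: "\<And>k. (\<lambda>n. moment (\<nu> n) k) \<longlonglongrightarrow> m k"
  obtains \<mu> where "real_distribution \<mu>" "all_moments_finite \<mu>" "\<And>k. moment \<mu> k = m k"
proof -
  have t: "tight \<nu>"
    by (rule tight_of_moment_2[OF \<nu>(1) _ lim]) (use \<nu>(2) in \<open>auto simp: all_moments_finite_def\<close>)
  obtain r \<mu> where r: "strict_mono (r :: nat \<Rightarrow> nat)" "real_distribution \<mu>" "weak_conv_m (\<nu> \<circ> id \<circ> r) \<mu>"
    using tight_imp_convergent_subsubsequence[OF t strict_mono_id] by blast
  have lim': "(\<lambda>n. moment ((\<nu> \<circ> id \<circ> r) n) k) \<longlonglongrightarrow> m k" for k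
    using LIMSEQ_subseq_LIMSEQ[OF lim[of k] r(1)] by (simp add: o_def)
  show ?thesis
  proof (rule that[OF r(2)])
    show "all_moments_finite \<mu>" by (rule weak_limit_moments(1)[OF _ _ r(2,3) lim']) (use \<nu> in auto)
    show "moment \<mu> k = m k" for k by (rule weak_limit_moments(2)[OF _ _ r(2,3) lim']) (use \<nu> in auto)
  qed
qed

definition moment_determinate :: "real measure \<Rightarrow> bool" where
  "moment_determinate \<mu> \<longleftrightarrow> (\<forall>\<nu>. real_distribution \<nu> \<longrightarrow> all_moments_finite \<nu> \<longrightarrow>
     (\<forall>k. moment \<nu> k = moment \<mu> k) \<longrightarrow> \<nu> = \<mu>)"

text \<open>By tightness it is enough to identify the subsequential limits; each of them has the
  moments of \<open>\<mu>\<close> and therefore is \<open>\<mu>\<close>.\<close>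

theorem method_of_moments:
  assumes \<nu>: "\<And>n. real_distribution (\<nu> n)" "\<And>n. all_moments_finite (\<nu> n)"
    and \<mu>: "real_distribution \<mu>" "moment_determinate \<mu>"
    and lim: "\<And>k. (\<lambda>n. moment (\<nu> n) k) \<longlonglongrightarrow> moment \<mu> k"
  shows "weak_conv_m \<nu> \<mu>"
proof (rule tight_subseq_weak_converge[OF \<nu>(1) \<mu>(1)])
  show "tight \<nu>"
    by (rule tight_of_moment_2[OF \<nu>(1) _ lim]) (use \<nu>(2) in \<open>auto simp: all_moments_finite_def\<close>)
  fix s \<rho> assume s: "strict_mono (s :: nat \<Rightarrow> nat)" "real_distribution \<rho>" "weak_conv_m (\<nu> \<circ> s) \<rho>"
  have lim': "(\<lambda>n. moment ((\<nu> \<circ> s) n) k) \<longlonglongrightarrow> moment \<mu> k" for k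
    using LIMSEQ_subseq_LIMSEQ[OF lim[of k] s(1)] by (simp add: o_def)
  have "all_moments_finite \<rho>" by (rule weak_limit_moments(1)[OF _ _ s(2,3) lim']) (use \<nu> in auto)
  moreover have "moment \<rho> k = moment \<mu> k" for k
    by (rule weak_limit_moments(2)[OF _ _ s(2,3) lim']) (use \<nu> in auto)
  ultimately have "\<rho> = \<mu>" using \<mu>(2) s(2) unfolding moment_determinate_def by blast
  then show "weak_conv_m (\<nu> \<circ> s) \<mu>" using s(3) by simp
qed

text \<open>Used to replace events about the distribution function of a random measure, whose measurability
  is not obvious, by events about its moments.\<close>
lemma cdf_close_of_moments_close:
  assumes \<mu>: "real_distribution \<mu>" "moment_determinate \<mu>" and s: "isCont (cdf \<mu>) s" and d: "d > 0"
  obtains K :: nat and \<eta> :: real where "\<eta> > 0"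
    "\<And>\<nu>. real_distribution \<nu> \<Longrightarrow> all_moments_finite \<nu> \<Longrightarrow>
      (\<forall>k\<le>K. \<bar>moment \<nu> k - moment \<mu> k\<bar> \<le> \<eta>) \<Longrightarrow> \<bar>cdf \<nu> s - cdf \<mu> s\<bar> \<le> d"
proof -
  have "\<exists>K \<eta>. \<eta> > 0 \<and> (\<forall>\<nu>. real_distribution \<nu> \<longrightarrow> all_moments_finite \<nu> \<longrightarrow>
      (\<forall>k\<le>K. \<bar>moment \<nu> k - moment \<mu> k\<bar> \<le> \<eta>) \<longrightarrow> \<bar>cdf \<nu> s - cdf \<mu> s\<bar> \<le> d)"
  proof (rule ccontr)
    assume no: "\<not> ?thesis"
    \<comment> \<open>Counterexamples for \<open>K = n\<close> and
      \<open>\<eta> = 1 / (n + 1)\<close> form a sequence with converging moments, so the method of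
      moments contradicts the fixed gap \<open>d\<close>.\<close>
    have "\<forall>n. \<exists>\<nu>. real_distribution \<nu> \<and> all_moments_finite \<nu> \<and>
      (\<forall>k\<le>n. \<bar>moment \<nu> k - moment \<mu> k\<bar> \<le> inverse (real (Suc n))) \<and> d < \<bar>cdf \<nu> s - cdf \<mu> s\<bar>"
    proof
      fix n
      have "inverse (real (Suc n)) > 0" by simp
      with no show "\<exists>\<nu>. real_distribution \<nu> \<and> all_moments_finite \<nu> \<and>
        (\<forall>k\<le>n. \<bar>moment \<nu> k - moment \<mu> k\<bar> \<le> inverse (real (Suc n))) \<and> d < \<bar>cdf \<nu> s - cdf \<mu> s\<bar>"
        by (meson not_le)
    qed
    then obtain \<nu> where \<nu>: "\<And>n. real_distribution (\<nu> n)" "\<And>n. all_moments_finite (\<nu> n)"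
      "\<And>n k. k \<le> n \<Longrightarrow> \<bar>moment (\<nu> n) k - moment \<mu> k\<bar> \<le> inverse (real (Suc n))"
      "\<And>n. d < \<bar>cdf (\<nu> n) s - cdf \<mu> s\<bar>"
      by metis
    have "(\<lambda>n. moment (\<nu> n) k) \<longlonglongrightarrow> moment \<mu> k" for k
    proof (rule LIM_zero_cancel, rule Lim_null_comparison)
      show "\<forall>\<^sub>F n in sequentially. norm (moment (\<nu> n) k - moment \<mu> k) \<le> inverse (real (Suc n))"
        using eventually_ge_at_top[of k] by eventually_elim (use \<nu>(3) in auto)
      show "(\<lambda>n. inverse (real (Suc n))) \<longlonglongrightarrow> 0" by (rule LIMSEQ_inverse_real_of_nat)
    qed
    from method_of_moments[OF \<nu>(1,2) \<mu> this]
    have "(\<lambda>n. cdf (\<nu> n) s) \<longlonglongrightarrow> cdf \<mu> s"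
      using s by (simp add: weak_conv_m_def weak_conv_def)
    from tendstoD[OF this d] have "\<exists>n. dist (cdf (\<nu> n) s) (cdf \<mu> s) < d"
      by (auto simp: eventually_sequentially)
    then show False using \<nu>(4) by (auto simp: dist_real_def) (meson less_asym)
  qed
  then show ?thesis using that by blast
qed

section \<open>Closed walks and trees\<close>

text \<open>Steps are numbered from 1 to \<open>k\<close>, step \<open>i\<close> leading from
  \<open>p (i - 1)\<close> to \<open>p i\<close>. Edges are unordered because the matrices are
  symmetric, and a loop is a singleton.\<close>

definition walk_edge :: "(nat \<Rightarrow> 'v) \<Rightarrow> nat \<Rightarrow> 'v set" where
  "walk_edge p i = {p (i - 1), p i}"

text \<open>Steps lie in one block if they read the same entry of the symmetric matrix. By
  independence the mean of the product of entries along a walk depends on this partition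
  only.\<close>

definition edge_part :: "(nat \<Rightarrow> 'v) \<Rightarrow> nat \<Rightarrow> nat set set" where
  "edge_part p k = (\<lambda>e. {i \<in> {1..k}. walk_edge p i = e}) ` walk_edge p ` {1..k}"

text \<open>The graph traversed by a walk is connected, and a connected graph with one vertex more
  than it has edges is a tree. The count is taken as the definition because it is what the
  asymptotics compare.\<close>

definition tree_walk :: "(nat \<Rightarrow> 'v) \<Rightarrow> nat \<Rightarrow> bool" where
  "tree_walk p k \<longleftrightarrow> p 0 = p k \<and> card (p ` {0..k}) = Suc (card (walk_edge p ` {1..k}))"

lemma edge_part_partition: "partition_on {1..k} (edge_part p k)"
  unfolding edge_part_def by (rule partition_onI) (auto simp: disjnt_def)

lemma edge_part_inj: "inj_on (\<lambda>e. {i \<in> {1..k}. walk_edge p i = e}) (walk_edge p ` {1..k})"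
proof (rule inj_onI)
  fix e f assume "e \<in> walk_edge p ` {1..k}"
    and eq: "{i \<in> {1..k}. walk_edge p i = e} = {i \<in> {1..k}. walk_edge p i = f}"
  then obtain i where "i \<in> {1..k}" "walk_edge p i = e" by blast
  then have "i \<in> {i \<in> {1..k}. walk_edge p i = f}" unfolding eq[symmetric] by blast
  then show "e = f" using \<open>walk_edge p i = e\<close> by blast
qed

lemma card_edge_part: "card (edge_part p k) = card (walk_edge p ` {1..k})"
  unfolding edge_part_def by (rule card_image[OF edge_part_inj])

lemma edge_part_eqI:
  assumes "partition_on {1..k} \<sigma>"
    and "\<And>i j. i \<in> {1..k} \<Longrightarrow> j \<in> {1..k} \<Longrightarrow> walk_edge p i = walk_edge p j \<longleftrightarrow> (\<exists>U\<in>\<sigma>. i \<in> U \<and> j \<in> U)"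
  shows "edge_part p k = \<sigma>"
proof -
  have *: "{j \<in> {1..k}. walk_edge p j = walk_edge p i} = U" if "U \<in> \<sigma>" "i \<in> U" for U i
  proof -
    have "i \<in> {1..k}" using that partition_onD1[OF assms(1)] by auto
    have "U \<subseteq> {1..k}" using that partition_onD1[OF assms(1)] by auto
    moreover have "U' = U" if "U' \<in> \<sigma>" "i \<in> U'" for U'
      using partition_onD2[OF assms(1)] that \<open>U \<in> \<sigma>\<close> \<open>i \<in> U\<close> by (auto simp: disjoint_def)
    ultimately show ?thesis using that \<open>i \<in> {1..k}\<close> assms(2) by blast
  qed
  show ?thesis
  proof
    show "edge_part p k \<subseteq> \<sigma>"
    proof
      fix W assume "W \<in> edge_part p k"
      then obtain i where i: "i \<in> {1..k}" "W = {j \<in> {1..k}. walk_edge p j = walk_edge p i}"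
        by (auto simp: edge_part_def)
      have "i \<in> \<Union>\<sigma>" using i(1) partition_onD1[OF assms(1)] by metis
      then obtain U where "U \<in> \<sigma>" "i \<in> U" by blast
      then show "W \<in> \<sigma>" using * i by auto
    qed
    show "\<sigma> \<subseteq> edge_part p k"
    proof
      fix U assume U: "U \<in> \<sigma>"
      then obtain i where i: "i \<in> U" using partition_onD3[OF assms(1)] by fastforce
      have "i \<in> {1..k}" using i U partition_onD1[OF assms(1)] by auto
      then show "U \<in> edge_part p k" unfolding edge_part_def using *[OF U i]
        by (intro image_eqI[of _ _ "walk_edge p i"]) auto
    qed
  qed
qed

lemma first_visit:
  assumes "v \<in> p ` {0..k} - {p (0::nat)}"
  defines "j \<equiv> LEAST j. p j = v"
  shows "j \<in> {1..k}" "p j = v" "\<And>i. i < j \<Longrightarrow> p i \<noteq> v"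
proof -
  obtain i where i: "i \<le> k" "p i = v" using assms by auto
  show pj: "p j = v" unfolding j_def by (rule LeastI[of _ i]) (rule i)
  have "j \<le> i" unfolding j_def by (rule Least_le) (rule i)
  moreover have "j \<noteq> 0" using pj assms by (metis DiffD2 singletonI)
  ultimately show "j \<in> {1..k}" using i by auto
  show "p i \<noteq> v" if "i < j" for i using that unfolding j_def by (rule not_less_Least)
qed

text \<open>If \<open>v\<close> and \<open>w\<close> were first entered through the same edge, that
  edge would be \<open>{v, w}\<close>, and each vertex would be visited one step before the first
  visit to the other.\<close>

lemma first_visit_edge_inj:
  "inj_on (\<lambda>v. walk_edge p (LEAST j. p j = v)) (p ` {0..k} - {p 0})"
proof (rule inj_onI, rule ccontr)
  fix v w assume v: "v \<in> p ` {0..k} - {p 0}" and w: "w \<in> p ` {0..k} - {p 0}"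
    and eq: "walk_edge p (LEAST j. p j = v) = walk_edge p (LEAST j. p j = w)" and ne: "v \<noteq> w"
  note V = first_visit[OF v] and W = first_visit[OF w]
  let ?j = "LEAST j. p j = v" and ?l = "LEAST j. p j = w"
  have "p (?l - 1) = v" "p (?j - 1) = w"
    using eq ne V(2) W(2) unfolding walk_edge_def by (auto simp: doubleton_eq_iff)
  then have "\<not> ?l - 1 < ?j" "\<not> ?j - 1 < ?l" using V(3) W(3) by blast+
  then show False using V(1) W(1) by auto
qed

text \<open>Each vertex outside \<open>A\<close> is charged to the edge of its first visit. That
  edge contains the vertex, hence is not one of the edges \<open>F\<close> inside
  \<open>A\<close>.\<close>

lemma walk_new_vertices_le_start:
  assumes "p 0 \<in> A" "\<And>e. e \<in> F \<Longrightarrow> e \<subseteq> A"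
  shows "card (p ` {0..k} - A) \<le> card (walk_edge p ` {1..k} - F)"
proof (rule card_inj_on_le)
  show "inj_on (\<lambda>v. walk_edge p (LEAST j. p j = v)) (p ` {0..k} - A)"
    by (rule inj_on_subset[OF first_visit_edge_inj[of p k]]) (use assms in auto)
  show "(\<lambda>v. walk_edge p (LEAST j. p j = v)) ` (p ` {0..k} - A) \<subseteq> walk_edge p ` {1..k} - F"
  proof
    fix e assume "e \<in> (\<lambda>v. walk_edge p (LEAST j. p j = v)) ` (p ` {0..k} - A)"
    then obtain v where v: "v \<in> p ` {0..k} - A" "e = walk_edge p (LEAST j. p j = v)" by auto
    then have v': "v \<in> p ` {0..k} - {p 0}" using assms by auto
    note V = first_visit[OF v']
    have "v \<in> e" unfolding v(2) walk_edge_def using V(2) by simp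
    then show "e \<in> walk_edge p ` {1..k} - F" using V(1) v assms(2) by blast
  qed
qed simp

text \<open>A closed walk may be entered at any of its vertices, by rotation.\<close>
lemma walk_new_vertices_le:
  assumes closed: "p 0 = p k" and meet: "p ` {0..k} \<inter> A \<noteq> {}" and F: "\<And>e. e \<in> F \<Longrightarrow> e \<subseteq> A"
  shows "card (p ` {0..k} - A) \<le> card (walk_edge p ` {1..k} - F)"
proof (cases "k = 0")
  case True
  then show ?thesis using meet by auto
next
  case False
  obtain a where a: "a \<le> k" "p a \<in> A" using meet by auto
  have pm: "p (i mod k) = p i" if "i \<le> k" for i
    using that closed by (cases "i = k") auto
  \<comment> \<open>Rotation by \<open>a\<close>; indices may be taken modulo \<open>k\<close>
    because \<open>p k = p 0\<close>.\<close>
  define q where "q j = p ((a + j) mod k)" for j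
  have "card (p ` {0..k} - A) \<le> card (q ` {0..k} - A)"
  proof (rule card_mono)
    have "p i \<in> q ` {0..k}" if i: "i \<le> k" for i
    proof -
      have "(a + (i + (k - a)) mod k) mod k = (a + (i + (k - a))) mod k" by (simp add: mod_simps)
      also have "\<dots> = i mod k" using a by simp
      finally have "q ((i + (k - a)) mod k) = p i" unfolding q_def using pm[OF i] by simp
      moreover have "(i + (k - a)) mod k \<in> {0..k}" using False by (simp add: less_imp_le)
      ultimately show ?thesis by (metis imageI)
    qed
    then show "p ` {0..k} - A \<subseteq> q ` {0..k} - A" by auto
  qed simp
  also have "\<dots> \<le> card (walk_edge q ` {1..k} - F)"
    by (rule walk_new_vertices_le_start[OF _ F]) (use a pm in \<open>auto simp: q_def\<close>)
  also have "\<dots> \<le> card (walk_edge p ` {1..k} - F)"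
  proof (rule card_mono)
    have "walk_edge q j \<in> walk_edge p ` {1..k}" if j: "j \<in> {1..k}" for j
    proof -
      define i where "i = (a + (j - 1)) mod k"
      have i: "i < k" using False by (simp add: i_def)
      have "(a + j) mod k = Suc i mod k" using j unfolding i_def by (simp add: mod_simps)
      then have "walk_edge q j = {p i, p (Suc i mod k)}" unfolding walk_edge_def q_def i_def by simp
      also have "\<dots> = walk_edge p (Suc i)" using pm[of "Suc i"] i by (simp add: walk_edge_def)
      finally show ?thesis using i by auto
    qed
    then show "walk_edge q ` {1..k} - F \<subseteq> walk_edge p ` {1..k} - F" by auto
  qed simp
  finally show ?thesis .
qed

lemma walk_vertices_le:
  "p 0 = p k \<Longrightarrow> card (p ` {0..k}) \<le> Suc (card (walk_edge p ` {1..k}))"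
  using walk_new_vertices_le_start[of p "{p 0}" "{}" k] by (simp add: card_Diff_singleton_if)

section \<open>Cuts and parity along a walk\<close>

definition edge_cut :: "(nat \<Rightarrow> 'v) \<Rightarrow> nat \<Rightarrow> 'v set \<Rightarrow> 'v set set" where
  "edge_cut p k X = {e \<in> walk_edge p ` {1..k}. e \<inter> X \<noteq> {} \<and> \<not> e \<subseteq> X}"

lemma walk_edge_in_cut:
  "i \<in> {1..k} \<Longrightarrow> walk_edge p i \<in> edge_cut p k X \<longleftrightarrow> (p (i - 1) \<in> X) \<noteq> (p i \<in> X)"
  by (auto simp: edge_cut_def walk_edge_def)

text \<open>Membership in \<open>X\<close> changes exactly at the steps that pass through the
  cut.\<close>

lemma cut_parity:
  assumes "a \<le> c" "c \<le> k"
  shows "even (card {i \<in> {a<..c}. walk_edge p i \<in> edge_cut p k X}) \<longleftrightarrow> (p a \<in> X \<longleftrightarrow> p c \<in> X)"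
  using assms
proof (induction c rule: dec_induct)
  case (step c)
  have "{i \<in> {a<..Suc c}. walk_edge p i \<in> edge_cut p k X} = {i \<in> {a<..c}. walk_edge p i \<in> edge_cut p k X} \<union>
     (if walk_edge p (Suc c) \<in> edge_cut p k X then {Suc c} else {})"
    using step by (auto simp: le_Suc_eq)
  then have "card {i \<in> {a<..Suc c}. walk_edge p i \<in> edge_cut p k X} = card {i \<in> {a<..c}. walk_edge p i \<in> edge_cut p k X} +
     (if walk_edge p (Suc c) \<in> edge_cut p k X then 1 else 0)"
    by (auto simp: card_insert_if)
  moreover have "walk_edge p (Suc c) \<in> edge_cut p k X \<longleftrightarrow> (p c \<in> X) \<noteq> (p (Suc c) \<in> X)"
    using walk_edge_in_cut[of "Suc c" k p X] step by simp
  ultimately show ?case using step by auto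
qed simp

text \<open>Apply \<open>cut_parity\<close> to the one-point set \<open>{p a}\<close>: the steps
  through its cut are sorted by edge and each edge contributes an even number. This holds on any
  graph; on trees \<open>tree_walk_even\<close> is the converse.\<close>

lemma even_edge_counts_imp_closed:
  assumes "a \<le> c" "c \<le> k"
    and ev: "\<And>e. even (card {i \<in> {a<..c}. walk_edge p i = e})"
  shows "p a = p c"
proof -
  let ?X = "{p a}"
  have eq: "{i \<in> {a<..c}. walk_edge p i \<in> edge_cut p k ?X} = (\<Union>e\<in>edge_cut p k ?X. {i \<in> {a<..c}. walk_edge p i = e})" by auto
  have "card (\<Union>e\<in>edge_cut p k ?X. {i \<in> {a<..c}. walk_edge p i = e}) = (\<Sum>e\<in>edge_cut p k ?X. card {i \<in> {a<..c}. walk_edge p i = e})"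
    by (intro card_UN_disjoint) (auto simp: edge_cut_def)
  moreover have "even (\<Sum>e\<in>edge_cut p k ?X. card {i \<in> {a<..c}. walk_edge p i = e})"
    using ev by (intro dvd_sum) auto
  ultimately have "even (card {i \<in> {a<..c}. walk_edge p i \<in> edge_cut p k ?X})" using eq by simp
  then have "p a \<in> ?X \<longleftrightarrow> p c \<in> ?X" using cut_parity[OF assms(1,2), of p ?X] by (rule iffD1[rotated])
  then show ?thesis by simp
qed

text \<open>In a tree there are as many edge sets as vertex sets avoiding the root, and a vertex set is
  determined by its cut, so every edge set is a cut.\<close>
lemma tree_walk_cut:
  assumes "tree_walk p k" "e \<in> walk_edge p ` {1..k}"
  obtains X where "edge_cut p k X = {e}"
proof -
  let ?V = "p ` {0..k} - {p 0}" and ?E = "walk_edge p ` {1..k}"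
  have inj: "inj_on (edge_cut p k) (Pow ?V)"
  proof (rule inj_onI)
    fix X Y assume X: "X \<in> Pow ?V" and Y: "Y \<in> Pow ?V" and eq: "edge_cut p k X = edge_cut p k Y"
    have "p i \<in> X \<longleftrightarrow> p i \<in> Y" if "i \<le> k" for i
      using that
    proof (induction i)
      case (Suc i)
      then show ?case using walk_edge_in_cut[of "Suc i" k p X] walk_edge_in_cut[of "Suc i" k p Y] eq by auto
    qed (use X Y in auto)
    then show "X = Y" using X Y by auto
  qed
  have "card ?V = card ?E" using assms(1) by (simp add: tree_walk_def card_Diff_singleton_if)
  then have "card (edge_cut p k ` Pow ?V) = card (Pow ?E)"
    by (simp add: card_image[OF inj] card_Pow)
  moreover have "edge_cut p k ` Pow ?V \<subseteq> Pow ?E" by (auto simp: edge_cut_def)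
  ultimately have "edge_cut p k ` Pow ?V = Pow ?E" by (intro card_subset_eq) auto
  then have "{e} \<in> edge_cut p k ` Pow ?V" using assms(2) by auto
  then show ?thesis using that by auto
qed

text \<open>An edge of a tree is a cut by itself, so a walk that returns to its starting point
  crosses it an even number of times.\<close>

lemma tree_walk_even:
  assumes t: "tree_walk p k" and "a \<le> c" "c \<le> k" "p a = p c"
  shows "even (card {i \<in> {a<..c}. walk_edge p i = e})"
proof (cases "e \<in> walk_edge p ` {1..k}")
  case True
  obtain X where X: "edge_cut p k X = {e}" using tree_walk_cut[OF t True] .
  show ?thesis using cut_parity[OF assms(2,3), of p X] assms(4) X by simp
next
  case False
  then have none: "{i \<in> {a<..c}. walk_edge p i = e} = {}" using assms by fastforce
  show ?thesis unfolding none by simp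
qed

lemma tree_walk_block_even:
  assumes "tree_walk p k" "U \<in> edge_part p k" shows "even (card U)"
proof -
  obtain e where "U = {i \<in> {1..k}. walk_edge p i = e}" using assms(2) by (auto simp: edge_part_def)
  then have "U = {i \<in> {0<..k}. walk_edge p i = e}" by auto
  then show ?thesis using tree_walk_even[of p k 0 k e] assms(1) by (simp add: tree_walk_def)
qed

lemma tree_walk_length_even:
  assumes "tree_walk p k" shows "even k"
proof -
  have "{1..k} = \<Union>(edge_part p k)" using edge_part_partition partition_onD1 by blast
  then have "k = card (\<Union>(edge_part p k))" by (metis card_atLeastAtMost diff_Suc_1)
  also have "\<dots> = sum card (edge_part p k)"
    using edge_part_partition[of k p] by (intro card_Union_disjoint)
      (auto simp: partition_on_def disjoint_def pairwise_def disjnt_def edge_part_def)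
  finally have "k = sum card (edge_part p k)" .
  moreover have "even (sum card (edge_part p k))"
    using tree_walk_block_even[OF assms] by (intro dvd_sum) auto
  ultimately show ?thesis by simp
qed

section \<open>Special symmetric partitions\<close>

lemma rank_in_Suc:
  assumes "finite S" shows "rank_in S (Suc i) = rank_in S i + (if Suc i \<in> S then 1 else 0)"
proof -
  have "{b \<in> S. b \<le> Suc i} = {b \<in> S. b \<le> i} \<union> (if Suc i \<in> S then {Suc i} else {})"
    by (auto simp: le_Suc_eq)
  then show ?thesis unfolding rank_in_def using assms by (auto simp: card_insert_if)
qed

lemma rank_in_0: "0 \<notin> S \<Longrightarrow> rank_in S 0 = 0"
  unfolding rank_in_def by (simp add: card_eq_0_iff) (metis gr0I)

lemma rank_in_mono: "finite S \<Longrightarrow> i \<le> j \<Longrightarrow> rank_in S i \<le> rank_in S j"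
  unfolding rank_in_def by (intro card_mono) auto

lemma rank_in_strict_mono:
  assumes "finite S" "i < j" "j \<in> S" shows "rank_in S i < rank_in S j"
  unfolding rank_in_def
proof (rule psubset_card_mono)
  have "j \<in> {b \<in> S. b \<le> j}" "j \<notin> {b \<in> S. b \<le> i}" using assms by auto
  then show "{b \<in> S. b \<le> i} \<subset> {b \<in> S. b \<le> j}" using assms(2) by fastforce
qed (use assms(1) in simp)

lemma rank_in_inj: "finite S \<Longrightarrow> inj_on (rank_in S) S"
  by (rule inj_onI) (metis rank_in_strict_mono less_irrefl linorder_neqE_nat)

lemma rank_in_le_card: "finite S \<Longrightarrow> rank_in S i \<le> card S"
  unfolding rank_in_def by (intro card_mono) auto

lemma rank_in_top: "S \<subseteq> {..k} \<Longrightarrow> rank_in S k = card S"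
  unfolding rank_in_def by (rule arg_cong[of _ _ card]) auto

lemma rank_in_image: "finite S \<Longrightarrow> rank_in S ` S = {1..card S}"
proof (rule card_subset_eq)
  assume S: "finite S"
  have "1 \<le> rank_in S i" if "i \<in> S" for i
  proof -
    have "i \<in> {b \<in> S. b \<le> i}" using that by simp
    then have "card {b \<in> S. b \<le> i} > 0" using S by (auto simp: card_gt_0_iff)
    then show ?thesis by (simp add: rank_in_def)
  qed
  then show "rank_in S ` S \<subseteq> {1..card S}" using rank_in_le_card[OF S] by auto
  show "card (rank_in S ` S) = card {1..card S}" by (simp add: card_image[OF rank_in_inj[OF S]])
qed simp

lemma rank_in_pred:
  assumes "finite S" "i \<in> S" "0 \<notin> S" shows "rank_in S (i - 1) = rank_in S i - 1"
  using rank_in_Suc[OF assms(1), of "i - 1"] assms by (cases i) auto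

text \<open>Contraction of a walk: if \<open>g\<close> stands still at the positions outside
  \<open>S\<close>, deleting these positions loses nothing, and \<open>q\<close> is \<open>g\<close>
  read along the remaining ones.\<close>

lemma rank_in_factor:
  assumes "finite S" and const: "\<And>i. i \<in> {1..k} - S \<Longrightarrow> g (i - 1) = g i"
  obtains q where "\<And>i. i \<le> k \<Longrightarrow> g i = q (rank_in S i)"
proof -
  have eq: "g i = g j" if "i \<le> j" "j \<le> k" "rank_in S i = rank_in S j" for i j
    using that
  proof (induction j rule: dec_induct)
    case (step j)
    have "rank_in S i \<le> rank_in S j" by (rule rank_in_mono[OF assms(1) step(1)])
    then have "Suc j \<notin> S" "rank_in S i = rank_in S j"
      using step rank_in_Suc[OF assms(1), of j] by (auto split: if_splits)
    then show ?case using step const[of "Suc j"] by simp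
  qed simp
  show ?thesis
  proof (rule that[of "\<lambda>r. g (LEAST j. rank_in S j = r)"])
    fix i assume i: "i \<le> k"
    let ?j = "LEAST j. rank_in S j = rank_in S i"
    have "rank_in S ?j = rank_in S i" by (rule LeastI[of _ i]) simp
    moreover have "?j \<le> i" by (rule Least_le) simp
    ultimately show "g i = g (LEAST j. rank_in S j = rank_in S i)"
      using eq[of ?j i] i by simp
  qed
qed

lemma Union_relabel:
  assumes "finite (\<Union>\<tau>)" shows "\<Union>(relabel \<tau>) = {1..card (\<Union>\<tau>)}"
proof -
  have "\<Union>(relabel \<tau>) = rank_in (\<Union>\<tau>) ` \<Union>\<tau>" unfolding relabel_def by auto
  then show ?thesis using rank_in_image[OF assms] by simp
qed

lemma relabel_same_block:
  assumes "finite (\<Union>\<tau>)" "a \<in> \<Union>\<tau>" "c \<in> \<Union>\<tau>"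
  shows "(\<exists>U\<in>relabel \<tau>. rank_in (\<Union>\<tau>) a \<in> U \<and> rank_in (\<Union>\<tau>) c \<in> U) \<longleftrightarrow> (\<exists>U\<in>\<tau>. a \<in> U \<and> c \<in> U)"
proof -
  have "rank_in (\<Union>\<tau>) x \<in> rank_in (\<Union>\<tau>) ` U \<longleftrightarrow> x \<in> U" if "U \<in> \<tau>" "x \<in> \<Union>\<tau>" for x U
    using inj_on_image_mem_iff[OF rank_in_inj[OF assms(1)], of x U] that by auto
  then show ?thesis using assms(2,3) unfolding relabel_def by auto
qed

lemma card_relabel:
  assumes "finite (\<Union>\<tau>)" shows "card (relabel \<tau>) = card \<tau>"
  unfolding relabel_def
proof (rule card_image, rule inj_onI)
  fix U W assume "U \<in> \<tau>" "W \<in> \<tau>" "rank_in (\<Union>\<tau>) ` U = rank_in (\<Union>\<tau>) ` W"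
  then show "U = W" using inj_on_image_eq_iff[OF rank_in_inj[OF assms]] by (metis Union_upper)
qed

lemma relabel_partition:
  assumes "finite (\<Union>\<tau>)" "disjoint \<tau>" "{} \<notin> \<tau>"
  shows "partition_on {1..card (\<Union>\<tau>)} (relabel \<tau>)"
proof (rule partition_onI)
  show "\<Union>(relabel \<tau>) = {1..card (\<Union>\<tau>)}" by (rule Union_relabel[OF assms(1)])
  show "{} \<notin> relabel \<tau>" using assms(3) by (auto simp: relabel_def)
  fix p q assume "p \<in> relabel \<tau>" "q \<in> relabel \<tau>" "p \<noteq> q"
  then obtain U W where UW: "U \<in> \<tau>" "W \<in> \<tau>" "p = rank_in (\<Union>\<tau>) ` U" "q = rank_in (\<Union>\<tau>) ` W"
    by (auto simp: relabel_def)
  then have "U \<inter> W = {}" using assms(2) \<open>p \<noteq> q\<close> by (auto simp: disjoint_def)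
  then have "rank_in (\<Union>\<tau>) ` U \<inter> rank_in (\<Union>\<tau>) ` W = {}"
    using inj_on_image_Int[OF rank_in_inj[OF assms(1)], of U W] UW by auto
  then show "disjnt p q" using UW by (simp add: disjnt_def)
qed

section \<open>From walks on trees to special symmetric partitions\<close>

lemma tree_walk_first_visit_edges:
  assumes "tree_walk p k"
  shows "(\<lambda>v. walk_edge p (LEAST j. p j = v)) ` (p ` {0..k} - {p 0}) = walk_edge p ` {1..k}"
\<comment> \<open>On a tree the injection from non-root vertices to edges by first visits is onto,
  because both sides have the same size.\<close>
proof (rule card_subset_eq)
  show "(\<lambda>v. walk_edge p (LEAST j. p j = v)) ` (p ` {0..k} - {p 0}) \<subseteq> walk_edge p ` {1..k}"
    by (intro image_subsetI imageI first_visit(1))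
  show "card ((\<lambda>v. walk_edge p (LEAST j. p j = v)) ` (p ` {0..k} - {p 0})) = card (walk_edge p ` {1..k})"
  proof -
    have "card (p ` {0..k} - {p 0}) = card (p ` {0..k}) - 1" by (rule card_Diff_singleton) simp
    then have "card (p ` {0..k} - {p 0}) = card (walk_edge p ` {1..k})"
      using assms by (simp add: tree_walk_def)
    then show ?thesis by (simp only: card_image[OF first_visit_edge_inj])
  qed
qed simp

text \<open>The vertex discovered last is a leaf: it is visited only from its neighbour and back.\<close>
lemma tree_walk_last_leaf:
  assumes t: "tree_walk p k" and V: "V \<in> edge_part p k" "\<forall>U\<in>edge_part p k. Min U \<le> Min V"
  obtains u v where "u \<noteq> v" "p 0 \<noteq> v" "u \<in> p ` {0..k}" "v \<in> p ` {0..k}"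
    "V = {i \<in> {1..k}. v \<in> walk_edge p i}" "\<And>i. i \<in> V \<Longrightarrow> walk_edge p i = {u, v}"
proof -
  obtain e where e: "V = {i \<in> {1..k}. walk_edge p i = e}" "e \<in> walk_edge p ` {1..k}"
    using V(1) by (auto simp: edge_part_def)
  define s where "s = Min V"
  have fin: "finite V" and ne: "V \<noteq> {}" using e by auto
  have sV: "s \<in> V" unfolding s_def by (rule Min_in[OF fin ne])
  have s1: "s \<in> {1..k}" and es: "walk_edge p s = e" using sV e by auto
  obtain w where w: "w \<in> p ` {0..k} - {p 0}" "e = walk_edge p (LEAST j. p j = w)"
    using e(2) unfolding tree_walk_first_visit_edges[OF t, symmetric] by blast
  define j where "j = (LEAST j. p j = w)"
  note J = first_visit[OF w(1), folded j_def]
  have "j \<in> V" using J(1) w(2) e(1) by (auto simp: j_def)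
  then have sj: "s \<le> j" unfolding s_def using fin by simp
  have "w \<in> walk_edge p s" unfolding es w(2) j_def[symmetric] using J(2) by (simp add: walk_edge_def)
  \<comment> \<open>Step \<open>s\<close> touches \<open>w\<close> but starts elsewhere, because
    \<open>s \<le> j\<close> puts position \<open>s - 1\<close> before the first visit; so
    \<open>w\<close> is discovered at step \<open>s\<close>.\<close>
  moreover have sw: "p (s - 1) \<noteq> w"
  proof (rule J(3))
    show "s - 1 < j" using sj s1 by (cases s) auto
  qed
  ultimately have ps: "p s = w" by (auto simp: walk_edge_def)
  have new: "p i \<noteq> w" if "i < s" for i using J(3) that sj by auto
  \<comment> \<open>A step through \<open>w\<close> has a block whose minimum is at most
    \<open>s\<close>, since \<open>V\<close> has the largest minimum, and not below
    \<open>s\<close>, since \<open>w\<close> is new at \<open>s\<close>.\<close>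
  have inc: "i \<in> V" if i: "i \<in> {1..k}" "w \<in> walk_edge p i" for i
  proof -
    define U where "U = {l \<in> {1..k}. walk_edge p l = walk_edge p i}"
    have "U \<in> edge_part p k" using i unfolding edge_part_def U_def by blast
    then have le: "Min U \<le> s" using V(2) s_def by auto
    have "finite U" "U \<noteq> {}" using i by (auto simp: U_def)
    then have m: "Min U \<in> U" by (rule Min_in)
    then have "w \<in> walk_edge p (Min U)" using i by (auto simp: U_def)
    then have "\<not> Min U < s" using new[of "Min U"] new[of "Min U - 1"]
      by (auto simp: walk_edge_def less_imp_diff_less)
    then have "Min U = s" using le by simp
    then show ?thesis using m i e es by (auto simp: U_def)
  qed
  show ?thesis
  proof (rule that[of "p (s - 1)" w])
    show "p (s - 1) \<noteq> w" by (rule sw)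
    show "p 0 \<noteq> w" using w by auto
    show "p (s - 1) \<in> p ` {0..k}" using s1 by auto
    show "w \<in> p ` {0..k}" using w by auto
    show eV: "walk_edge p i = {p (s - 1), w}" if "i \<in> V" for i
      using that e es ps unfolding walk_edge_def[of p s] by auto
    have "V \<subseteq> {1..k}" using e(1) by blast
    then show "V = {i \<in> {1..k}. w \<in> walk_edge p i}" using inc eV by blast
  qed
qed

lemma even_interval_pair: "even_interval {i..Suc i}"
  unfolding even_interval_def by (intro conjI exI[of _ i] exI[of _ "Suc i"]) auto

text \<open>The last block consists of the steps to and from the leaf discovered last. Pruning that
  leaf leaves a shorter tree walk whose edge partition is the relabelled remainder, so induction on
  the length applies. Between two visits to the leaf the walk returns to the neighbour, which gives
  the parity condition.\<close>

theorem tree_walk_special_symmetric: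
  "tree_walk p k \<Longrightarrow> k \<ge> 1 \<Longrightarrow> special_symmetric (edge_part p k)"
proof (induction k arbitrary: p rule: less_induct)
  case (less k p)
  note t = less.prems(1)
  define \<sigma> where "\<sigma> = edge_part p k"
  have part: "partition_on {1..k} \<sigma>" unfolding \<sigma>_def by (rule edge_part_partition)
  have fin\<sigma>: "finite \<sigma>" by (rule finite_elements[OF _ part]) simp
  have ne\<sigma>: "\<sigma> \<noteq> {}" using part less.prems(2) partition_onD1[OF part] by force
  have evk: "even k" by (rule tree_walk_length_even[OF t])
  have "Max (Min ` \<sigma>) \<in> Min ` \<sigma>" using fin\<sigma> ne\<sigma> by (intro Max_in) auto
  then obtain V where V: "V \<in> \<sigma>" "Min V = Max (Min ` \<sigma>)" by auto
  have Vmax: "\<forall>U\<in>\<sigma>. Min U \<le> Min V" using fin\<sigma> V(2) by simp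
  show ?case
  proof (cases "\<sigma> - {V} = {}")
    case True
    then have "\<sigma> = {V}" using V by auto
    then have "\<sigma> = {{1..2 * (k div 2)}}" using partition_onD1[OF part] evk by simp
    then show ?thesis using special_symmetric.one_block[of "k div 2"] less.prems(2) evk unfolding \<sigma>_def[symmetric] by auto
  next
    case False
    obtain u v where uv: "u \<noteq> v" "p 0 \<noteq> v" "u \<in> p ` {0..k}" "v \<in> p ` {0..k}"
      "V = {i \<in> {1..k}. v \<in> walk_edge p i}" "\<And>i. i \<in> V \<Longrightarrow> walk_edge p i = {u, v}"
      by (rule tree_walk_last_leaf[OF t V(1)[unfolded \<sigma>_def] Vmax[unfolded \<sigma>_def]]) (rule that)
    have pk: "p k = p 0" using t by (simp add: tree_walk_def)
    define T where "T = {i \<in> {0..k}. p i = v}"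
    have finT: "finite T" by (simp add: T_def)
    have T0: "0 < i \<and> i < k \<and> p (i - 1) = u \<and> p (Suc i) = u" if "i \<in> T" for i
    proof -
      have i: "i \<le> k" "p i = v" using that by (auto simp: T_def)
      then have ik: "0 < i" "i < k" using uv(2) pk by (auto intro: gr0I le_neq_implies_less)
      then have "i \<in> V" "Suc i \<in> V" using i uv(5) by (auto simp: walk_edge_def)
      then show ?thesis using uv(1) uv(6)[of i] uv(6)[of "Suc i"] i ik
        by (auto simp: walk_edge_def doubleton_eq_iff)
    qed
    have TV: "V = (\<Union>i\<in>T. {i..Suc i})"
    proof
      show "V \<subseteq> (\<Union>i\<in>T. {i..Suc i})"
      proof
        fix i assume i: "i \<in> V"
        then have "i \<in> {1..k}" "v = p (i - 1) \<or> v = p i" using uv(5) by (auto simp: walk_edge_def)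
        then have "i - 1 \<in> T \<and> i = Suc (i - 1) \<or> i \<in> T" unfolding T_def by auto
        then show "i \<in> (\<Union>i\<in>T. {i..Suc i})" by fastforce
      qed
      show "(\<Union>i\<in>T. {i..Suc i}) \<subseteq> V"
      proof
        fix j assume "j \<in> (\<Union>i\<in>T. {i..Suc i})"
        then obtain i where "i \<in> T" "j = i \<or> j = Suc i" by (auto simp: le_Suc_eq)
        then show "j \<in> V" using T0[of i] uv(5) unfolding T_def walk_edge_def by auto
      qed
    qed
    have gapT: "Suc i < j" if "i \<in> T" "j \<in> T" "i < j" for i j
    proof -
      have "j \<noteq> Suc i" using T0[OF that(1)] that(2) uv(1) by (auto simp: T_def)
      then show ?thesis using that by simp
    qed
    define L where "L = sorted_list_of_set T"
    have L: "set L = T" "sorted_wrt (<) L" unfolding L_def using finT by auto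
    \<comment> \<open>One pair of steps per visit to the leaf, in and out. Pairs from successive
      visits may be adjacent and are not merged.\<close>
    define Is where "Is = map (\<lambda>i. {i..Suc i}) L"
    define S where "S = \<Union>(\<sigma> - {V})"
    have S: "S = {1..k} - V"
    proof -
      have "U \<inter> V = {}" if "U \<in> \<sigma> - {V}" for U
        using partition_onD2[OF part] V(1) that by (auto simp: disjoint_def)
      then have "S = \<Union>\<sigma> - V" unfolding S_def using V(1) by blast
      then show ?thesis using partition_onD1[OF part] by simp
    qed
    have finS: "finite S" and S0: "0 \<notin> S" using S by auto
    \<comment> \<open>Moving the leaf onto its neighbour \<open>u\<close> turns the steps of
      \<open>V\<close> into standstills, so that the image walk factors through
      \<open>rank_in S\<close>.\<close>
    define \<phi> where "\<phi> w = (if w = v then u else w)" for w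
    have "\<phi> (p (i - 1)) = \<phi> (p i)" if "i \<in> {1..k} - S" for i
      using that S uv(6)[of i] by (auto simp: \<phi>_def walk_edge_def doubleton_eq_iff)
    then obtain q where q: "\<And>i. i \<le> k \<Longrightarrow> \<phi> (p i) = q (rank_in S i)"
      using rank_in_factor[OF finS, of k "\<lambda>i. \<phi> (p i)"] by blast
    have noV: "p (i - 1) \<noteq> v" "p i \<noteq> v" if "i \<in> S" for i
      using that S uv(5) by (auto simp: walk_edge_def)
    have edge_q: "walk_edge q (rank_in S i) = walk_edge p i" if "i \<in> S" for i
    proof -
      have "i \<le> k" using that S by auto
      then have "q (rank_in S i) = p i" "q (rank_in S i - 1) = p (i - 1)"
        using q[of i] q[of "i - 1"] noV[OF that] rank_in_pred[OF finS that S0] by (auto simp: \<phi>_def)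
      then show ?thesis by (simp add: walk_edge_def)
    qed
    have Sim: "rank_in S ` S = {1..card S}" by (rule rank_in_image[OF finS])
    have partS: "partition_on {1..card S} (relabel (\<sigma> - {V}))"
      unfolding S_def by (rule relabel_partition)
        (use finS partition_onD2[OF part] partition_onD3[OF part] in \<open>auto simp: S_def disjoint_def\<close>)
    have eq: "edge_part q (card S) = relabel (\<sigma> - {V})"
    proof (rule edge_part_eqI[OF partS])
      fix i j assume "i \<in> {1..card S}" "j \<in> {1..card S}"
      then obtain a c where ac: "a \<in> S" "c \<in> S" "i = rank_in S a" "j = rank_in S c"
        unfolding Sim[symmetric] by blast
      have "(\<exists>U\<in>relabel (\<sigma> - {V}). i \<in> U \<and> j \<in> U) \<longleftrightarrow> (\<exists>U\<in>\<sigma> - {V}. a \<in> U \<and> c \<in> U)"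
        unfolding ac(3,4) S_def by (rule relabel_same_block) (use finS ac S_def in auto)
      also have "\<dots> \<longleftrightarrow> walk_edge p a = walk_edge p c"
      proof
        assume "\<exists>U\<in>\<sigma> - {V}. a \<in> U \<and> c \<in> U"
        then show "walk_edge p a = walk_edge p c" unfolding \<sigma>_def edge_part_def by auto
      next
        assume ee: "walk_edge p a = walk_edge p c"
        obtain U where U: "U \<in> \<sigma> - {V}" "a \<in> U" using ac(1) unfolding S_def by blast
        have "c \<in> {1..k}" using ac(2) S by auto
        then have "c \<in> U" using U ee unfolding \<sigma>_def edge_part_def by auto
        then show "\<exists>U\<in>\<sigma> - {V}. a \<in> U \<and> c \<in> U" using U by blast
      qed
      finally show "walk_edge q i = walk_edge q j \<longleftrightarrow> (\<exists>U\<in>relabel (\<sigma> - {V}). i \<in> U \<and> j \<in> U)"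
        using edge_q ac by simp
    qed
    have q0: "q 0 = p 0" using q[of 0] uv(2) rank_in_0[OF S0] by (simp add: \<phi>_def)
    have "rank_in S k = card S" using S by (intro rank_in_top) auto
    then have qk: "q (card S) = p 0" using q[of k] uv(2) pk by (simp add: \<phi>_def)
    have img: "q ` {0..card S} = p ` {0..k} - {v}"
    proof -
      have "rank_in S ` {0..k} = {0..card S}"
      proof
        show "rank_in S ` {0..k} \<subseteq> {0..card S}" using rank_in_le_card[OF finS] by auto
        show "{0..card S} \<subseteq> rank_in S ` {0..k}"
        proof
          fix j assume "j \<in> {0..card S}"
          then have "j = 0 \<or> j \<in> rank_in S ` S" unfolding Sim by auto
          then show "j \<in> rank_in S ` {0..k}" using rank_in_0[OF S0] S by force
        qed
      qed
      then have "q ` {0..card S} = (\<lambda>i. q (rank_in S i)) ` {0..k}" by (metis image_image)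
      also have "\<dots> = \<phi> ` p ` {0..k}" unfolding image_image using q by (intro image_cong) auto
      also have "\<dots> = p ` {0..k} - {v}" using uv(1,3) by (auto simp: \<phi>_def image_iff)
      finally show ?thesis .
    qed
    have "card (walk_edge q ` {1..card S}) = card (relabel (\<sigma> - {V}))"
      using card_edge_part[of q "card S"] unfolding eq by simp
    also have "\<dots> = card (\<sigma> - {V})" by (rule card_relabel) (use finS in \<open>simp add: S_def[symmetric]\<close>)
    also have "\<dots> = card (walk_edge p ` {1..k}) - 1"
      using V(1) fin\<sigma> card_edge_part[of p k] by (simp add: \<sigma>_def)
    finally have ce: "card (walk_edge q ` {1..card S}) = card (walk_edge p ` {1..k}) - 1" .
    have "card (walk_edge p ` {1..k}) \<ge> 1"
      using less.prems(2) by (simp add: Suc_le_eq card_gt_0_iff)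
    then have tq: "tree_walk q (card S)"
      using t ce img uv(4) q0 qk unfolding tree_walk_def by (simp add: card_Diff_singleton)
    obtain W where W: "W \<in> \<sigma> - {V}" using False by blast
    then have "W \<noteq> {}" "W \<subseteq> S" using partition_onD3[OF part] by (auto simp: S_def)
    then have cS: "card S \<ge> 1" using finS by (metis card_0_eq less_one not_le subset_empty)
    have "V \<noteq> {}" using V(1) partition_onD3[OF part] by metis
    moreover have "V \<subseteq> {1..k}" using uv(5) by blast
    ultimately have "S \<subset> {1..k}" unfolding S by blast
    then have lt: "card S < k" using psubset_card_mono[of "{1..k}" S] by simp
    have IH: "special_symmetric (relabel (\<sigma> - {V}))"
      using less.IH[OF lt tq cS] unfolding eq .
    have mm: "Min {a..Suc a} = a" "Max {a..Suc a} = Suc a" for a :: nat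
      by (auto intro: Min_eqI Max_eqI)
    \<comment> \<open>Both lengths are even and \<open>1 \<le> card S < k\<close>, hence
      \<open>k \<ge> 4\<close>, as the rule for several blocks requires.\<close>
    have k4: "k div 2 > 1" using tree_walk_length_even[OF tq] evk cS lt by presburger
    have k2: "2 * (k div 2) = k" using evk by simp
    show ?thesis unfolding \<sigma>_def[symmetric]
    proof (rule special_symmetric.step[of "k div 2" \<sigma> V Is, OF k4 _ V(1) Vmax False _ _ _ _ IH])
      show "partition_on {1..2 * (k div 2)} \<sigma>" unfolding k2 by (rule part)
      show "V = \<Union>(set Is)" unfolding Is_def using TV L by simp
      show "\<forall>I\<in>set Is. even_interval I" unfolding Is_def using even_interval_pair by auto
      have "sorted_wrt (\<lambda>i j. Max {i..Suc i} < Min {j..Suc j}) L"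
        using L(2) by (rule sorted_wrt_mono_rel[rotated]) (use gapT L(1) in \<open>auto simp only: mm\<close>)
      then show "sorted_wrt (\<lambda>I J. Max I < Min J) Is" unfolding Is_def by (simp only: sorted_wrt_map)
      show "\<forall>U\<in>\<sigma> - {V}. \<forall>j. Suc j < length Is \<longrightarrow>
        even (card (U \<inter> ({Min (Is ! j)..Max (Is ! Suc j)} - (Is ! j \<union> Is ! Suc j))))"
      proof (intro ballI allI impI)
        fix U j assume U: "U \<in> \<sigma> - {V}" and j: "Suc j < length Is"
        define a b where "a = L ! j" and "b = L ! Suc j"
        have jL: "Suc j < length L" using j by (simp add: Is_def)
        have ab: "a \<in> T" "b \<in> T" "a < b"
          using jL L nth_mem[of j L] nth_mem[of "Suc j" L] sorted_wrt_nth_less[OF L(2), of j "Suc j"] by (auto simp: a_def b_def)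
        have Ij: "Is ! j = {a..Suc a}" "Is ! Suc j = {b..Suc b}" using jL by (auto simp: Is_def a_def b_def)
        obtain e where e: "U = {i \<in> {1..k}. walk_edge p i = e}" using U by (auto simp: \<sigma>_def edge_part_def)
        \<comment> \<open>The walk is at \<open>u\<close> at the times \<open>Suc a\<close> and
          \<open>b - 1\<close>, so \<open>tree_walk_even\<close> applies to the steps of
          \<open>U\<close> between the two pairs.\<close>
        have "U \<inter> ({a..Suc b} - ({a..Suc a} \<union> {b..Suc b})) = {i \<in> {Suc a<..b - 1}. walk_edge p i = e}"
          using gapT[OF ab] T0[OF ab(1)] T0[OF ab(2)] unfolding e by auto
        moreover have "even (card {i \<in> {Suc a<..b - 1}. walk_edge p i = e})"
          using gapT[OF ab] T0[OF ab(1)] T0[OF ab(2)] by (intro tree_walk_even[OF t]) auto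
        ultimately show "even (card (U \<inter> ({Min (Is ! j)..Max (Is ! Suc j)} - (Is ! j \<union> Is ! Suc j))))"
          unfolding Ij mm by simp
      qed
    qed
  qed
qed

section \<open>From special symmetric partitions back to walks on trees\<close>

lemma even_intervalD:
  assumes "even_interval I" shows "I = {Min I..Max I}" "finite I" "I \<noteq> {}"
proof -
  obtain a b where ab: "a \<le> b" "I = {a..b}" using assms by (auto simp: even_interval_def)
  then have "Min I = a" "Max I = b" by (auto intro: Min_eqI Max_eqI)
  then show "I = {Min I..Max I}" "finite I" "I \<noteq> {}" using ab by auto
qed

context
  fixes Is :: "nat set list" and V :: "nat set"
  assumes V: "V = \<Union>(set Is)" and ev: "\<forall>I\<in>set Is. even_interval I"
    and srt: "sorted_wrt (\<lambda>I J. Max I < Min J) Is"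
begin

lemma intervals_less: "i < j \<Longrightarrow> j < length Is \<Longrightarrow> Max (Is ! i) < Min (Is ! j)"
  using sorted_wrt_nth_less[OF srt] by simp

lemma intervals_disjoint:
  assumes "I \<in> set Is" "J \<in> set Is" "I \<noteq> J" shows "I \<inter> J = {}"
proof -
  obtain i j where ij: "i < length Is" "j < length Is" "I = Is ! i" "J = Is ! j"
    using assms by (metis in_set_conv_nth)
  have "Max I < Min J \<or> Max J < Min I"
    using ij assms(3) intervals_less by (metis linorder_neqE_nat)
  moreover have "I = {Min I..Max I}" "J = {Min J..Max J}"
    using even_intervalD(1) ev assms by blast+
  ultimately show ?thesis by (metis Int_emptyI atLeastAtMost_iff leD le_trans)
qed

text \<open>A position outside \<open>V\<close> has each interval entirely before or entirely after
  it, and the intervals have even size.\<close>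

lemma even_rank_outside:
  assumes "i \<notin> V" shows "even (rank_in V i)"
proof -
  have "{b \<in> V. b \<le> i} = (\<Union>I\<in>set Is. {b \<in> I. b \<le> i})" using V by auto
  then have "rank_in V i = (\<Sum>I\<in>set Is. card {b \<in> I. b \<le> i})"
    unfolding rank_in_def using intervals_disjoint even_intervalD(2) ev
    by (simp only:, intro card_UN_disjoint) fastforce+
  moreover have "even (\<Sum>I\<in>set Is. card {b \<in> I. b \<le> i})"
  proof (rule dvd_sum)
    fix I assume I: "I \<in> set Is"
    obtain a b where ab: "a \<le> b" "I = {a..b}" and e: "even (card I)"
      using ev I by (auto simp: even_interval_def)
    have "i \<notin> I" using assms I V by auto
    then have "{b \<in> I. b \<le> i} = {} \<or> {b \<in> I. b \<le> i} = I" using ab by auto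
    then show "even (card {b \<in> I. b \<le> i})" using e by (elim disjE) (simp_all only: card.empty even_zero)
  qed
  ultimately show ?thesis by simp
qed

text \<open>The hypothesis concerns neighbouring intervals only. Since \<open>U\<close> avoids the
  intervals themselves, the even counts in successive gaps add up between any two elements of
  \<open>V\<close>.\<close>

lemma even_between_intervals:
  assumes U: "U \<inter> V = {}"
    and gap: "\<forall>j. Suc j < length Is \<longrightarrow>
      even (card (U \<inter> ({Min (Is ! j)..Max (Is ! Suc j)} - (Is ! j \<union> Is ! Suc j))))"
    and ac: "a \<in> V" "c \<in> V" "a \<le> c"
  shows "even (card (U \<inter> {a..c}))"
proof -
  have int: "Is ! j = {Min (Is ! j)..Max (Is ! j)}" "Min (Is ! j) \<le> Max (Is ! j)" "Is ! j \<subseteq> V"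
    if "j < length Is" for j
  proof -
    have I: "Is ! j \<in> set Is" using that by simp
    then have e: "even_interval (Is ! j)" using ev by blast
    show "Is ! j = {Min (Is ! j)..Max (Is ! j)}" by (rule even_intervalD(1)[OF e])
    show "Min (Is ! j) \<le> Max (Is ! j)" using even_intervalD(2,3)[OF e] by simp
    show "Is ! j \<subseteq> V" using I V by blast
  qed
  have main: "even (card (U \<inter> {Min (Is ! i)..Max (Is ! j)}))" if "i \<le> j" "j < length Is" for i j
    using that
  proof (induction j rule: dec_induct)
    case base
    have "U \<inter> {Min (Is ! i)..Max (Is ! i)} = {}" using int[of i] base U by blast
    then show ?case by simp
  next
    case (step j)
    let ?A = "U \<inter> {Min (Is ! i)..Max (Is ! j)}"
    let ?B = "U \<inter> ({Min (Is ! j)..Max (Is ! Suc j)} - (Is ! j \<union> Is ! Suc j))"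
    have j: "j < length Is" "Suc j < length Is" using step by auto
    have lt: "Max (Is ! j) < Min (Is ! Suc j)" using intervals_less[of j "Suc j"] j by simp
    have le: "Min (Is ! i) \<le> Min (Is ! j)"
    proof (cases "i = j")
      case False
      then have "Max (Is ! i) < Min (Is ! j)" using intervals_less[of i j] step j by simp
      then show ?thesis using int(2)[of i] step j by simp
    qed simp
    have nU: "x \<notin> Is ! j" "x \<notin> Is ! Suc j" if "x \<in> U" for x
      using that U int(3)[OF j(1)] int(3)[OF j(2)] by auto
    have mem: "x \<in> Is ! j \<longleftrightarrow> Min (Is ! j) \<le> x \<and> x \<le> Max (Is ! j)" for x
      using int(1)[OF j(1)] by (metis atLeastAtMost_iff)
    have "U \<inter> {Min (Is ! i)..Max (Is ! Suc j)} = ?A \<union> ?B"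
    proof (intro equalityI subsetI)
      fix x assume x: "x \<in> U \<inter> {Min (Is ! i)..Max (Is ! Suc j)}"
      show "x \<in> ?A \<union> ?B"
      proof (cases "x \<le> Max (Is ! j)")
        case False
        then show ?thesis using x nU[of x] int(2)[OF j(1)] by auto
      qed (use x in auto)
    next
      fix x assume "x \<in> ?A \<union> ?B"
      then show "x \<in> U \<inter> {Min (Is ! i)..Max (Is ! Suc j)}"
        using le lt int(2)[OF j(1)] int(2)[OF j(2)] by auto
    qed
    moreover have "?A \<inter> ?B = {}"
    proof -
      have "x \<notin> ?B" if "x \<in> ?A" for x using that mem[of x] by simp
      then show ?thesis by blast
    qed
    ultimately have "card (U \<inter> {Min (Is ! i)..Max (Is ! Suc j)}) = card ?A + card ?B"
      by (simp only:) (rule card_Un_disjoint, auto)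
    then show ?case using step.IH j gap by simp
  qed
  obtain i j where i: "i < length Is" "a \<in> Is ! i" and j: "j < length Is" "c \<in> Is ! j"
    using ac V by (auto simp: in_set_conv_nth)
  have mem: "Min (Is ! l) \<le> x \<and> x \<le> Max (Is ! l) \<longleftrightarrow> x \<in> Is ! l" if "l < length Is" for l x
    using int(1)[OF that] by (metis atLeastAtMost_iff)
  have ij: "i \<le> j"
  proof (rule ccontr)
    assume "\<not> i \<le> j"
    then have "Max (Is ! j) < Min (Is ! i)" using intervals_less[of j i] i by simp
    then show False using mem[OF i(1), of a] mem[OF j(1), of c] i j ac by auto
  qed
  have "U \<inter> {a..c} = U \<inter> {Min (Is ! i)..Max (Is ! j)}"
  proof (intro equalityI subsetI)
    fix x assume "x \<in> U \<inter> {a..c}"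
    then show "x \<in> U \<inter> {Min (Is ! i)..Max (Is ! j)}"
      using mem[OF i(1), of a] mem[OF j(1), of c] i j by auto
  next
    fix x assume x: "x \<in> U \<inter> {Min (Is ! i)..Max (Is ! j)}"
    then have n: "x \<notin> Is ! i" "x \<notin> Is ! j" using U int(3)[OF i(1)] int(3)[OF j(1)] by auto
    have "a \<le> x" using n(1) mem[OF i(1), of x] mem[OF i(1), of a] x i by auto
    moreover have "x \<le> c" using n(2) mem[OF j(1), of x] mem[OF j(1), of c] x j by auto
    ultimately show "x \<in> U \<inter> {a..c}" using x by simp
  qed
  then show ?thesis using main[OF ij j(1)] by simp
qed

end

lemma fresh_nat: obtains v :: nat where "v \<notin> q ` {0..k::nat}"
  using ex_new_if_finite[of "q ` {0..k}"] by auto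

text \<open>The last block is inserted into the walk of the remaining blocks as repeated excursions to
  a fresh leaf \<open>v\<close>, which is occupied exactly when an odd number of steps of \<open>V\<close> has been made.\<close>
lemma tree_walk_insert_block:
  fixes q :: "nat \<Rightarrow> nat"
  assumes part: "partition_on {1..n} \<sigma>" and V: "V \<in> \<sigma>"
    and out: "\<And>i. i \<notin> V \<Longrightarrow> even (rank_in V i)"
    and between: "\<And>U a c. U \<in> \<sigma> - {V} \<Longrightarrow> a \<in> V \<Longrightarrow> c \<in> V \<Longrightarrow> a \<le> c \<Longrightarrow> even (card (U \<inter> {a..c}))"
    and q: "tree_walk q (card (\<Union>(\<sigma> - {V})))" "edge_part q (card (\<Union>(\<sigma> - {V}))) = relabel (\<sigma> - {V})"
  shows "\<exists>p :: nat \<Rightarrow> nat. tree_walk p n \<and> edge_part p n = \<sigma>"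
proof -
  define S where "S = \<Union>(\<sigma> - {V})"
  have S: "S = {1..n} - V"
  proof -
    have "U \<inter> V = {}" if "U \<in> \<sigma> - {V}" for U
      using partition_onD2[OF part] V that by (auto simp: disjoint_def)
    then have "S = \<Union>\<sigma> - V" unfolding S_def using V by blast
    then show ?thesis using partition_onD1[OF part] by simp
  qed
  have Vn: "V \<subseteq> {1..n}" using V partition_onD1[OF part] by auto
  have fin: "finite S" "finite V" and zero: "0 \<notin> S" "0 \<notin> V" using S Vn finite_subset[OF Vn] by auto
  note q = q[folded S_def]
  obtain v where v: "v \<notin> q ` {0..card S}" by (rule fresh_nat)
  define r where "r = rank_in S"
  define \<rho> where "\<rho> = rank_in V"
  define p where "p i = (if odd (\<rho> i) then v else q (r i))" for i
  have r_le: "r i \<le> card S" for i unfolding r_def by (rule rank_in_le_card[OF fin(1)])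
  have qv: "q (r i) \<noteq> v" for i using v r_le[of i] by auto
  have rV: "r (i - 1) = r i" "\<rho> i = Suc (\<rho> (i - 1))" if "i \<in> V" for i
  proof -
    have i: "i = Suc (i - 1)" "i \<notin> S" using that Vn S by auto
    show "r (i - 1) = r i" using rank_in_Suc[OF fin(1), of "i - 1"] i unfolding r_def by simp
    show "\<rho> i = Suc (\<rho> (i - 1))" using rank_in_Suc[OF fin(2), of "i - 1"] i(1) that unfolding \<rho>_def by simp
  qed
  have edge_V: "walk_edge p i = {v, q (r i)}" if "i \<in> V" for i
    using rV[OF that] unfolding walk_edge_def p_def by auto
  have edge_S: "walk_edge p i = walk_edge q (r i)" if "i \<in> S" for i
  proof -
    have i: "i = Suc (i - 1)" "i \<notin> V" using that S by auto
    have "\<rho> i = \<rho> (i - 1)" using rank_in_Suc[OF fin(2), of "i - 1"] i unfolding \<rho>_def by simp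
    moreover have "even (\<rho> i)" using out[OF i(2)] by (simp add: \<rho>_def)
    moreover have "r (i - 1) = r i - 1" using rank_in_pred[OF fin(1) that zero(1)] by (simp add: r_def)
    ultimately show ?thesis unfolding walk_edge_def p_def by simp
  qed
  have rS: "r ` S = {1..card S}" unfolding r_def by (rule rank_in_image[OF fin(1)])
  \<comment> \<open>All excursions leave from one vertex: between two elements of \<open>V\<close>
    every other block has an even number of steps, so the reduced walk uses each edge evenly and is
    back where it was.\<close>
  have same: "q (r a) = q (r c)" if ac: "a \<in> V" "c \<in> V" "a \<le> c" for a c
  proof (rule even_edge_counts_imp_closed[of "r a" "r c" "card S"])
    show "r a \<le> r c" unfolding r_def by (rule rank_in_mono[OF fin(1) ac(3)])
    show "r c \<le> card S" by (rule r_le)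
    fix e
    show "even (card {i \<in> {r a<..r c}. walk_edge q i = e})"
    proof (cases "e \<in> walk_edge q ` {1..card S}")
      case False
      then have none: "{i \<in> {r a<..r c}. walk_edge q i = e} = {}" using r_le[of c] by fastforce
      show ?thesis unfolding none by simp
    next
      case True
      then have "{i \<in> {1..card S}. walk_edge q i = e} \<in> relabel (\<sigma> - {V})"
        unfolding q(2)[symmetric] edge_part_def by blast
      then obtain U where U: "U \<in> \<sigma> - {V}" "{i \<in> {1..card S}. walk_edge q i = e} = r ` U"
        by (auto simp: relabel_def S_def[symmetric] r_def)
      have US: "U \<subseteq> S" using U by (auto simp: S_def)
      have "{i \<in> {r a<..r c}. walk_edge q i = e} = {i \<in> {1..card S}. walk_edge q i = e} \<inter> {r a<..r c}"
        using r_le[of c] by auto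
      also have "\<dots> = r ` (U \<inter> {a..c})"
        unfolding U(2)
      proof (intro equalityI subsetI)
        fix l assume "l \<in> r ` U \<inter> {r a<..r c}"
        then obtain x where x: "x \<in> U" "l = r x" "r a < r x" "r x \<le> r c" by auto
        have "a \<le> x"
        proof (rule ccontr)
          assume "\<not> a \<le> x"
          then have "r x \<le> r a" unfolding r_def by (intro rank_in_mono fin) simp
          then show False using x(3) by simp
        qed
        moreover have "x \<le> c"
        proof (rule ccontr)
          assume "\<not> x \<le> c"
          then have "r c < r x" unfolding r_def using x(1) US by (intro rank_in_strict_mono fin) auto
          then show False using x(4) by simp
        qed
        ultimately show "l \<in> r ` (U \<inter> {a..c})" using x by auto
      next
        fix l assume "l \<in> r ` (U \<inter> {a..c})"
        then obtain x where x: "x \<in> U" "l = r x" "a \<le> x" "x \<le> c" by auto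
        then have "x \<noteq> a" using ac(1) US S by auto
        then have "r a < r x" using rank_in_strict_mono[OF fin(1), of a x] x US by (auto simp: r_def)
        moreover have "r x \<le> r c" unfolding r_def by (rule rank_in_mono[OF fin(1) x(4)])
        ultimately show "l \<in> r ` U \<inter> {r a<..r c}" using x by auto
      qed
      finally have eq: "{i \<in> {r a<..r c}. walk_edge q i = e} = r ` (U \<inter> {a..c})" .
      have "inj_on r (U \<inter> {a..c})"
        using rank_in_inj[OF fin(1)] US unfolding r_def by (auto intro: inj_on_subset)
      then have "card (r ` (U \<inter> {a..c})) = card (U \<inter> {a..c})" by (rule card_image)
      then show ?thesis unfolding eq using between[OF U(1) ac] by simp
    qed
  qed
  define s where "s = Min V"
  have neV: "V \<noteq> {}" using V partition_onD3[OF part] by metis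
  have sV: "s \<in> V" unfolding s_def by (rule Min_in[OF fin(2) neV])
  have edge_V': "walk_edge p i = {v, q (r s)}" if "i \<in> V" for i
  proof -
    have "s \<le> i" unfolding s_def using fin(2) that by simp
    then show ?thesis using edge_V[OF that] same[OF sV that] by simp
  qed
  have v_edge: "v \<notin> walk_edge p i" if "i \<in> S" for i
  proof -
    have "r i \<in> {1..card S}" using rS that by auto
    then have "walk_edge q (r i) \<subseteq> q ` {0..card S}" unfolding walk_edge_def by auto
    then show ?thesis using v edge_S[OF that] by auto
  qed
  have split: "i \<in> V \<or> i \<in> S" if "i \<in> {1..n}" for i using S that by auto
  have VS: "i \<notin> V" if "i \<in> S" for i using S that by auto
  have ep: "edge_part p n = \<sigma>"
  proof (rule edge_part_eqI[OF part])
    fix i j assume ij: "i \<in> {1..n}" "j \<in> {1..n}"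
    have uniq: "U = V" if "U \<in> \<sigma>" "x \<in> U" "x \<in> V" for U x
      using partition_onD2[OF part] V that by (auto simp: disjoint_def)
    consider "i \<in> V" "j \<in> V" | "i \<in> V" "j \<in> S" | "i \<in> S" "j \<in> V" | "i \<in> S" "j \<in> S"
      using split ij by blast
    then show "walk_edge p i = walk_edge p j \<longleftrightarrow> (\<exists>U\<in>\<sigma>. i \<in> U \<and> j \<in> U)"
    proof cases
      case 1
      then show ?thesis using edge_V' V by auto
    next
      case 2
      have "v \<in> walk_edge p i" using edge_V' 2 by simp
      then have "walk_edge p i \<noteq> walk_edge p j" using v_edge[OF 2(2)] by metis
      then show ?thesis using uniq 2 VS by metis
    next
      case 3
      have "v \<in> walk_edge p j" using edge_V' 3 by simp
      then have "walk_edge p i \<noteq> walk_edge p j" using v_edge[OF 3(1)] by metis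
      then show ?thesis using uniq 3 VS by metis
    next
      case 4
      have R: "r i \<in> {1..card S}" "r j \<in> {1..card S}" using rS 4 by auto
      have "walk_edge p i = walk_edge p j \<longleftrightarrow> walk_edge q (r i) = walk_edge q (r j)"
        using edge_S 4 by simp
      also have "\<dots> \<longleftrightarrow> (\<exists>U\<in>edge_part q (card S). r i \<in> U \<and> r j \<in> U)"
        using R unfolding edge_part_def by auto
      also have "\<dots> \<longleftrightarrow> (\<exists>U\<in>\<sigma> - {V}. i \<in> U \<and> j \<in> U)"
        unfolding q(2) unfolding r_def S_def by (rule relabel_same_block) (use fin 4 S_def in auto)
      also have "\<dots> \<longleftrightarrow> (\<exists>U\<in>\<sigma>. i \<in> U \<and> j \<in> U)" using 4 VS by auto
      finally show ?thesis .
    qed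
  qed
  have p0: "p 0 = q 0" unfolding p_def \<rho>_def r_def by (simp add: rank_in_0 zero)
  \<comment> \<open>Evaluated just past the end, \<open>out\<close> says that the block
    \<open>V\<close> has even size, so the walk does not end on the leaf.\<close>
  have "n + 1 \<notin> V" using Vn by auto
  then have "even (\<rho> (n + 1))" using out by (simp add: \<rho>_def)
  moreover have "\<rho> (n + 1) = \<rho> n" using \<open>n + 1 \<notin> V\<close> rank_in_Suc[OF fin(2), of n] by (simp add: \<rho>_def)
  moreover have "r n = card S" unfolding r_def by (rule rank_in_top) (use S in auto)
  ultimately have pn: "p n = q (card S)" unfolding p_def by simp
  have img: "p ` {0..n} = insert v (q ` {0..card S})"
  proof
    show "p ` {0..n} \<subseteq> insert v (q ` {0..card S})" using r_le by (auto simp: p_def)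
    have "v \<in> p ` {0..n}"
    proof (cases "odd (\<rho> s)")
      case True
      then have "p s = v" by (simp add: p_def)
      then show ?thesis using sV Vn by force
    next
      case False
      then have "p (s - 1) = v" using rV(2)[OF sV] by (simp add: p_def)
      moreover have "s \<le> n" using sV Vn by auto
      then have "s - 1 \<le> n" by simp
      ultimately show ?thesis by force
    qed
    moreover have "q l \<in> p ` {0..n}" if l: "l \<le> card S" for l
    proof (cases "l = 0")
      case True then show ?thesis using p0 by force
    next
      case False
      then have "l \<in> r ` S" using rS l by simp
      then obtain x where x: "x \<in> S" "l = r x" by auto
      then have "p x = q l" using out[OF VS[OF x(1)]] by (simp add: p_def \<rho>_def)
      moreover have "x \<le> n" using x S by auto
      ultimately show ?thesis by force
    qed
    ultimately show "insert v (q ` {0..card S}) \<subseteq> p ` {0..n}" by auto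
  qed
  have "card (walk_edge p ` {1..n}) = card \<sigma>" using card_edge_part[of p n] ep by simp
  also have "\<dots> = Suc (card (\<sigma> - {V}))"
    using V finite_elements[OF _ part] by (metis card_Suc_Diff1 finite_atLeastAtMost)
  also have "card (\<sigma> - {V}) = card (edge_part q (card S))"
    unfolding q(2) by (rule card_relabel[symmetric]) (use fin(1) in \<open>simp only: S_def\<close>)
  also have "\<dots> = card (walk_edge q ` {1..card S})" by (rule card_edge_part)
  finally have "tree_walk p n"
    using q(1) p0 pn v unfolding tree_walk_def img by simp
  then show ?thesis using ep by blast
qed

text \<open>A one-block partition comes from walking one edge back and forth; every further block is
  grafted as a new leaf by \<open>tree_walk_insert_block\<close>. The length is expressed as
  \<open>card (\<Union>\<sigma>)\<close> because the induction passes through relabelled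
  partitions.\<close>

theorem special_symmetric_tree_walk:
  "special_symmetric \<sigma> \<Longrightarrow> \<exists>(p :: nat \<Rightarrow> nat). tree_walk p (card (\<Union>\<sigma>)) \<and> edge_part p (card (\<Union>\<sigma>)) = \<sigma>"
proof (induction rule: special_symmetric.induct)
  case (one_block k)
  define p :: "nat \<Rightarrow> nat" where "p i = i mod 2" for i
  have e: "walk_edge p i = {0, 1}" if "i \<in> {1..2 * k}" for i
  proof -
    have "i \<noteq> 0" using that by auto
    then obtain j where "i = Suc j" by (cases i) auto
    then show ?thesis by (auto simp: walk_edge_def p_def mod_Suc)
  qed
  have "walk_edge p ` {1..2 * k} = (\<lambda>_. {0, 1}) ` {1..2 * k}" using e by (intro image_cong) auto
  then have we: "walk_edge p ` {1..2 * k} = {{0, 1}}" using one_block by (simp add: image_constant_conv)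
  have "{i \<in> {1..2 * k}. walk_edge p i = {0, 1}} = {1..2 * k}" using e by blast
  then have ep: "edge_part p (2 * k) = {{1..2 * k}}" unfolding edge_part_def we by simp
  have "p ` {0..2 * k} = {0, 1}"
  proof
    have "p 0 = 0" "p 1 = 1" "0 \<in> {0..2 * k}" "1 \<in> {0..2 * k}" using one_block by (auto simp: p_def)
    then show "{0, 1} \<subseteq> p ` {0..2 * k}" by (metis empty_subsetI imageI insert_subset)
  qed (auto simp: p_def)
  then have "tree_walk p (2 * k)" unfolding tree_walk_def we by (simp add: p_def)
  then show ?case using ep by auto
next
  case (step k \<sigma> V Is)
  have U1: "\<Union>\<sigma> = {1..2 * k}" using partition_onD1[OF step(2)] by simp
  have finU: "finite (\<Union>(\<sigma> - {V}))" using U1 by (rule_tac finite_subset[of _ "{1..2 * k}"]) auto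
  have cr: "card (\<Union>(relabel (\<sigma> - {V}))) = card (\<Union>(\<sigma> - {V}))" using Union_relabel[OF finU] by simp
  obtain q :: "nat \<Rightarrow> nat" where q: "tree_walk q (card (\<Union>(\<sigma> - {V})))"
    "edge_part q (card (\<Union>(\<sigma> - {V}))) = relabel (\<sigma> - {V})"
    using step.IH unfolding cr by blast
  have "\<exists>p :: nat \<Rightarrow> nat. tree_walk p (2 * k) \<and> edge_part p (2 * k) = \<sigma>"
  proof (rule tree_walk_insert_block[OF step(2,3) _ _ q])
    show "even (rank_in V i)" if "i \<notin> V" for i by (rule even_rank_outside[OF step(6,7,8) that])
    fix U a c assume U: "U \<in> \<sigma> - {V}" and ac: "a \<in> V" "c \<in> V" "a \<le> c"
    have UV: "U \<inter> V = {}" using partition_onD2[OF step(2)] U step(3) by (auto simp: disjoint_def)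
    show "even (card (U \<inter> {a..c}))"
      by (rule even_between_intervals[OF step(6,7,8) UV _ ac]) (use step(9) U in blast)
  qed
  then show ?case unfolding U1 by simp
qed

text \<open>At \<open>k = 0\<close> the equivalence fails: the walk without steps is a tree walk
  with empty partition, while \<open>SS 0\<close> is empty.\<close>

theorem SS_iff_tree_walk:
  assumes "k \<ge> 1"
  shows "\<sigma> \<in> SS k \<longleftrightarrow> (\<exists>p :: nat \<Rightarrow> nat. tree_walk p k \<and> edge_part p k = \<sigma>)"
proof
  assume "\<sigma> \<in> SS k"
  then have \<sigma>: "partition_on {1..k} \<sigma>" "special_symmetric \<sigma>" by (auto simp: SS_def)
  have "card (\<Union>\<sigma>) = k" using partition_onD1[OF \<sigma>(1)] by (metis card_atLeastAtMost diff_Suc_1)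
  then show "\<exists>p :: nat \<Rightarrow> nat. tree_walk p k \<and> edge_part p k = \<sigma>"
    using special_symmetric_tree_walk[OF \<sigma>(2)] by simp
next
  assume "\<exists>p :: nat \<Rightarrow> nat. tree_walk p k \<and> edge_part p k = \<sigma>"
  then show "\<sigma> \<in> SS k"
    using tree_walk_special_symmetric[OF _ assms] edge_part_partition by (auto simp: SS_def)
qed

section \<open>Spectral distributions of real symmetric matrices\<close>

lemma mult_mat_index:
  assumes "A \<in> carrier_mat n m" "B \<in> carrier_mat m p" "i < n" "j < p"
  shows "(A * B) $$ (i, j) = (\<Sum>k<m. A $$ (i, k) * B $$ (k, j))"
  using assms by (simp add: scalar_prod_def atLeast0LessThan)

lemma assoc_mult_mat_5:
  assumes "A \<in> carrier_mat n n" "B \<in> carrier_mat n n" "C \<in> carrier_mat n n" "D \<in> carrier_mat n n" "E \<in> carrier_mat n n"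
  shows "A * (B * C * D) * E = (A * B) * (C * (D * E))" "A * (B * C * D) * E = ((A * B) * C) * (D * E)"
  using assms by (simp_all add: assoc_mult_mat[of _ n n _ n _ n])

text \<open>The fundamental theorem of algebra gives a complex eigenpair. Pairing the real part of
  the eigenvector with the image of the imaginary part, and conversely, gives a difference of
  \<open>Im l\<close> times the squared norm, which symmetry makes zero. A nonzero one of the two
  parts is then a real eigenvector.\<close>

lemma real_symmetric_eigenvector:
  fixes A :: "real Matrix.mat"
  assumes A: "A \<in> carrier_mat n n" and n: "n > 0"
    and sym: "\<And>i j. i < n \<Longrightarrow> j < n \<Longrightarrow> A $$ (i, j) = A $$ (j, i)"
  obtains e :: real and v :: "nat \<Rightarrow> real" where
    "\<exists>i<n. v i \<noteq> 0" "\<And>i. i < n \<Longrightarrow> (\<Sum>j<n. A $$ (i, j) * v j) = e * v i"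
proof -
  define Ac where "Ac = map_mat complex_of_real A"
  have Ac: "Ac \<in> carrier_mat n n" using A by (simp add: Ac_def)
  have "degree (char_poly Ac) = n" using degree_monic_char_poly[OF Ac] by simp
  then have "\<not> constant (poly (char_poly Ac))" using n by (simp add: constant_degree)
  then obtain l where "poly (char_poly Ac) l = 0" using fundamental_theorem_of_algebra by blast
  then have "eigenvalue Ac l" using eigenvalue_root_char_poly[OF Ac] by simp
  then obtain w where w: "w \<in> carrier_vec n" "w \<noteq> 0\<^sub>v n" "Ac *\<^sub>v w = l \<cdot>\<^sub>v w"
    using Ac by (auto simp: eigenvalue_def eigenvector_def)
  define a b where "a i = Re (vec_index w i)" and "b i = Im (vec_index w i)" for i
  have eq: "(\<Sum>j<n. complex_of_real (A $$ (i, j)) * vec_index w j) = l * vec_index w i" if "i < n" for i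
  proof -
    have "vec_index (Ac *\<^sub>v w) i = (\<Sum>j<n. complex_of_real (A $$ (i, j)) * vec_index w j)"
      using that w(1) A by (simp add: Ac_def scalar_prod_def atLeast0LessThan)
    then show ?thesis using w that by simp
  qed
  have re: "(\<Sum>j<n. A $$ (i, j) * a j) = Re l * a i - Im l * b i" if "i < n" for i
    using arg_cong[OF eq[OF that], of Re] by (simp add: a_def b_def)
  have im: "(\<Sum>j<n. A $$ (i, j) * b j) = Re l * b i + Im l * a i" if "i < n" for i
    using arg_cong[OF eq[OF that], of Im] by (simp add: a_def b_def)
  have nz: "\<exists>i<n. a i \<noteq> 0 \<or> b i \<noteq> 0"
  proof (rule ccontr)
    assume "\<not> (\<exists>i<n. a i \<noteq> 0 \<or> b i \<noteq> 0)"
    then have "w = 0\<^sub>v n" using w(1) by (intro eq_vecI) (auto simp: a_def b_def complex_eq_iff)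
    then show False using w(2) by simp
  qed
  have "(\<Sum>i<n. b i * (\<Sum>j<n. A $$ (i, j) * a j)) = (\<Sum>i<n. a i * (\<Sum>j<n. A $$ (i, j) * b j))"
  proof -
    have "(\<Sum>i<n. b i * (\<Sum>j<n. A $$ (i, j) * a j)) = (\<Sum>i<n. \<Sum>j<n. b i * (A $$ (i, j) * a j))"
      by (simp add: sum_distrib_left)
    also have "\<dots> = (\<Sum>j<n. \<Sum>i<n. b i * (A $$ (i, j) * a j))" by (rule sum.swap)
    also have "\<dots> = (\<Sum>j<n. \<Sum>i<n. a j * (A $$ (j, i) * b i))"
      using sym by (intro sum.cong refl) (simp add: mult_ac)
    finally show ?thesis by (simp add: sum_distrib_left)
  qed
  then have "(\<Sum>i<n. b i * (Re l * a i - Im l * b i)) = (\<Sum>i<n. a i * (Re l * b i + Im l * a i))"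
    using re im by simp
  then have "(\<Sum>i<n. a i * (Re l * b i + Im l * a i) - b i * (Re l * a i - Im l * b i)) = 0"
    by (simp add: sum_subtractf)
  moreover have "(\<Sum>i<n. a i * (Re l * b i + Im l * a i) - b i * (Re l * a i - Im l * b i))
      = Im l * (\<Sum>i<n. (a i)\<^sup>2 + (b i)\<^sup>2)"
    unfolding sum_distrib_left by (intro sum.cong refl) (simp add: algebra_simps power2_eq_square)
  moreover have "(\<Sum>i<n. (a i)\<^sup>2 + (b i)\<^sup>2) > 0"
  proof -
    obtain i where i: "i < n" "a i \<noteq> 0 \<or> b i \<noteq> 0" using nz by blast
    then have "(a i)\<^sup>2 + (b i)\<^sup>2 > 0" by (simp add: sum_power2_gt_zero_iff)
    then show ?thesis using i by (intro sum_pos2[of _ i]) auto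
  qed
  ultimately have l: "Im l = 0" by simp
  show ?thesis
  proof (cases "\<exists>i<n. a i \<noteq> 0")
    case True
    then show ?thesis by (rule that[of a "Re l"]) (use re l in simp)
  next
    case False
    then have "\<exists>i<n. b i \<noteq> 0" using nz by blast
    then show ?thesis by (rule that[of b "Re l"]) (use im l in simp)
  qed
qed

text \<open>The reflection that exchanges \<open>v\<close> and the first basis vector; it is
  symmetric and its own inverse.\<close>

lemma householder:
  fixes v :: "nat \<Rightarrow> real"
  assumes v: "(\<Sum>i<n. (v i)\<^sup>2) = 1" and n: "n > 0"
  obtains H where "H \<in> carrier_mat n n" "transpose_mat H = H" "H * H = 1\<^sub>m n"
    "\<And>i. i < n \<Longrightarrow> H $$ (i, 0) = v i"
proof -
  define w where "w i = v i - (if i = 0 then 1 else 0)" for i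
  define s where "s = (\<Sum>i<n. (w i)\<^sup>2)"
  \<comment> \<open>If \<open>v\<close> is the first basis vector, then \<open>s = 0\<close>,
    division by 0 yields \<open>c = 0\<close>, and \<open>H\<close> is the identity, as it should
    be.\<close>
  define c where "c = 2 / s"
  define H where "H = Matrix.mat n n (\<lambda>(i, j). (if i = j then 1 else 0) - c * w i * w j)"
  have H: "H \<in> carrier_mat n n" by (simp add: H_def)
  have s: "s = 2 - 2 * v 0"
  proof -
    have "s = (\<Sum>i<n. (v i)\<^sup>2 + (if i = 0 then 1 - 2 * v i else 0))"
      unfolding s_def w_def by (intro sum.cong refl) (auto simp: power2_diff)
    also have "\<dots> = 1 + (1 - 2 * v 0)" using n v by (simp add: sum.distrib)
    finally show ?thesis by simp
  qed
  have ws: "c * (c * s) = 2 * c" unfolding c_def by (cases "s = 0") auto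
  have "H * H = 1\<^sub>m n"
  proof (rule eq_matI)
    fix i j assume "i < dim_row (1\<^sub>m n :: real Matrix.mat)" "j < dim_col (1\<^sub>m n :: real Matrix.mat)"
    then have ij: "i < n" "j < n" by auto
    have "(H * H) $$ (i, j) = (\<Sum>k<n. ((if i = k then 1 else 0) - c * w i * w k) * ((if k = j then 1 else 0) - c * w k * w j))"
      using mult_mat_index[OF H H ij] ij by (simp add: H_def)
    also have "\<dots> = (\<Sum>k<n. (if k = i then (if i = j then 1 else 0) - c * w i * w j else 0)
        - (if k = j then c * w i * w j else 0) + c * c * w i * w j * (w k)\<^sup>2)"
      by (intro sum.cong refl) (auto simp: algebra_simps power2_eq_square)
    also have "\<dots> = (if i = j then 1 else 0) - c * w i * w j - c * w i * w j + c * c * w i * w j * s"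
      using ij by (simp add: sum.distrib sum_subtractf s_def sum_distrib_left)
    also have "c * c * w i * w j * s = (c * (c * s)) * (w i * w j)" by simp
    also have "\<dots> = 2 * c * (w i * w j)" unfolding ws ..
    finally show "(H * H) $$ (i, j) = 1\<^sub>m n $$ (i, j)" using ij by simp
  qed (use H in auto)
  moreover have "transpose_mat H = H" by (rule eq_matI) (auto simp: H_def mult_ac)
  moreover have "H $$ (i, 0) = v i" if i: "i < n" for i
  proof (cases "s = 0")
    case True
    then have "w i = 0" using i unfolding s_def by (subst (asm) sum_nonneg_eq_0_iff) auto
    then show ?thesis using i n by (auto simp: H_def w_def)
  next
    case False
    have "w 0 = - s / 2" using s by (simp add: w_def)
    then have "c * w i * w 0 = - w i" using False by (simp add: c_def)
    then show ?thesis using i n by (auto simp: H_def w_def)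
  qed
  ultimately show ?thesis using that H by blast
qed

text \<open>A Householder reflection whose first column is a unit eigenvector brings
  \<open>A\<close> to block form with the eigenvalue in the corner; symmetry clears the first row,
  and the induction hypothesis treats the remaining block.\<close>

theorem real_spectral:
  fixes A :: "real Matrix.mat"
  assumes "A \<in> carrier_mat n n" "\<And>i j. i < n \<Longrightarrow> j < n \<Longrightarrow> A $$ (i, j) = A $$ (j, i)"
  shows "\<exists>P d. P \<in> carrier_mat n n \<and> P * transpose_mat P = 1\<^sub>m n \<and> transpose_mat P * P = 1\<^sub>m n \<and>
    A = P * mat_diag n d * transpose_mat P"
  using assms
proof (induction n arbitrary: A)
  case 0
  show ?case
    by (rule exI[of _ "1\<^sub>m 0"], rule exI[of _ "\<lambda>_. 0"]) (use 0 in \<open>auto intro!: eq_matI\<close>)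
next
  case (Suc n)
  note A = Suc.prems(1) and sym = Suc.prems(2)
  obtain e :: real and x :: "nat \<Rightarrow> real" where x: "\<exists>i<Suc n. x i \<noteq> 0"
    "\<And>i. i < Suc n \<Longrightarrow> (\<Sum>j<Suc n. A $$ (i, j) * x j) = e * x i"
    by (rule real_symmetric_eigenvector[OF A _ sym]) (auto intro: that)
  define N where "N = sqrt (\<Sum>i<Suc n. (x i)\<^sup>2)"
  have Np: "(\<Sum>i<Suc n. (x i)\<^sup>2) > 0"
  proof -
    obtain i where "i < Suc n" "x i \<noteq> 0" using x(1) by blast
    then show ?thesis by (intro sum_pos2[of _ i]) auto
  qed
  then have N: "N > 0" "N\<^sup>2 = (\<Sum>i<Suc n. (x i)\<^sup>2)" by (auto simp: N_def)
  define v where "v i = x i / N" for i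
  have v1: "(\<Sum>i<Suc n. (v i)\<^sup>2) = 1"
    using N Np by (simp add: v_def power_divide sum_divide_distrib[symmetric])
  have Av: "(\<Sum>j<Suc n. A $$ (i, j) * v j) = e * v i" if "i < Suc n" for i
    using x(2)[OF that] unfolding v_def by (simp add: sum_divide_distrib[symmetric])
  obtain H where H: "H \<in> carrier_mat (Suc n) (Suc n)" "transpose_mat H = H" "H * H = 1\<^sub>m (Suc n)"
    "\<And>i. i < Suc n \<Longrightarrow> H $$ (i, 0) = v i"
    by (rule householder[OF v1]) (auto intro: that)
  define B where "B = H * A * H"
  have B: "B \<in> carrier_mat (Suc n) (Suc n)" using H A by (simp add: B_def)
  have At: "transpose_mat A = A" using A sym by (intro eq_matI) auto
  have "transpose_mat B = transpose_mat H * (transpose_mat A * transpose_mat H)"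
    unfolding B_def using H(1) A by (simp add: transpose_mult[of _ "Suc n" "Suc n" _ "Suc n"])
  also have "\<dots> = B" unfolding At H(2) B_def using H(1) A by (simp add: assoc_mult_mat[of _ "Suc n" "Suc n" _ "Suc n" _ "Suc n"])
  finally have Bt: "transpose_mat B = B" .
  have Bsym: "B $$ (i, j) = B $$ (j, i)" if "i < Suc n" "j < Suc n" for i j
    using arg_cong[OF Bt, of "\<lambda>M. M $$ (j, i)"] that B by simp
  have Bcol: "B $$ (i, 0) = (if i = 0 then e else 0)" if i: "i < Suc n" for i
  proof -
    have AH: "A * H \<in> carrier_mat (Suc n) (Suc n)" using A H by simp
    have "(A * H) $$ (k, 0) = e * H $$ (k, 0)" if "k < Suc n" for k
      using mult_mat_index[OF A H(1) that, of 0] Av[OF that] H(4) that by simp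
    then have "(H * (A * H)) $$ (i, 0) = e * (H * H) $$ (i, 0)"
      using mult_mat_index[OF H(1) AH i, of 0] mult_mat_index[OF H(1) H(1) i, of 0]
      by (simp add: sum_distrib_left mult_ac distrib_left)
    moreover have "B = H * (A * H)" unfolding B_def using A H(1) by (rule_tac assoc_mult_mat) auto
    ultimately show ?thesis using i H(3) by simp
  qed
  define A' where "A' = Matrix.mat n n (\<lambda>(i, j). B $$ (Suc i, Suc j))"
  have A': "A' \<in> carrier_mat n n" by (simp add: A'_def)
  obtain P' d where P': "P' \<in> carrier_mat n n" "P' * transpose_mat P' = 1\<^sub>m n"
    "transpose_mat P' * P' = 1\<^sub>m n" "A' = P' * mat_diag n d * transpose_mat P'"
    using Suc.IH[OF A'] Bsym by (auto simp: A'_def)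
  define E where "E = Matrix.mat 1 1 (\<lambda>_. e)"
  let ?z1 = "0\<^sub>m 1 n" and ?z2 = "0\<^sub>m n 1"
  have BB: "B = four_block_mat E ?z1 ?z2 A'"
  proof (rule eq_matI)
    fix i j assume "i < dim_row (four_block_mat E ?z1 ?z2 A')" "j < dim_col (four_block_mat E ?z1 ?z2 A')"
    then have ij: "i < Suc n" "j < Suc n" by (auto simp: E_def A'_def)
    show "B $$ (i, j) = four_block_mat E ?z1 ?z2 A' $$ (i, j)"
      using ij Bcol[of i] Bcol[of j] Bsym[of 0 j] by (auto simp: E_def A'_def)
  qed (use B in \<open>auto simp: E_def A'_def\<close>)
  define Q where "Q = four_block_mat (1\<^sub>m 1) ?z1 ?z2 P'"
  define d' where "d' i = (case i of 0 \<Rightarrow> e | Suc i \<Rightarrow> d i)" for i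
  have Q: "Q \<in> carrier_mat (Suc n) (Suc n)" using P'(1) by (auto simp: Q_def)
  have Qt: "transpose_mat Q = four_block_mat (1\<^sub>m 1) ?z1 ?z2 (transpose_mat P')"
    unfolding Q_def using P'(1) by (subst transpose_four_block_mat) auto
  have one: "four_block_mat (1\<^sub>m 1) ?z1 ?z2 (1\<^sub>m n) = (1\<^sub>m (Suc n) :: real Matrix.mat)"
    by (rule eq_matI) auto
  have D: "mat_diag (Suc n) d' = four_block_mat E ?z1 ?z2 (mat_diag n d)"
    by (rule eq_matI) (auto simp: mat_diag_def E_def d'_def split: nat.splits)
  have QQ: "Q * transpose_mat Q = 1\<^sub>m (Suc n)" "transpose_mat Q * Q = 1\<^sub>m (Suc n)"
    unfolding Qt unfolding Q_def one[symmetric]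
    by (subst mult_four_block_mat; use P' in auto)+
  have E: "E \<in> carrier_mat 1 1" by (simp add: E_def)
  have QD: "Q * mat_diag (Suc n) d' = four_block_mat E ?z1 ?z2 (P' * mat_diag n d)"
  proof -
    have "?z1 * mat_diag n d = ?z1" by (rule left_mult_zero_mat[of _ n n]) simp
    then show ?thesis unfolding D Q_def using P'(1) E by (subst mult_four_block_mat) auto
  qed
  have "Q * mat_diag (Suc n) d' * transpose_mat Q = four_block_mat E ?z1 ?z2 (P' * mat_diag n d * transpose_mat P')"
  proof -
    have PD: "P' * mat_diag n d \<in> carrier_mat n n" using P'(1) by simp
    then have "P' * mat_diag n d * ?z2 = ?z2" by (rule right_mult_zero_mat)
    moreover have "0\<^sub>m n n + P' * mat_diag n d * transpose_mat P' = P' * mat_diag n d * transpose_mat P'"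
      using PD P'(1) by (intro left_add_zero_mat mult_carrier_mat[of _ n n]) auto
    ultimately show ?thesis unfolding QD Qt using P'(1) E PD by (subst mult_four_block_mat) auto
  qed
  then have BQ: "B = Q * mat_diag (Suc n) d' * transpose_mat Q" using BB P'(4) by simp
  define P where "P = H * Q"
  define Dd where "Dd = mat_diag (Suc n) d'"
  have Dd: "Dd \<in> carrier_mat (Suc n) (Suc n)" by (simp add: Dd_def)
  have P: "P \<in> carrier_mat (Suc n) (Suc n)" using H Q by (simp add: P_def)
  have Pt: "transpose_mat P = transpose_mat Q * H"
    unfolding P_def using H Q by (simp add: transpose_mult[of _ "Suc n" "Suc n" _ "Suc n"])
  have QT: "transpose_mat Q \<in> carrier_mat (Suc n) (Suc n)" using Q by simp
  note assoc = assoc_mult_mat[of _ "Suc n" "Suc n" _ "Suc n" _ "Suc n"]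
  have "P * transpose_mat P = H * ((Q * transpose_mat Q) * H)"
    unfolding Pt unfolding P_def using H(1) Q QT by (simp add: assoc)
  then have PP1: "P * transpose_mat P = 1\<^sub>m (Suc n)" using QQ(1) H by simp
  have PP2: "transpose_mat P * P = 1\<^sub>m (Suc n)"
    using mat_mult_left_right_inverse[OF P _ PP1] P by simp
  have "P * Dd * transpose_mat P = H * (Q * Dd * transpose_mat Q) * H"
    unfolding Pt unfolding P_def using H(1) Q QT Dd by (simp add: assoc)
  also have "\<dots> = H * (H * A * H) * H" using BQ by (simp add: Dd_def B_def)
  also have "\<dots> = (H * H) * A * (H * H)" using H(1) A by (simp add: assoc)
  also have "\<dots> = A" using H(3) A by simp
  finally show ?case using P PP1 PP2 unfolding Dd_def by metis
qed

definition orth_diag :: "real Matrix.mat \<Rightarrow> nat \<Rightarrow> real Matrix.mat \<Rightarrow> (nat \<Rightarrow> real) \<Rightarrow> bool" where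
  "orth_diag A n P d \<longleftrightarrow> P \<in> carrier_mat n n \<and> P * transpose_mat P = 1\<^sub>m n \<and>
     transpose_mat P * P = 1\<^sub>m n \<and> A = P * mat_diag n d * transpose_mat P"

lemma orth_diag_exists:
  assumes "A \<in> carrier_mat n n" "\<And>i j. i < n \<Longrightarrow> j < n \<Longrightarrow> A $$ (i, j) = A $$ (j, i)"
  obtains P d where "orth_diag A n P d"
  using real_spectral[OF assms] that unfolding orth_diag_def by metis

lemma orth_diag_proots:
  assumes "orth_diag A n P d"
  shows "proots (char_poly A) = image_mset d (mset_set {..<n})"
proof -
  have P: "P \<in> carrier_mat n n" "P * transpose_mat P = 1\<^sub>m n" "transpose_mat P * P = 1\<^sub>m n"
    "A = P * mat_diag n d * transpose_mat P" using assms by (auto simp: orth_diag_def)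
  have "similar_mat_wit A (mat_diag n d) P (transpose_mat P)"
    by (rule similar_mat_witI[of _ _ n]) (use P in auto)
  then have "char_poly A = char_poly (mat_diag n d)" by (intro char_poly_similar) (auto simp: similar_mat_def)
  also have "\<dots> = (\<Prod>a\<leftarrow>diag_mat (mat_diag n d). [:- a, 1:])"
    by (rule char_poly_upper_triangular[of _ n]) (auto simp: mat_diag_def)
  also have "diag_mat (mat_diag n d) = map d [0..<n]" by (auto simp: diag_mat_def mat_diag_def)
  also have "(\<Prod>a\<leftarrow>map d [0..<n]. [:- a, 1:]) = (\<Prod>i<n. [:- d i, 1:])"
    by (induction n) (simp_all add: mult.commute)
  finally have cp: "char_poly A = (\<Prod>i<n. [:- d i, 1:])" .
  have "proots (\<Prod>i<n. [:- d i, 1:]) = (\<Sum>i<n. proots [:- d i, 1:])"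
    by (rule proots_prod) auto
  also have "\<dots> = (\<Sum>i<n. {#d i#})" by simp
  also have "\<dots> = image_mset d (mset_set {..<n})"
    by (induction n) (simp_all add: lessThan_Suc)
  finally show ?thesis unfolding cp .
qed

section \<open>Integrals, moments and distribution functions in terms of eigenvalues\<close>

lemma real_distribution_esd: "real_distribution (esd A)"
  \<comment> \<open>Every value of \<open>pmf_of_multiset\<close> is a probability mass function, so
    the unspecified value at the empty matrix is covered as well.\<close>
  unfolding esd_def by (rule prob_space.real_distribution_distr[OF measure_pmf.prob_space_axioms]) simp

lemma integral_esd:
  fixes f :: "real \<Rightarrow> real"
  assumes "orth_diag A n P d" "n > 0" and [measurable]: "f \<in> borel_measurable borel"
  shows "integrable (esd A) f" "(\<integral>s. f s \<partial>esd A) = (\<Sum>i<n. f (d i)) / real n"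
proof -
  have ne: "{..<n} \<noteq> {}" using assms(2) by auto
  have esd: "esd A = distr (measure_pmf (map_pmf d (pmf_of_set {..<n}))) borel (\<lambda>x. x)"
    unfolding esd_def orth_diag_proots[OF assms(1)]
    by (subst map_pmf_of_set) (use ne in auto)
  have "integrable (measure_pmf (map_pmf d (pmf_of_set {..<n}))) f"
    by (rule integrable_measure_pmf_finite) (use ne in simp)
  then show "integrable (esd A) f" unfolding esd by (subst integrable_distr_eq) auto
  have "(\<integral>s. f s \<partial>esd A) = measure_pmf.expectation (pmf_of_set {..<n}) (\<lambda>i. f (d i))"
    unfolding esd by (subst integral_distr) auto
  also have "\<dots> = (\<Sum>i<n. f (d i)) / real n"
    by (subst integral_pmf_of_set) (use ne in auto)
  finally show "(\<integral>s. f s \<partial>esd A) = (\<Sum>i<n. f (d i)) / real n" .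
qed

lemma cdf_esd:
  assumes "orth_diag A n P d" "n > 0"
  shows "cdf (esd A) s = (\<Sum>i<n. indicator {..s} (d i)) / real n"
proof -
  interpret real_distribution "esd A" by (rule real_distribution_esd)
  have "cdf (esd A) s = (\<integral>x. indicator {..s} x \<partial>esd A)" by (simp add: cdf_def)
  also have "\<dots> = (\<Sum>i<n. indicator {..s} (d i)) / real n"
    by (rule integral_esd(2)[OF assms]) simp
  finally show ?thesis .
qed

definition mat_tr :: "real Matrix.mat \<Rightarrow> real" where
  "mat_tr A = (\<Sum>i<dim_row A. A $$ (i, i))"

lemma mat_tr_comm:
  assumes "A \<in> carrier_mat n m" "B \<in> carrier_mat m n" shows "mat_tr (A * B) = mat_tr (B * A)"
proof -
  have "mat_tr (A * B) = (\<Sum>i<n. \<Sum>k<m. A $$ (i, k) * B $$ (k, i))"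
    unfolding mat_tr_def using assms by (intro sum.cong mult_mat_index) auto
  also have "\<dots> = (\<Sum>k<m. \<Sum>i<n. B $$ (k, i) * A $$ (i, k))"
    by (subst sum.swap) (simp add: mult.commute)
  also have "\<dots> = mat_tr (B * A)"
    unfolding mat_tr_def using assms by (intro sum.cong mult_mat_index[symmetric]) auto
  finally show ?thesis .
qed

lemma mat_diag_pow: "mat_diag n d ^\<^sub>m k = mat_diag n (\<lambda>i. d i ^ k)"
proof (induction k)
  case 0
  show ?case by (simp add: mat_diag_one[symmetric] del: mat_diag_one) (simp add: mat_diag_def)
next
  case (Suc k)
  then show ?case by (simp add: power_commutes)
qed

lemma orth_diag_tr_pow:
  assumes "orth_diag A n P d"
  shows "mat_tr (A ^\<^sub>m k) = (\<Sum>i<n. d i ^ k)"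
proof -
  have P: "P \<in> carrier_mat n n" "P * transpose_mat P = 1\<^sub>m n" "transpose_mat P * P = 1\<^sub>m n"
    "A = P * mat_diag n d * transpose_mat P" using assms by (auto simp: orth_diag_def)
  have "similar_mat_wit A (mat_diag n d) P (transpose_mat P)"
    by (rule similar_mat_witI[of _ _ n]) (use P in auto)
  then have "similar_mat_wit (A ^\<^sub>m k) (mat_diag n d ^\<^sub>m k) P (transpose_mat P)"
    by (rule similar_mat_wit_pow)
  then have "A ^\<^sub>m k = P * (mat_diag n (\<lambda>i. d i ^ k) * transpose_mat P)"
    using P(1) by (simp add: similar_mat_wit_def Let_def mat_diag_pow assoc_mult_mat[of _ n n _ n _ n])
  moreover have C: "mat_diag n (\<lambda>i. d i ^ k) * transpose_mat P \<in> carrier_mat n n"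
    by (rule mult_carrier_mat[of _ n n]) (use P(1) in auto)
  ultimately have "mat_tr (A ^\<^sub>m k) = mat_tr ((mat_diag n (\<lambda>i. d i ^ k) * transpose_mat P) * P)"
    using mat_tr_comm[OF P(1) C] by simp
  also have "(mat_diag n (\<lambda>i. d i ^ k) * transpose_mat P) * P = mat_diag n (\<lambda>i. d i ^ k)"
    using P(1,3) right_mult_one_mat[OF mat_diag_dim, of n "\<lambda>i. d i ^ k"] by (simp add: assoc_mult_mat[of _ n n _ n _ n])
  finally show ?thesis by (simp add: mat_tr_def mat_diag_def)
qed

theorem moment_esd:
  fixes A :: "real Matrix.mat"
  assumes A: "A \<in> carrier_mat n n" "\<And>i j. i < n \<Longrightarrow> j < n \<Longrightarrow> A $$ (i, j) = A $$ (j, i)" and n: "n > 0"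
  shows "all_moments_finite (esd A)" "moment (esd A) k = mat_tr (A ^\<^sub>m k) / real n"
proof -
  obtain P d where Pd: "orth_diag A n P d" by (rule orth_diag_exists[OF A])
  show "all_moments_finite (esd A)"
    unfolding all_moments_finite_def by (intro allI integral_esd(1)[OF Pd n]) simp
  show "moment (esd A) k = mat_tr (A ^\<^sub>m k) / real n"
    unfolding moment_def orth_diag_tr_pow[OF Pd] by (rule integral_esd(2)[OF Pd n]) simp
qed

section \<open>Orthogonal invariance of norms and the coupling of two spectra\<close>

lemma column_norms_orthogonal_mult:
  fixes M Q :: "real Matrix.mat"
  assumes Q: "Q \<in> carrier_mat n n" "transpose_mat Q * Q = 1\<^sub>m n" and M: "M \<in> carrier_mat n m" and j: "j < m"
  shows "(\<Sum>i<n. ((Q * M) $$ (i, j))\<^sup>2) = (\<Sum>i<n. (M $$ (i, j))\<^sup>2)"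
proof -
  have norm: "(\<Sum>i<n. (N $$ (i, j))\<^sup>2) = (transpose_mat N * N) $$ (j, j)" if "N \<in> carrier_mat n m" for N :: "real Matrix.mat"
    using that j mult_mat_index[of "transpose_mat N" m n N m j j] by (simp add: power2_eq_square)
  have "transpose_mat (Q * M) * (Q * M) = transpose_mat M * ((transpose_mat Q * Q) * M)"
    using Q(1) M by (simp add: transpose_mult[of _ n n _ m] assoc_mult_mat[of _ m n _ n _ m] assoc_mult_mat[of _ n n _ n _ m])
  then have "transpose_mat (Q * M) * (Q * M) = transpose_mat M * M" using Q(2) M by simp
  then show ?thesis using norm[of "Q * M"] norm[OF M] Q(1) M by simp
qed

lemma frobenius_orthogonal:
  fixes M P Q :: "real Matrix.mat"
  assumes P: "P \<in> carrier_mat n n" "transpose_mat P * P = 1\<^sub>m n"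
    and Q: "Q \<in> carrier_mat n n" "transpose_mat Q * Q = 1\<^sub>m n" and M: "M \<in> carrier_mat n n"
  shows "(\<Sum>i<n. \<Sum>j<n. ((P * M * transpose_mat Q) $$ (i, j))\<^sup>2) = (\<Sum>i<n. \<Sum>j<n. (M $$ (i, j))\<^sup>2)"
proof -
  let ?N = "P * M"
  have N: "?N \<in> carrier_mat n n" using P M by simp
  have "(\<Sum>i<n. \<Sum>j<n. ((?N * transpose_mat Q) $$ (i, j))\<^sup>2) = (\<Sum>i<n. \<Sum>j<n. ((Q * transpose_mat ?N) $$ (j, i))\<^sup>2)"
  proof (intro sum.cong refl)
    fix i j assume ij: "i \<in> {..<n}" "j \<in> {..<n}"
    have "?N * transpose_mat Q = transpose_mat (Q * transpose_mat ?N)"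
      using Q N by (simp add: transpose_mult[of _ n n _ n])
    then show "((?N * transpose_mat Q) $$ (i, j))\<^sup>2 = ((Q * transpose_mat ?N) $$ (j, i))\<^sup>2"
      using ij Q(1) P(1) M by simp
  qed
  also have "\<dots> = (\<Sum>i<n. \<Sum>j<n. (transpose_mat ?N $$ (j, i))\<^sup>2)"
    using column_norms_orthogonal_mult[OF Q, of "transpose_mat ?N" n] N by (intro sum.cong[OF refl, of "{..<n}" "\<lambda>i. \<Sum>j<n. ((Q * transpose_mat ?N) $$ (j, i))\<^sup>2"]) simp
  also have "\<dots> = (\<Sum>i<n. \<Sum>j<n. (?N $$ (i, j))\<^sup>2)" using P(1) M by (intro sum.cong refl) auto
  also have "\<dots> = (\<Sum>j<n. \<Sum>i<n. (?N $$ (i, j))\<^sup>2)" by (rule sum.swap)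
  also have "\<dots> = (\<Sum>j<n. \<Sum>i<n. (M $$ (i, j))\<^sup>2)"
    using column_norms_orthogonal_mult[OF P M] by (intro sum.cong[OF refl, of "{..<n}" "\<lambda>j. \<Sum>i<n. (?N $$ (i, j))\<^sup>2"]) simp
  also have "\<dots> = (\<Sum>i<n. \<Sum>j<n. (M $$ (i, j))\<^sup>2)" by (rule sum.swap)
  finally show ?thesis .
qed

text \<open>With eigenvectors \<open>u\<close>, \<open>v\<close> of the two matrices, the weights \<open>\<langle>u k, v l\<rangle>\<^sup>2 / n\<close> couple the two
  spectral distributions at squared cost \<open>\<parallel>A - B\<parallel>\<^sup>2 / n\<close>; this replaces the Hoffman--Wielandt inequality.\<close>
theorem cdf_esd_perturbation:
  fixes A B :: "real Matrix.mat"
  assumes A: "A \<in> carrier_mat n n" "\<And>i j. i < n \<Longrightarrow> j < n \<Longrightarrow> A $$ (i, j) = A $$ (j, i)"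
    and B: "B \<in> carrier_mat n n" "\<And>i j. i < n \<Longrightarrow> j < n \<Longrightarrow> B $$ (i, j) = B $$ (j, i)"
    and n: "n > 0" and \<epsilon>: "\<epsilon> > 0"
  shows "cdf (esd A) s \<le> cdf (esd B) (s + \<epsilon>)
    + (\<Sum>i<n. \<Sum>j<n. (A $$ (i, j) - B $$ (i, j))\<^sup>2) / (real n * \<epsilon>\<^sup>2)"
proof -
  obtain P d where Pd: "orth_diag A n P d" by (rule orth_diag_exists[OF A])
  obtain Q e where Qe: "orth_diag B n Q e" by (rule orth_diag_exists[OF B])
  have P: "P \<in> carrier_mat n n" "P * transpose_mat P = 1\<^sub>m n" "transpose_mat P * P = 1\<^sub>m n"
    "A = P * mat_diag n d * transpose_mat P" using Pd by (auto simp: orth_diag_def)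
  have Q: "Q \<in> carrier_mat n n" "Q * transpose_mat Q = 1\<^sub>m n" "transpose_mat Q * Q = 1\<^sub>m n"
    "B = Q * mat_diag n e * transpose_mat Q" using Qe by (auto simp: orth_diag_def)
  \<comment> \<open>Entry \<open>(k, l)\<close> is the inner product of the \<open>k\<close>-th
    eigenvector of \<open>A\<close> and the \<open>l\<close>-th of \<open>B\<close>. By
    \<open>X1\<close> and \<open>X2\<close> the squared entries are doubly stochastic, which makes
    them a coupling.\<close>
  define X where "X = transpose_mat P * Q"
  have X: "X \<in> carrier_mat n n" using P(1) Q(1) by (simp add: X_def)
  have PT: "transpose_mat P \<in> carrier_mat n n" and QT: "transpose_mat Q \<in> carrier_mat n n" using P Q by auto
  have Dd: "mat_diag n d \<in> carrier_mat n n" and De: "mat_diag n e \<in> carrier_mat n n" by auto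
  have X1: "(\<Sum>k<n. (X $$ (k, l))\<^sup>2) = 1" if l: "l < n" for l
  proof -
    have "transpose_mat (transpose_mat P) * transpose_mat P = 1\<^sub>m n" using P by simp
    then have "(\<Sum>k<n. (X $$ (k, l))\<^sup>2) = (\<Sum>k<n. (Q $$ (k, l))\<^sup>2)"
      unfolding X_def by (intro column_norms_orthogonal_mult[OF PT _ Q(1) l])
    also have "\<dots> = (transpose_mat Q * Q) $$ (l, l)"
      using mult_mat_index[OF QT Q(1) l l] Q(1) l by (simp add: power2_eq_square)
    finally show ?thesis using Q(3) l by simp
  qed
  have X2: "(\<Sum>l<n. (X $$ (k, l))\<^sup>2) = 1" if k: "k < n" for k
  proof -
    have "transpose_mat (transpose_mat Q) * transpose_mat Q = 1\<^sub>m n" using Q by simp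
    then have "(\<Sum>l<n. ((transpose_mat Q * P) $$ (l, k))\<^sup>2) = (\<Sum>l<n. (P $$ (l, k))\<^sup>2)"
      by (intro column_norms_orthogonal_mult[OF QT _ P(1) k])
    also have "\<dots> = (transpose_mat P * P) $$ (k, k)"
      using mult_mat_index[OF PT P(1) k k] P(1) k by (simp add: power2_eq_square)
    also have "transpose_mat Q * P = transpose_mat X" unfolding X_def using P(1) Q(1)
      by (simp add: transpose_mult[of _ n n _ n])
    finally show ?thesis using P(3) X k by simp
  qed
  define F where "F = (\<Sum>i<n. \<Sum>j<n. (A $$ (i, j) - B $$ (i, j))\<^sup>2)"
  \<comment> \<open>In the two eigenbases \<open>A - B\<close> has the entries
    \<open>X $$ (k, l) * (d k - e l)\<close> up to order of factors, and the Frobenius norm does not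
    see the change of bases.\<close>
  have cost: "(\<Sum>k<n. \<Sum>l<n. (X $$ (k, l))\<^sup>2 * (d k - e l)\<^sup>2) = F"
  proof -
    have "transpose_mat P * (A - B) * Q = transpose_mat P * A * Q - transpose_mat P * B * Q"
      using PT A(1) B(1) Q(1) by (simp add: mult_minus_distrib_mat[of _ n n _ n] minus_mult_distrib_mat[of _ n n _ _ n])
    also have "transpose_mat P * A * Q = (transpose_mat P * P) * (mat_diag n d * X)"
      unfolding P(4) X_def by (rule assoc_mult_mat_5(1)[OF PT P(1) Dd PT Q(1)])
    also have "\<dots> = mat_diag n d * X"
      unfolding P(3) by (rule left_mult_one_mat) (rule mult_carrier_mat[OF Dd X])
    also have "transpose_mat P * B * Q = (X * mat_diag n e) * (transpose_mat Q * Q)"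
      unfolding Q(4) X_def by (rule assoc_mult_mat_5(2)[OF PT Q(1) De QT Q(1)])
    also have "\<dots> = X * mat_diag n e"
      unfolding Q(3) by (rule right_mult_one_mat) (rule mult_carrier_mat[OF X De])
    finally have eq: "transpose_mat P * (A - B) * transpose_mat (transpose_mat Q) = mat_diag n d * X - X * mat_diag n e"
      by simp
    have "F = (\<Sum>i<n. \<Sum>j<n. ((A - B) $$ (i, j))\<^sup>2)"
      unfolding F_def using A(1) B(1) by (intro sum.cong refl) auto
    also have "\<dots> = (\<Sum>i<n. \<Sum>j<n. ((transpose_mat P * (A - B) * transpose_mat (transpose_mat Q)) $$ (i, j))\<^sup>2)"
      by (rule frobenius_orthogonal[OF PT _ QT _, symmetric]) (use P Q A B in auto)
    also have "\<dots> = (\<Sum>k<n. \<Sum>l<n. (X $$ (k, l))\<^sup>2 * (d k - e l)\<^sup>2)"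
      unfolding eq mat_diag_mult_left[OF X] mat_diag_mult_right[OF X]
      by (intro sum.cong refl) (auto simp: power_mult_distrib[symmetric] algebra_simps)
    finally show ?thesis ..
  qed
  have "(\<Sum>k<n. indicator {..s} (d k)) = (\<Sum>k<n. \<Sum>l<n. (X $$ (k, l))\<^sup>2 * indicator {..s} (d k))"
    using X2 by (simp add: sum_distrib_right[symmetric])
  also have "\<dots> \<le> (\<Sum>k<n. \<Sum>l<n. (X $$ (k, l))\<^sup>2 * indicator {..s + \<epsilon>} (e l) + (X $$ (k, l))\<^sup>2 * (d k - e l)\<^sup>2 / \<epsilon>\<^sup>2)"
  proof (intro sum_mono)
    fix k l
    \<comment> \<open>If \<open>d k \<le> s\<close>, then either \<open>e l\<close> is at most
      \<open>s + \<epsilon>\<close> or the pair is more than \<open>\<epsilon>\<close> apart, as in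
      Chebyshev's inequality.\<close>
    have "indicator {..s} (d k) \<le> indicator {..s + \<epsilon>} (e l) + (d k - e l)\<^sup>2 / \<epsilon>\<^sup>2"
    proof (cases "d k \<le> s \<and> e l > s + \<epsilon>")
      case True
      then have "\<epsilon>\<^sup>2 \<le> (e l - d k)\<^sup>2" using \<epsilon> by (intro power_mono) auto
      then have "1 \<le> (d k - e l)\<^sup>2 / \<epsilon>\<^sup>2" using \<epsilon> by (simp add: power2_commute)
      then show ?thesis using True by (simp add: indicator_def)
    qed (auto simp: indicator_def)
    then have "(X $$ (k, l))\<^sup>2 * indicator {..s} (d k) \<le> (X $$ (k, l))\<^sup>2 * (indicator {..s + \<epsilon>} (e l) + (d k - e l)\<^sup>2 / \<epsilon>\<^sup>2)"
      by (intro mult_left_mono) auto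
    then show "(X $$ (k, l))\<^sup>2 * indicator {..s} (d k) \<le> (X $$ (k, l))\<^sup>2 * indicator {..s + \<epsilon>} (e l) + (X $$ (k, l))\<^sup>2 * (d k - e l)\<^sup>2 / \<epsilon>\<^sup>2"
      by (simp add: distrib_left)
  qed
  also have "\<dots> = (\<Sum>k<n. \<Sum>l<n. (X $$ (k, l))\<^sup>2 * indicator {..s + \<epsilon>} (e l)) + F / \<epsilon>\<^sup>2"
    unfolding cost[symmetric] by (simp add: sum.distrib sum_divide_distrib)
  also have "(\<Sum>k<n. \<Sum>l<n. (X $$ (k, l))\<^sup>2 * indicator {..s + \<epsilon>} (e l)) = (\<Sum>l<n. indicator {..s + \<epsilon>} (e l))"
    by (subst sum.swap) (use X1 in \<open>simp add: sum_distrib_right[symmetric]\<close>)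
  finally have "(\<Sum>k<n. indicator {..s} (d k)) / real n \<le> ((\<Sum>l<n. indicator {..s + \<epsilon>} (e l)) + F / \<epsilon>\<^sup>2) / real n"
    by (intro divide_right_mono) auto
  then show ?thesis unfolding cdf_esd[OF Pd n] cdf_esd[OF Qe n] F_def[symmetric]
    by (simp add: add_divide_distrib mult.commute)
qed

section \<open>Counting closed walks\<close>

text \<open>Extensional functions on \<open>{0..k}\<close>, so that a walk is determined by its
  positions and only finitely many exist. The base point counts, as it does in a trace.\<close>

definition closed_walks :: "nat \<Rightarrow> nat \<Rightarrow> (nat \<Rightarrow> nat) set" where
  "closed_walks n k = {p \<in> {0..k} \<rightarrow>\<^sub>E {..<n}. p 0 = p k}"

lemma finite_closed_walks: "finite (closed_walks n k)"
  unfolding closed_walks_def by (rule finite_subset[of _ "{0..k} \<rightarrow>\<^sub>E {..<n}"]) (auto intro: finite_PiE)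

lemma mat_pow_index:
  fixes A :: "real Matrix.mat"
  assumes A: "A \<in> carrier_mat n n" and "a < n" "c < n"
  shows "(A ^\<^sub>m k) $$ (a, c) =
    (\<Sum>p | p \<in> {0..k} \<rightarrow>\<^sub>E {..<n} \<and> p 0 = a \<and> p k = c. \<Prod>i\<in>{1..k}. A $$ (p (i - 1), p i))"
  using assms(3)
proof (induction k arbitrary: c)
  case 0
  have "{p. p \<in> {0..0::nat} \<rightarrow>\<^sub>E {..<n} \<and> p 0 = a \<and> p 0 = c} = (if a = c then {\<lambda>i\<in>{0}. a} else {})"
    using assms(2) by (auto simp: PiE_def extensional_def)
  then show ?case using assms(1,2) 0 by auto
next
  case (Suc k)
  let ?S = "\<lambda>(k::nat) c. {p. p \<in> {0..k} \<rightarrow>\<^sub>E {..<n} \<and> p 0 = a \<and> p k = c}"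
  let ?w = "\<lambda>(k::nat) p. \<Prod>i\<in>{1..k}. A $$ (p (i - 1), p i)"
  have fin: "finite (?S k c)" for k c
    by (rule finite_subset[of _ "{0..k} \<rightarrow>\<^sub>E {..<n}"]) (auto intro: finite_PiE)
  have Ak: "A ^\<^sub>m k \<in> carrier_mat n n" using A by simp
  have "(A ^\<^sub>m Suc k) $$ (a, c) = (\<Sum>b<n. (A ^\<^sub>m k) $$ (a, b) * A $$ (b, c))"
    using mult_mat_index[OF Ak A assms(2) Suc.prems] by simp
  also have "\<dots> = (\<Sum>b<n. \<Sum>p\<in>?S k b. ?w k p * A $$ (p k, c))"
    using Suc.IH by (simp add: sum_distrib_right)
  also have "\<dots> = (\<Sum>(b, p)\<in>(SIGMA b:{..<n}. ?S k b). ?w k p * A $$ (p k, c))"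
    using fin by (intro sum.Sigma) auto
  also have "\<dots> = (\<Sum>p\<in>?S (Suc k) c. ?w (Suc k) p)"
  proof (rule sum.reindex_bij_witness[of _ "\<lambda>p. (p k, restrict p {0..k})" "\<lambda>(b, p). p(Suc k := c)"])
    fix bp assume "bp \<in> (SIGMA b:{..<n}. ?S k b)"
    then obtain b p where bp: "bp = (b, p)" "b < n" "p \<in> {0..k} \<rightarrow>\<^sub>E {..<n}" "p 0 = a" "p k = b" by auto
    have r: "restrict (p(Suc k := c)) {0..k} = p"
      using bp(3) by (auto simp: restrict_def PiE_def extensional_def fun_eq_iff)
    show "((case bp of (b, p) \<Rightarrow> p(Suc k := c)) k, restrict (case bp of (b, p) \<Rightarrow> p(Suc k := c)) {0..k}) = bp"
      using bp r by simp
    show "(case bp of (b, p) \<Rightarrow> p(Suc k := c)) \<in> ?S (Suc k) c"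
      using bp Suc.prems by (auto simp: PiE_def extensional_def le_Suc_eq Pi_def)
    show "?w (Suc k) (case bp of (b, p) \<Rightarrow> p(Suc k := c)) = (case bp of (b, p) \<Rightarrow> ?w k p * A $$ (p k, c))"
    proof -
      have "?w k (p(Suc k := c)) = ?w k p" by (intro prod.cong refl) auto
      then show ?thesis using bp by simp
    qed
  next
    fix p assume p: "p \<in> ?S (Suc k) c"
    then show "(case (p k, restrict p {0..k}) of (b, p) \<Rightarrow> p(Suc k := c)) = p"
      by (auto simp: restrict_def PiE_def extensional_def fun_eq_iff le_Suc_eq)
    show "(p k, restrict p {0..k}) \<in> (SIGMA b:{..<n}. ?S k b)"
      using p by auto
  qed
  finally show ?case .
qed

lemma mat_tr_pow:
  fixes A :: "real Matrix.mat"
  assumes A: "A \<in> carrier_mat n n"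
  shows "mat_tr (A ^\<^sub>m k) = (\<Sum>p\<in>closed_walks n k. \<Prod>i\<in>{1..k}. A $$ (p (i - 1), p i))"
proof -
  let ?S = "\<lambda>a. {p. p \<in> {0..k} \<rightarrow>\<^sub>E {..<n} \<and> p 0 = a \<and> p k = a}"
  have fin: "finite (?S a)" for a
    by (rule finite_subset[of _ "{0..k} \<rightarrow>\<^sub>E {..<n}"]) (auto intro: finite_PiE)
  have "A ^\<^sub>m k \<in> carrier_mat n n" using A by simp
  then have "mat_tr (A ^\<^sub>m k) = (\<Sum>a<n. \<Sum>p\<in>?S a. \<Prod>i\<in>{1..k}. A $$ (p (i - 1), p i))"
    unfolding mat_tr_def using mat_pow_index[OF A] by auto
  also have "\<dots> = (\<Sum>p\<in>(\<Union>a\<in>{..<n}. ?S a). \<Prod>i\<in>{1..k}. A $$ (p (i - 1), p i))"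
    using fin by (intro sum.UNION_disjoint[symmetric]) auto
  also have "(\<Union>a\<in>{..<n}. ?S a) = closed_walks n k"
    unfolding closed_walks_def by (auto simp: PiE_def Pi_def)
  finally show ?thesis .
qed

section \<open>Numbers of walks with a given edge partition\<close>

lemma card_functions_small_image:
  assumes "finite S"
  shows "card {f \<in> S \<rightarrow>\<^sub>E {..<n::nat}. card (f ` S) = v} \<le> v ^ card S * n ^ v"
proof -
  let ?G = "(S \<rightarrow>\<^sub>E {..<v}) \<times> ({..<v} \<rightarrow>\<^sub>E {..<n})"
  have fin: "finite ?G" using assms by (intro finite_cartesian_product finite_PiE) auto
  \<comment> \<open>Factor \<open>f\<close> through \<open>{..<v}\<close>: the map \<open>h\<close>
    enumerates the image and \<open>g\<close> records which value is taken.\<close>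
  have "{f \<in> S \<rightarrow>\<^sub>E {..<n}. card (f ` S) = v} \<subseteq> (\<lambda>(g, h). restrict (h \<circ> g) S) ` ?G"
  proof
    fix f assume "f \<in> {f \<in> S \<rightarrow>\<^sub>E {..<n}. card (f ` S) = v}"
    then have f: "f \<in> S \<rightarrow>\<^sub>E {..<n}" "card (f ` S) = v" by auto
    obtain h where h: "bij_betw h {..<v} (f ` S)"
      using ex_bij_betw_nat_finite[of "f ` S"] assms f(2) by (auto simp: atLeast0LessThan)
    define g where "g = restrict (\<lambda>s. inv_into {..<v} h (f s)) S"
    have inv: "inv_into {..<v} h (f s) \<in> {..<v}" "h (inv_into {..<v} h (f s)) = f s" if "s \<in> S" for s
    proof -
      have fs: "f s \<in> h ` {..<v}" using bij_betw_imp_surj_on[OF h] that by simp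
      show "inv_into {..<v} h (f s) \<in> {..<v}" by (rule inv_into_into[OF fs])
      show "h (inv_into {..<v} h (f s)) = f s" by (rule f_inv_into_f[OF fs])
    qed
    have hf: "h i < n" if "i < v" for i
    proof -
      have "h i \<in> f ` S" using bij_betw_apply[OF h] that by auto
      then show ?thesis using f(1) by auto
    qed
    have r: "restrict (restrict h {..<v} \<circ> g) S = f"
    proof
      fix s show "restrict (restrict h {..<v} \<circ> g) S s = f s"
        using inv[of s] f(1) by (auto simp: g_def restrict_def PiE_def extensional_def)
    qed
    have "(g, restrict h {..<v}) \<in> ?G" using inv hf by (auto simp: g_def)
    then show "f \<in> (\<lambda>(g, h). restrict (h \<circ> g) S) ` ?G"
      by (rule image_eqI[rotated]) (simp only: prod.case r)
  qed
  then have "card {f \<in> S \<rightarrow>\<^sub>E {..<n}. card (f ` S) = v} \<le> card ?G"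
    by (rule surj_card_le[OF fin])
  also have "\<dots> = v ^ card S * n ^ v"
    using assms by (simp add: card_cartesian_product card_PiE)
  finally show ?thesis .
qed

text \<open>Only the power of \<open>n\<close> matters later, so each image size up to
  \<open>b\<close> is bounded crudely by the case \<open>b\<close>.\<close>

lemma card_functions_image_le:
  assumes "finite S" "n \<ge> 1"
  shows "card {f \<in> S \<rightarrow>\<^sub>E {..<n::nat}. card (f ` S) \<le> b} \<le> Suc b * b ^ card S * n ^ b"
proof (cases "S = {}")
  case True
  have "card {f \<in> S \<rightarrow>\<^sub>E {..<n::nat}. card (f ` S) \<le> b} \<le> card (S \<rightarrow>\<^sub>E {..<n::nat})"
    using assms by (intro card_mono finite_PiE) auto
  also have "\<dots> = 1" using True by simp
  also have "1 \<le> Suc b * b ^ card S * n ^ b"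
    using True one_le_power[OF assms(2), of b] by (simp add: trans_le_add1)
  finally show ?thesis .
next
  case False
  have "{f \<in> S \<rightarrow>\<^sub>E {..<n::nat}. card (f ` S) \<le> b} = (\<Union>v\<in>{..b}. {f \<in> S \<rightarrow>\<^sub>E {..<n}. card (f ` S) = v})"
    by auto
  then have "card {f \<in> S \<rightarrow>\<^sub>E {..<n::nat}. card (f ` S) \<le> b} \<le> (\<Sum>v\<le>b. card {f \<in> S \<rightarrow>\<^sub>E {..<n}. card (f ` S) = v})"
    by (simp only:) (rule card_UN_le, simp)
  also have "\<dots> \<le> (\<Sum>v\<le>b. b ^ card S * n ^ b)"
  proof (rule sum_mono)
    fix v assume v: "v \<in> {..b}"
    have "card {f \<in> S \<rightarrow>\<^sub>E {..<n}. card (f ` S) = v} \<le> v ^ card S * n ^ v"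
      by (rule card_functions_small_image[OF assms(1)])
    also have "\<dots> \<le> b ^ card S * n ^ b"
      using v assms(2) by (intro mult_le_mono power_mono power_increasing) auto
    finally show "card {f \<in> S \<rightarrow>\<^sub>E {..<n}. card (f ` S) = v} \<le> b ^ card S * n ^ b" .
  qed
  finally show ?thesis by (simp add: algebra_simps)
qed

definition walk_count :: "nat \<Rightarrow> nat \<Rightarrow> nat set set \<Rightarrow> nat" where
  "walk_count n k \<sigma> = card {p \<in> closed_walks n k. edge_part p k = \<sigma>}"

text \<open>A step that is not the first of its block runs along a known edge from a known position,
  so its endpoint is forced. Free choices remain only at the start and at the block minima, which
  yields \<open>walk_count_le\<close>.\<close>

lemma walk_determined:
  assumes p: "edge_part p k = \<sigma>" and q: "edge_part q k = \<sigma>" and "p 0 = q 0"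
    and "\<And>U. U \<in> \<sigma> \<Longrightarrow> p (Min U) = q (Min U)"
  shows "i \<le> k \<Longrightarrow> p i = q i"
proof (induction i rule: less_induct)
  case (less i)
  show ?case
  proof (cases "i = 0")
    case False
    then have i: "i \<in> {1..k}" using less by auto
    define U where "U = {j \<in> {1..k}. walk_edge p j = walk_edge p i}"
    have U: "U \<in> \<sigma>" using i unfolding p[symmetric] U_def edge_part_def by blast
    have iU: "i \<in> U" "finite U" using i by (auto simp: U_def)
    define s where "s = Min U"
    have sU: "s \<in> U" unfolding s_def using iU by (intro Min_in) auto
    have si: "s \<le> i" unfolding s_def using iU by simp
    obtain f where f: "U = {j \<in> {1..k}. walk_edge q j = f}" using U unfolding q[symmetric] edge_part_def by auto
    have qe: "walk_edge q i = walk_edge q s" using iU sU unfolding f by auto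
    have pe: "walk_edge p i = walk_edge p s" using sU unfolding U_def by auto
    have s1: "s \<ge> 1" using sU by (auto simp: U_def)
    show ?thesis
    proof (cases "s = i")
      case True
      then show ?thesis using assms(4)[OF U] by (simp add: s_def)
    next
      case False
      then have "s < i" using si by simp
      then have "p s = q s" "p (s - 1) = q (s - 1)" "p (i - 1) = q (i - 1)"
        using less s1 i by (auto intro!: less.IH)
      then show ?thesis using pe qe by (auto simp: walk_edge_def doubleton_eq_iff)
    qed
  qed (use assms(3) in simp)
qed

lemma walk_count_le:
  assumes part: "partition_on {1..k} \<sigma>" shows "walk_count n k \<sigma> \<le> n ^ Suc (card \<sigma>)"
proof -
  let ?W = "{p \<in> closed_walks n k. edge_part p k = \<sigma>}"
  let ?F = "\<lambda>p. (p 0, \<lambda>U\<in>\<sigma>. p (Min U))"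
  have fin\<sigma>: "finite \<sigma>" by (rule finite_elements[OF _ part]) simp
  have "card ?W \<le> card ({..<n} \<times> (\<sigma> \<rightarrow>\<^sub>E {..<n}))"
  proof (rule card_inj_on_le[of ?F])
    show "inj_on ?F ?W"
    proof (rule inj_onI)
      fix p q assume p: "p \<in> ?W" and q: "q \<in> ?W" and eq: "?F p = ?F q"
      have "p (Min U) = q (Min U)" if "U \<in> \<sigma>" for U
        using eq that by (metis prod.inject restrict_apply')
      then have "p i = q i" if "i \<le> k" for i
        using walk_determined[of p k \<sigma> q i] p q eq that by auto
      moreover have "p i = q i" if "\<not> i \<le> k" for i
        using p q that by (auto simp: closed_walks_def PiE_def extensional_def)
      ultimately show "p = q" by blast
    qed
    have "Min U \<le> k" if "U \<in> \<sigma>" for U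
    proof -
      have "U \<subseteq> {1..k}" "U \<noteq> {}" using that partition_onD1[OF part] partition_onD3[OF part] by auto
      then have "Min U \<in> {1..k}" by (meson Min_in finite_atLeastAtMost finite_subset subsetD)
      then show ?thesis by simp
    qed
    then show "?F ` ?W \<subseteq> {..<n} \<times> (\<sigma> \<rightarrow>\<^sub>E {..<n})"
      by (auto simp: closed_walks_def PiE_def Pi_def)
    show "finite ({..<n} \<times> (\<sigma> \<rightarrow>\<^sub>E {..<n}))" using fin\<sigma> by (intro finite_cartesian_product finite_PiE) auto
  qed
  also have "\<dots> = n ^ Suc (card \<sigma>)" using fin\<sigma> by (simp add: card_cartesian_product card_PiE)
  finally show ?thesis unfolding walk_count_def .
qed

text \<open>A walk whose partition is not special symmetric is not a tree walk, so it has no more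
  vertices than edges, and one factor \<open>n\<close> is lost.\<close>

lemma walk_count_not_SS:
  assumes "\<sigma> \<notin> SS k" "k \<ge> 1" "n \<ge> 1"
  shows "walk_count n k \<sigma> \<le> Suc (card \<sigma>) * card \<sigma> ^ Suc k * n ^ card \<sigma>"
proof -
  have "walk_count n k \<sigma> \<le> card {f \<in> {0..k} \<rightarrow>\<^sub>E {..<n}. card (f ` {0..k}) \<le> card \<sigma>}"
    unfolding walk_count_def
  proof (rule card_mono)
    show "finite {f \<in> {0..k} \<rightarrow>\<^sub>E {..<n}. card (f ` {0..k}) \<le> card \<sigma>}"
      by (rule finite_subset[of _ "{0..k} \<rightarrow>\<^sub>E {..<n}"]) (auto intro: finite_PiE)
    show "{p \<in> closed_walks n k. edge_part p k = \<sigma>} \<subseteq> {f \<in> {0..k} \<rightarrow>\<^sub>E {..<n}. card (f ` {0..k}) \<le> card \<sigma>}"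
    proof
      fix p assume "p \<in> {p \<in> closed_walks n k. edge_part p k = \<sigma>}"
      then have p: "p \<in> {0..k} \<rightarrow>\<^sub>E {..<n}" "p 0 = p k" "edge_part p k = \<sigma>" by (auto simp: closed_walks_def)
      have "\<not> tree_walk p k" using SS_iff_tree_walk[OF assms(2), of \<sigma>] assms(1) p(3) by metis
      then have "card (p ` {0..k}) \<noteq> Suc (card \<sigma>)"
        using p card_edge_part[of p k] by (auto simp: tree_walk_def)
      moreover have "card (p ` {0..k}) \<le> Suc (card \<sigma>)"
        using walk_vertices_le[of p k] p card_edge_part[of p k] by simp
      ultimately show "p \<in> {f \<in> {0..k} \<rightarrow>\<^sub>E {..<n}. card (f ` {0..k}) \<le> card \<sigma>}" using p(1) by simp
    qed
  qed
  also have "\<dots> \<le> Suc (card \<sigma>) * card \<sigma> ^ card {0..k} * n ^ card \<sigma>"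
    by (rule card_functions_image_le) (use assms in auto)
  finally show ?thesis by simp
qed

lemma edge_part_inj_comp:
  assumes "inj_on h (q ` {0..k})" shows "edge_part (\<lambda>i. h (q i)) k = edge_part q k"
proof (rule edge_part_eqI[OF edge_part_partition])
  fix i j assume ij: "i \<in> {1..k}" "j \<in> {1..k}"
  have sub: "walk_edge q i \<subseteq> q ` {0..k}" if "i \<in> {1..k}" for i using that by (auto simp: walk_edge_def)
  have "walk_edge (\<lambda>i. h (q i)) i = h ` walk_edge q i" for i by (simp add: walk_edge_def)
  then have "walk_edge (\<lambda>i. h (q i)) i = walk_edge (\<lambda>i. h (q i)) j \<longleftrightarrow> walk_edge q i = walk_edge q j"
    using inj_on_image_eq_iff[OF assms sub[OF ij(1)] sub[OF ij(2)]] by simp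
  also have "\<dots> \<longleftrightarrow> (\<exists>U\<in>edge_part q k. i \<in> U \<and> j \<in> U)"
    using ij unfolding edge_part_def by auto
  finally show "walk_edge (\<lambda>i. h (q i)) i = walk_edge (\<lambda>i. h (q i)) j \<longleftrightarrow> (\<exists>U\<in>edge_part q k. i \<in> U \<and> j \<in> U)" .
qed

lemma edge_part_cong:
  assumes "\<And>i. i \<le> k \<Longrightarrow> p i = q i" shows "edge_part p k = edge_part q k"
proof -
  have "walk_edge p i = walk_edge q i" if "i \<in> {1..k}" for i
  proof -
    have "i \<le> k" "i - 1 \<le> k" using that by auto
    then show ?thesis unfolding walk_edge_def using assms by metis
  qed
  then have "walk_edge p ` {1..k} = walk_edge q ` {1..k}"
    and "{i \<in> {1..k}. walk_edge p i = e} = {i \<in> {1..k}. walk_edge q i = e}" for e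
    by auto
  then show ?thesis unfolding edge_part_def by simp
qed

text \<open>Relabelling the vertices of one fixed tree walk injectively keeps its edge partition.
  The added term of order \<open>n ^ b\<close> accounts for the labellings that are not
  injective.\<close>

lemma walk_count_SS_ge:
  assumes "\<sigma> \<in> SS k" "k \<ge> 1" "n \<ge> 1"
  defines "b \<equiv> card \<sigma>"
  shows "n ^ Suc b \<le> walk_count n k \<sigma> + Suc b * b ^ Suc b * n ^ b"
proof -
  obtain q :: "nat \<Rightarrow> nat" where q: "tree_walk q k" "edge_part q k = \<sigma>"
    using SS_iff_tree_walk[OF assms(2)] assms(1) by metis
  let ?V = "q ` {0..k}"
  have cV: "card ?V = Suc b" using q card_edge_part[of q k] by (simp add: tree_walk_def b_def)
  let ?I = "{h \<in> ?V \<rightarrow>\<^sub>E {..<n}. inj_on h ?V}" and ?N = "{h \<in> ?V \<rightarrow>\<^sub>E {..<n}. card (h ` ?V) \<le> b}"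
  have finV: "finite (?V \<rightarrow>\<^sub>E {..<n})" by (intro finite_PiE) auto
  have "n ^ Suc b = card (?V \<rightarrow>\<^sub>E {..<n})" by (simp add: card_PiE cV)
  also have "\<dots> \<le> card (?I \<union> ?N)"
  proof (rule card_mono)
    show "finite (?I \<union> ?N)" by (rule finite_subset[OF _ finV]) auto
    show "?V \<rightarrow>\<^sub>E {..<n} \<subseteq> ?I \<union> ?N"
    proof
      fix h assume h: "h \<in> ?V \<rightarrow>\<^sub>E {..<n}"
      have "card (h ` ?V) \<le> Suc b" using card_image_le[of ?V h] cV by simp
      moreover have "inj_on h ?V" if "card (h ` ?V) = Suc b"
        by (rule eq_card_imp_inj_on) (use that cV in auto)
      ultimately show "h \<in> ?I \<union> ?N" using h by (auto simp: le_Suc_eq)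
    qed
  qed
  also have "\<dots> \<le> card ?I + card ?N" by (rule card_Un_le)
  also have "card ?N \<le> Suc b * b ^ Suc b * n ^ b"
    using card_functions_image_le[of ?V n b] assms(3) cV by simp
  also have "card ?I \<le> walk_count n k \<sigma>"
    unfolding walk_count_def
  proof (rule card_inj_on_le[of "\<lambda>h. \<lambda>i\<in>{0..k}. h (q i)"])
    show "inj_on (\<lambda>h. \<lambda>i\<in>{0..k}. h (q i)) ?I"
    proof (rule inj_onI)
      fix h h' assume h: "h \<in> ?I" "h' \<in> ?I" and eq: "(\<lambda>i\<in>{0..k}. h (q i)) = (\<lambda>i\<in>{0..k}. h' (q i))"
      have e: "h (q i) = h' (q i)" if "i \<in> {0..k}" for i using fun_cong[OF eq, of i] that by simp
      show "h = h'"
      proof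
        fix v show "h v = h' v"
          using h e by (cases "v \<in> ?V") (auto simp: PiE_def extensional_def)
      qed
    qed
    show "(\<lambda>h. \<lambda>i\<in>{0..k}. h (q i)) ` ?I \<subseteq> {p \<in> closed_walks n k. edge_part p k = \<sigma>}"
    proof
      fix p assume "p \<in> (\<lambda>h. \<lambda>i\<in>{0..k}. h (q i)) ` ?I"
      then obtain h where h: "h \<in> ?V \<rightarrow>\<^sub>E {..<n}" "inj_on h ?V" "p = (\<lambda>i\<in>{0..k}. h (q i))" by auto
      have "edge_part p k = edge_part (\<lambda>i. h (q i)) k" by (rule edge_part_cong) (simp add: h(3))
      also have "\<dots> = \<sigma>" using edge_part_inj_comp[OF h(2)] q(2) by simp
      finally show "p \<in> {p \<in> closed_walks n k. edge_part p k = \<sigma>}"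
        using h(1,3) q(1) by (auto simp: closed_walks_def tree_walk_def)
    qed
    show "finite {p \<in> closed_walks n k. edge_part p k = \<sigma>}" using finite_closed_walks by simp
  qed
  finally show ?thesis by simp
qed

lemma mean_by_edge_partition:
  "(\<Sum>p\<in>closed_walks n k. f (edge_part p k)) =
     (\<Sum>\<sigma> | partition_on {1..k} \<sigma>. real (walk_count n k \<sigma>) * f \<sigma>)"
proof -
  have "(\<Sum>p\<in>closed_walks n k. f (edge_part p k)) =
    (\<Sum>\<sigma> | partition_on {1..k} \<sigma>. \<Sum>p | p \<in> closed_walks n k \<and> edge_part p k = \<sigma>. f (edge_part p k))"
  proof (rule sum.group[symmetric])
    show "(\<lambda>p. edge_part p k) ` closed_walks n k \<subseteq> {\<sigma>. partition_on {1..k} \<sigma>}"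
      using edge_part_partition by blast
    show "finite {\<sigma>. partition_on {1..k} \<sigma>}" by (rule finitely_many_partition_on) simp
  qed (rule finite_closed_walks)
  also have "\<dots> = (\<Sum>\<sigma> | partition_on {1..k} \<sigma>. real (walk_count n k \<sigma>) * f \<sigma>)"
    by (intro sum.cong refl) (simp add: walk_count_def)
  finally show ?thesis .
qed

lemma walk_count_SS_limit:
  assumes "\<sigma> \<in> SS k" "k \<ge> 1"
  shows "(\<lambda>n. real (walk_count n k \<sigma>) / real n ^ Suc (card \<sigma>)) \<longlonglongrightarrow> 1"
proof (rule tendsto_sandwich)
  define b where "b = card \<sigma>"
  define K where "K = real (Suc b * b ^ Suc b)"
  have part: "partition_on {1..k} \<sigma>" using assms(1) by (simp add: SS_def)
  show "\<forall>\<^sub>F n in sequentially. 1 - K / real n \<le> real (walk_count n k \<sigma>) / real n ^ Suc (card \<sigma>)"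
    using eventually_ge_at_top[of 1]
  proof eventually_elim
    case (elim n)
    have "n ^ Suc b \<le> walk_count n k \<sigma> + Suc b * b ^ Suc b * n ^ b"
      using walk_count_SS_ge[OF assms elim] by (simp only: b_def)
    then have "real (n ^ Suc b) \<le> real (walk_count n k \<sigma> + Suc b * b ^ Suc b * n ^ b)" by (rule of_nat_mono)
    then have "real n ^ Suc b \<le> real (walk_count n k \<sigma>) + K * real n ^ b"
      unfolding K_def of_nat_add of_nat_mult of_nat_power .
    then have "(real n ^ Suc b - K * real n ^ b) / real n ^ Suc b \<le> real (walk_count n k \<sigma>) / real n ^ Suc b"
      by (intro divide_right_mono) auto
    moreover have "(real n ^ Suc b - K * real n ^ b) / real n ^ Suc b = 1 - K / real n"
      using elim by (simp add: field_simps)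
    ultimately show ?case by (simp only: b_def)
  qed
  show "\<forall>\<^sub>F n in sequentially. real (walk_count n k \<sigma>) / real n ^ Suc (card \<sigma>) \<le> 1"
    using eventually_ge_at_top[of 1]
  proof eventually_elim
    case (elim n)
    have "real (walk_count n k \<sigma>) \<le> real (n ^ Suc (card \<sigma>))"
      using walk_count_le[OF part, of n] by (rule of_nat_mono)
    then show ?case using elim by (simp add: divide_le_eq)
  qed
  show "(\<lambda>n. 1 - K / real n) \<longlonglongrightarrow> 1"
    using tendsto_diff[OF tendsto_const[of 1] lim_const_over_n[of K]] by simp
qed simp

lemma SS_block_even:
  assumes "\<sigma> \<in> SS k" "k \<ge> 1" "U \<in> \<sigma>"
  obtains j where "j \<ge> 1" "card U = 2 * j"
proof -
  obtain p :: "nat \<Rightarrow> nat" where "tree_walk p k" "edge_part p k = \<sigma>"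
    using SS_iff_tree_walk[OF assms(2)] assms(1) by metis
  then have "even (card U)" using tree_walk_block_even assms(3) by metis
  moreover have "card U > 0"
  proof -
    have part: "partition_on {1..k} \<sigma>" using assms(1) by (simp add: SS_def)
    have "U \<subseteq> {1..k}" using partition_onD1[OF part] assms(3) by auto
    then have "finite U" by (rule finite_subset) simp
    moreover have "U \<noteq> {}" using partition_onD3[OF part] assms(3) by metis
    ultimately show ?thesis by (simp add: card_gt_0_iff)
  qed
  ultimately show ?thesis by (intro that[of "card U div 2"]) presburger+
qed

lemma SS_odd_empty: "odd k \<Longrightarrow> SS k = {}"
proof (rule ccontr)
  assume k: "odd k" and "SS k \<noteq> {}"
  then obtain \<sigma> where "\<sigma> \<in> SS k" by auto
  moreover have "k \<ge> 1" using k by (cases k) auto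
  ultimately obtain p :: "nat \<Rightarrow> nat" where "tree_walk p k" using SS_iff_tree_walk by metis
  then show False using tree_walk_length_even k by blast
qed

text \<open>A special symmetric partition with \<open>b\<close> blocks has about
  \<open>n ^ Suc b\<close> walks, exactly enough for a factor \<open>n\<close> on each block moment
  and the normalisation. Any other partition has at most a constant multiple of
  \<open>n ^ b\<close>, so decay slightly slower than \<open>1 / n\<close> per block is enough to
  remove it.\<close>

theorem mean_limit:
  fixes m :: "nat \<Rightarrow> nat \<Rightarrow> real"
  assumes small: "\<And>j \<alpha>. j \<ge> 1 \<Longrightarrow> \<alpha> < 1 \<Longrightarrow> (\<lambda>n. real n powr \<alpha> * m n j) \<longlonglongrightarrow> 0"
    and lim: "\<And>j. j \<ge> 1 \<Longrightarrow> (\<lambda>n. real n * m n (2 * j)) \<longlonglongrightarrow> C (2 * j)"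
    and k: "k \<ge> 1"
  shows "(\<lambda>n. (\<Sum>p\<in>closed_walks n k. part_weight (m n) (edge_part p k)) / real n)
    \<longlonglongrightarrow> (\<Sum>\<sigma>\<in>SS k. part_weight C \<sigma>)"
proof -
  let ?Q = "{\<sigma>. partition_on {1..k} \<sigma>}"
  have finQ: "finite ?Q" by (rule finitely_many_partition_on) simp
  have block: "(\<lambda>n. real (walk_count n k \<sigma>) * part_weight (m n) \<sigma> / real n)
      \<longlonglongrightarrow> (if \<sigma> \<in> SS k then part_weight C \<sigma> else 0)" if part: "partition_on {1..k} \<sigma>" for \<sigma>
  proof -
    define b where "b = card \<sigma>"
    have fin\<sigma>: "finite \<sigma>" by (rule finite_elements[OF _ part]) simp
    have "\<sigma> \<noteq> {}" using partition_onD1[OF part] k by force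
    then have b: "b \<ge> 1" using fin\<sigma> by (simp add: b_def Suc_le_eq card_gt_0_iff)
    show ?thesis
    proof (cases "\<sigma> \<in> SS k")
      case True
      have "(\<lambda>n. real n * m n (card U)) \<longlonglongrightarrow> C (card U)" if "U \<in> \<sigma>" for U
      proof -
        obtain j where "j \<ge> 1" "card U = 2 * j" by (rule SS_block_even[OF True k \<open>U \<in> \<sigma>\<close>])
        then show ?thesis using lim by simp
      qed
      then have "(\<lambda>n. real (walk_count n k \<sigma>) / real n ^ Suc (card \<sigma>) * (\<Prod>U\<in>\<sigma>. real n * m n (card U)))
        \<longlonglongrightarrow> 1 * (\<Prod>U\<in>\<sigma>. C (card U))"
        by (intro tendsto_mult walk_count_SS_limit[OF True k] tendsto_prod)
      moreover have "\<forall>\<^sub>F n in sequentially. real (walk_count n k \<sigma>) / real n ^ Suc (card \<sigma>) * (\<Prod>U\<in>\<sigma>. real n * m n (card U))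
        = real (walk_count n k \<sigma>) * part_weight (m n) \<sigma> / real n"
        using eventually_ge_at_top[of 1]
      proof eventually_elim
        case (elim n)
        then show ?case by (simp add: part_weight_def prod.distrib field_simps)
      qed
      ultimately have "(\<lambda>n. real (walk_count n k \<sigma>) * part_weight (m n) \<sigma> / real n) \<longlonglongrightarrow> 1 * (\<Prod>U\<in>\<sigma>. C (card U))"
        by (rule Lim_transform_eventually)
      then show ?thesis using True by (simp add: part_weight_def)
    next
      case False
      \<comment> \<open>With \<open>\<alpha> * b = b - 1\<close> the \<open>b\<close> blocks
        together absorb \<open>n ^ b / n\<close>, which is all that remains after
        normalisation.\<close>
      define \<alpha> where "\<alpha> = 1 - 1 / real b"
      have \<alpha>: "\<alpha> < 1" using b by (simp add: \<alpha>_def)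
      define K where "K = real (Suc b * b ^ Suc k)"
      have card1: "card U \<ge> 1" if "U \<in> \<sigma>" for U
      proof -
        have "U \<subseteq> {1..k}" "U \<noteq> {}" using that partition_onD1[OF part] partition_onD3[OF part] by auto
        then have "finite U" "U \<noteq> {}" using finite_subset by auto
        then show ?thesis by (simp add: Suc_le_eq card_gt_0_iff)
      qed
      have "(\<lambda>n. \<Prod>U\<in>\<sigma>. real n powr \<alpha> * m n (card U)) \<longlonglongrightarrow> (\<Prod>U\<in>\<sigma>. 0)"
        by (intro tendsto_prod small card1 \<alpha>)
      then have z: "(\<lambda>n. K * \<bar>\<Prod>U\<in>\<sigma>. real n powr \<alpha> * m n (card U)\<bar>) \<longlonglongrightarrow> 0"
        using b by (intro tendsto_mult_right_zero tendsto_rabs_zero) (simp add: b_def power_0_left)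
      have "(\<lambda>n. real (walk_count n k \<sigma>) * part_weight (m n) \<sigma> / real n) \<longlonglongrightarrow> 0"
      proof (rule Lim_null_comparison[OF _ z])
        show "\<forall>\<^sub>F n in sequentially. norm (real (walk_count n k \<sigma>) * part_weight (m n) \<sigma> / real n)
          \<le> K * \<bar>\<Prod>U\<in>\<sigma>. real n powr \<alpha> * m n (card U)\<bar>"
          using eventually_ge_at_top[of 1]
        proof eventually_elim
          case (elim n)
          have n: "real n > 0" using elim by simp
          have "walk_count n k \<sigma> \<le> Suc b * b ^ Suc k * n ^ b"
            using walk_count_not_SS[OF False k elim] by (simp only: b_def)
          then have "real (walk_count n k \<sigma>) \<le> real (Suc b * b ^ Suc k * n ^ b)" by (rule of_nat_mono)
          then have wc: "real (walk_count n k \<sigma>) \<le> K * real n ^ b"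
            unfolding K_def of_nat_mult of_nat_power .
          have "(\<Prod>U\<in>\<sigma>. real n powr \<alpha>) = real n powr (\<alpha> * real b)"
            using n by (simp add: b_def powr_powr[symmetric] powr_realpow)
          also have "\<alpha> * real b = real b - 1" using b by (simp add: \<alpha>_def field_simps)
          also have "real n powr (real b - 1) = real n ^ b / real n"
            using n by (simp add: powr_diff powr_realpow)
          finally have pw: "\<bar>\<Prod>U\<in>\<sigma>. real n powr \<alpha> * m n (card U)\<bar> = real n ^ b / real n * \<bar>part_weight (m n) \<sigma>\<bar>"
            using n by (simp add: prod.distrib part_weight_def abs_mult)
          have "norm (real (walk_count n k \<sigma>) * part_weight (m n) \<sigma> / real n)
              = real (walk_count n k \<sigma>) * (\<bar>part_weight (m n) \<sigma>\<bar> / real n)"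
            by (simp add: abs_mult)
          also have "\<dots> \<le> K * real n ^ b * (\<bar>part_weight (m n) \<sigma>\<bar> / real n)"
            using wc by (intro mult_right_mono) auto
          finally show ?case unfolding pw by (simp add: mult_ac)
        qed
      qed
      then show ?thesis using False by simp
    qed
  qed
  have "(\<lambda>n. \<Sum>\<sigma>\<in>?Q. real (walk_count n k \<sigma>) * part_weight (m n) \<sigma> / real n)
     \<longlonglongrightarrow> (\<Sum>\<sigma>\<in>?Q. if \<sigma> \<in> SS k then part_weight C \<sigma> else 0)"
    using block by (intro tendsto_sum) auto
  moreover have "(\<Sum>\<sigma>\<in>?Q. if \<sigma> \<in> SS k then part_weight C \<sigma> else 0) = (\<Sum>\<sigma>\<in>SS k. part_weight C \<sigma>)"
  proof -
    have "(\<Sum>\<sigma>\<in>SS k. part_weight C \<sigma>) = (\<Sum>\<sigma>\<in>SS k. if \<sigma> \<in> SS k then part_weight C \<sigma> else 0)"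
      by (intro sum.cong refl) simp
    also have "\<dots> = (\<Sum>\<sigma>\<in>?Q. if \<sigma> \<in> SS k then part_weight C \<sigma> else 0)"
      by (rule sum.mono_neutral_left[OF finQ]) (auto simp: SS_def)
    finally show ?thesis ..
  qed
  ultimately show ?thesis
    unfolding mean_by_edge_partition sum_divide_distrib by simp
qed

section \<open>Moments of traces\<close>

text \<open>By independence this is the mean of a product of entries with labels \<open>e i\<close>,
  \<open>i \<in> S\<close>. Unlike \<open>part_weight\<close> it allows any index set, so that
  several walks can be read as one word indexed by pairs.\<close>

definition word_weight :: "(nat \<Rightarrow> real) \<Rightarrow> ('i \<Rightarrow> 'e) \<Rightarrow> 'i set \<Rightarrow> real" where
  "word_weight m e S = (\<Prod>a\<in>e ` S. m (card {i \<in> S. e i = a}))"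

lemma word_weight_edge_part: "word_weight m (walk_edge p) {1..k} = part_weight m (edge_part p k)"
  unfolding word_weight_def part_weight_def edge_part_def
  by (subst prod.reindex[OF edge_part_inj]) simp

lemma word_weight_disjoint:
  assumes "finite S" "finite T" "S \<inter> T = {}" "e ` S \<inter> e ` T = {}"
  shows "word_weight m e (S \<union> T) = word_weight m e S * word_weight m e T"
proof -
  have "word_weight m e (S \<union> T) = (\<Prod>a\<in>e ` S. m (card {i \<in> S \<union> T. e i = a})) * (\<Prod>a\<in>e ` T. m (card {i \<in> S \<union> T. e i = a}))"
    unfolding word_weight_def image_Un using assms by (intro prod.union_disjoint) auto
  also have "(\<Prod>a\<in>e ` S. m (card {i \<in> S \<union> T. e i = a})) = word_weight m e S"
    unfolding word_weight_def
  proof (intro prod.cong refl arg_cong[of _ _ m] arg_cong[of _ _ card])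
    fix a assume "a \<in> e ` S"
    then show "{i \<in> S \<union> T. e i = a} = {i \<in> S. e i = a}" using assms(4) by blast
  qed
  also have "(\<Prod>a\<in>e ` T. m (card {i \<in> S \<union> T. e i = a})) = word_weight m e T"
    unfolding word_weight_def
  proof (intro prod.cong refl arg_cong[of _ _ m] arg_cong[of _ _ card])
    fix a assume "a \<in> e ` T"
    then show "{i \<in> S \<union> T. e i = a} = {i \<in> T. e i = a}" using assms(4) by blast
  qed
  finally show ?thesis .
qed

text \<open>Each distinct letter contributes one moment, whatever its multiplicity; for walks the
  exponent is therefore the number of distinct edges.\<close>

lemma word_weight_bound:
  assumes "finite S" "card S \<le> J" and m: "\<And>j. 1 \<le> j \<Longrightarrow> j \<le> J \<Longrightarrow> \<bar>m j\<bar> \<le> \<delta>"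
  shows "\<bar>word_weight m e S\<bar> \<le> \<delta> ^ card (e ` S)"
proof -
  have "\<bar>word_weight m e S\<bar> = (\<Prod>a\<in>e ` S. \<bar>m (card {i \<in> S. e i = a})\<bar>)"
    unfolding word_weight_def by (rule abs_prod)
  also have "\<dots> \<le> (\<Prod>a\<in>e ` S. \<delta>)"
  proof (rule prod_mono)
    fix a assume "a \<in> e ` S"
    then have "{i \<in> S. e i = a} \<noteq> {}" by auto
    then have "card {i \<in> S. e i = a} \<ge> 1" using assms(1) by (simp add: Suc_le_eq card_gt_0_iff)
    moreover have "card {i \<in> S. e i = a} \<le> J"
      using card_mono[OF assms(1), of "{i \<in> S. e i = a}"] assms(2) by auto
    ultimately show "0 \<le> \<bar>m (card {i \<in> S. e i = a})\<bar> \<and> \<bar>m (card {i \<in> S. e i = a})\<bar> \<le> \<delta>"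
      using m by simp
  qed
  finally show ?thesis by simp
qed

context prob_space
begin

lemma word_expectation:
  fixes Y :: "'e \<Rightarrow> 'a \<Rightarrow> real"
  assumes indep: "indep_vars (\<lambda>_. borel) Y I"
    and int: "\<And>a j. a \<in> I \<Longrightarrow> 1 \<le> j \<Longrightarrow> j \<le> J \<Longrightarrow> integrable M (\<lambda>\<omega>. Y a \<omega> ^ j)"
    and mom: "\<And>a j. a \<in> I \<Longrightarrow> 1 \<le> j \<Longrightarrow> j \<le> J \<Longrightarrow> expectation (\<lambda>\<omega>. Y a \<omega> ^ j) = m j"
    and S: "finite S" "e ` S \<subseteq> I" "card S \<le> J"
  shows "integrable M (\<lambda>\<omega>. \<Prod>i\<in>S. Y (e i) \<omega>)"
    and "expectation (\<lambda>\<omega>. \<Prod>i\<in>S. Y (e i) \<omega>) = word_weight m e S"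
proof -
  define c where "c a = card {i \<in> S. e i = a}" for a
  have c: "1 \<le> c a" "c a \<le> J" if "a \<in> e ` S" for a
  proof -
    have "{i \<in> S. e i = a} \<noteq> {}" using that by auto
    then show "c a \<ge> 1" using S(1) by (simp add: c_def Suc_le_eq card_gt_0_iff)
    show "c a \<le> J" using card_mono[OF S(1), of "{i \<in> S. e i = a}"] S(3) by (auto simp: c_def)
  qed
  have eq: "(\<Prod>i\<in>S. Y (e i) \<omega>) = (\<Prod>a\<in>e ` S. Y a \<omega> ^ c a)" for \<omega>
  proof -
    have "(\<Prod>i\<in>S. Y (e i) \<omega>) = (\<Prod>a\<in>e ` S. \<Prod>i | i \<in> S \<and> e i = a. Y (e i) \<omega>)"
      by (rule prod.group[symmetric]) (use S in auto)
    also have "\<dots> = (\<Prod>a\<in>e ` S. Y a \<omega> ^ c a)"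
      by (intro prod.cong refl) (simp add: c_def)
    finally show ?thesis .
  qed
  have ind: "indep_vars (\<lambda>_. borel) (\<lambda>a \<omega>. Y a \<omega> ^ c a) (e ` S)"
    by (rule indep_vars_compose2[OF indep_vars_subset[OF indep S(2)], of "\<lambda>a x. x ^ c a"]) simp
  have I: "integrable M (\<lambda>\<omega>. Y a \<omega> ^ c a)" if "a \<in> e ` S" for a
    using int[of a "c a"] c[OF that] that S(2) by auto
  show "integrable M (\<lambda>\<omega>. \<Prod>i\<in>S. Y (e i) \<omega>)"
    unfolding eq by (rule indep_vars_integrable[OF _ ind I]) (use S in auto)
  have "expectation (\<lambda>\<omega>. \<Prod>a\<in>e ` S. Y a \<omega> ^ c a) = (\<Prod>a\<in>e ` S. expectation (\<lambda>\<omega>. Y a \<omega> ^ c a))"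
    by (rule indep_vars_lebesgue_integral[OF _ ind I]) (use S in auto)
  also have "\<dots> = (\<Prod>a\<in>e ` S. m (c a))"
    using mom c S(2) by (intro prod.cong refl) auto
  finally show "expectation (\<lambda>\<omega>. \<Prod>i\<in>S. Y (e i) \<omega>) = word_weight m e S"
    unfolding eq word_weight_def c_def .
qed

section \<open>Joint moments of several centred words\<close>

context
  fixes Y :: "'e \<Rightarrow> 'a \<Rightarrow> real" and I J m and e :: "'l \<Rightarrow> nat \<Rightarrow> 'e" and L :: "'l set" and k :: nat
  assumes indep: "indep_vars (\<lambda>_. borel) Y I"
    and int: "\<And>a j. a \<in> I \<Longrightarrow> 1 \<le> j \<Longrightarrow> j \<le> J \<Longrightarrow> integrable M (\<lambda>\<omega>. Y a \<omega> ^ j)"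
    and mom: "\<And>a j. a \<in> I \<Longrightarrow> 1 \<le> j \<Longrightarrow> j \<le> J \<Longrightarrow> expectation (\<lambda>\<omega>. Y a \<omega> ^ j) = m j"
    and L: "finite L" "card L * k \<le> J" and eI: "\<And>j i. j \<in> L \<Longrightarrow> i \<in> {1..k} \<Longrightarrow> e j i \<in> I"
begin

private abbreviation "X \<equiv> \<lambda>j \<omega>. \<Prod>i\<in>{1..k}. Y (e j i) \<omega>"
private abbreviation "ww \<equiv> \<lambda>T. word_weight m (case_prod e) (T \<times> {1..k})"

lemma words_expectation:
  assumes "T \<subseteq> L"
  shows "integrable M (\<lambda>\<omega>. \<Prod>j\<in>T. X j \<omega>)" "expectation (\<lambda>\<omega>. \<Prod>j\<in>T. X j \<omega>) = ww T"
proof -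
  have fT: "finite T" by (rule finite_subset[OF assms L(1)])
  have eq: "(\<Prod>j\<in>T. X j \<omega>) = (\<Prod>x\<in>T \<times> {1..k}. Y (case_prod e x) \<omega>)" for \<omega>
    by (simp add: prod.cartesian_product case_prod_unfold)
  have "card (T \<times> {1..k}) \<le> card L * k"
    using card_mono[OF L(1) assms] by (simp add: card_cartesian_product)
  then have c: "card (T \<times> {1..k}) \<le> J" using L(2) by simp
  have s: "case_prod e ` (T \<times> {1..k}) \<subseteq> I" using eI assms by auto
  show "integrable M (\<lambda>\<omega>. \<Prod>j\<in>T. X j \<omega>)" "expectation (\<lambda>\<omega>. \<Prod>j\<in>T. X j \<omega>) = ww T"
    unfolding eq using word_expectation[OF indep int mom _ s c] fT by auto
qed

text \<open>The product of differences is expanded over the set \<open>T\<close> of words that keep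
  their random factor.\<close>

lemma words_centered_expectation:
  fixes c :: "'l \<Rightarrow> real"
  shows "integrable M (\<lambda>\<omega>. \<Prod>j\<in>L. (X j \<omega> - c j))"
    "expectation (\<lambda>\<omega>. \<Prod>j\<in>L. (X j \<omega> - c j)) = (\<Sum>T\<in>Pow L. ww T * (\<Prod>j\<in>L - T. - c j))"
proof -
  have eq: "(\<Prod>j\<in>L. (X j \<omega> - c j)) = (\<Sum>T\<in>Pow L. (\<Prod>j\<in>T. X j \<omega>) * (\<Prod>j\<in>L - T. - c j))" for \<omega>
    using prod_add[OF L(1), of "\<lambda>j. X j \<omega>" "\<lambda>j. - c j"] by simp
  have i: "integrable M (\<lambda>\<omega>. (\<Prod>j\<in>T. X j \<omega>) * (\<Prod>j\<in>L - T. - c j))" if "T \<in> Pow L" for T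
    using words_expectation(1)[of T] that by (intro integrable_mult_left) auto
  show "integrable M (\<lambda>\<omega>. \<Prod>j\<in>L. (X j \<omega> - c j))"
    unfolding eq using i by (intro Bochner_Integration.integrable_sum)
  show "expectation (\<lambda>\<omega>. \<Prod>j\<in>L. (X j \<omega> - c j)) = (\<Sum>T\<in>Pow L. ww T * (\<Prod>j\<in>L - T. - c j))"
    unfolding eq using i words_expectation
    by (subst Bochner_Integration.integral_sum) (auto intro!: sum.cong)
qed

text \<open>Replacing a word by its mean separates letters it shares with others, which can only
  increase the number of small factors; since \<open>\<delta> \<le> 1\<close>, every term is bounded
  by the case of the full union. The factor \<open>2 ^ card L\<close> counts the subsets.\<close>

lemma words_centered_bound:
  assumes m: "\<And>j. 1 \<le> j \<Longrightarrow> j \<le> J \<Longrightarrow> \<bar>m j\<bar> \<le> \<delta>" and \<delta>: "0 \<le> \<delta>" "\<delta> \<le> 1"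
  shows "\<bar>expectation (\<lambda>\<omega>. \<Prod>j\<in>L. (X j \<omega> - word_weight m (e j) {1..k}))\<bar>
    \<le> 2 ^ card L * \<delta> ^ card (\<Union>j\<in>L. e j ` {1..k})"
proof -
  let ?a = "\<lambda>j. word_weight m (e j) {1..k}"
  have "\<bar>\<Sum>T\<in>Pow L. ww T * (\<Prod>j\<in>L - T. - ?a j)\<bar> \<le> (\<Sum>T\<in>Pow L. \<bar>ww T * (\<Prod>j\<in>L - T. - ?a j)\<bar>)"
    by (rule sum_abs)
  also have "\<dots> \<le> (\<Sum>T\<in>Pow L. \<delta> ^ card (\<Union>j\<in>L. e j ` {1..k}))"
  proof (rule sum_mono)
    fix T assume "T \<in> Pow L"
    then have T: "T \<subseteq> L" and fT: "finite T" using L(1) finite_subset by auto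
    have img: "case_prod e ` (T \<times> {1..k}) = (\<Union>j\<in>T. e j ` {1..k})" by auto
    have "card (T \<times> {1..k}) \<le> card L * k" using card_mono[OF L(1) T] by (simp add: card_cartesian_product)
    from le_trans[OF this L(2)] have "card (T \<times> {1..k}) \<le> J" .
    then have b1: "\<bar>ww T\<bar> \<le> \<delta> ^ card (\<Union>j\<in>T. e j ` {1..k})"
      using word_weight_bound[of "T \<times> {1..k}" J m \<delta> "case_prod e", OF _ _ m] fT unfolding img by blast
    have b2: "\<bar>?a j\<bar> \<le> \<delta> ^ card (e j ` {1..k})" if "j \<in> L" for j
    proof -
      have "card L \<ge> 1" using that L(1) by (auto simp: Suc_le_eq card_gt_0_iff)
      then have "k \<le> card L * k" by simp
      from le_trans[OF this L(2)] show ?thesis using word_weight_bound[of "{1..k}" J m \<delta> "e j"] m by simp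
    qed
    have "\<bar>ww T * (\<Prod>j\<in>L - T. - ?a j)\<bar> = \<bar>ww T\<bar> * (\<Prod>j\<in>L - T. \<bar>?a j\<bar>)"
      by (simp add: abs_mult abs_prod)
    also have "\<dots> \<le> \<delta> ^ card (\<Union>j\<in>T. e j ` {1..k}) * (\<Prod>j\<in>L - T. \<delta> ^ card (e j ` {1..k}))"
      using b1 b2 \<delta>(1) by (intro mult_mono prod_mono prod_nonneg) auto
    also have "\<dots> = \<delta> ^ (card (\<Union>j\<in>T. e j ` {1..k}) + (\<Sum>j\<in>L - T. card (e j ` {1..k})))"
      by (simp add: power_add power_sum)
    also have "\<dots> \<le> \<delta> ^ card (\<Union>j\<in>L. e j ` {1..k})"
    proof (rule power_decreasing[OF _ \<delta>])
      have "(\<Union>j\<in>L. e j ` {1..k}) = (\<Union>j\<in>T. e j ` {1..k}) \<union> (\<Union>j\<in>L - T. e j ` {1..k})" using T by auto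
      then have "card (\<Union>j\<in>L. e j ` {1..k}) \<le> card (\<Union>j\<in>T. e j ` {1..k}) + card (\<Union>j\<in>L - T. e j ` {1..k})"
        by (simp only: card_Un_le)
      also have "card (\<Union>j\<in>L - T. e j ` {1..k}) \<le> (\<Sum>j\<in>L - T. card (e j ` {1..k}))"
        using L(1) by (intro card_UN_le) auto
      finally show "card (\<Union>j\<in>L. e j ` {1..k}) \<le> card (\<Union>j\<in>T. e j ` {1..k}) + (\<Sum>j\<in>L - T. card (e j ` {1..k}))"
        by simp
    qed
    finally show "\<bar>ww T * (\<Prod>j\<in>L - T. - ?a j)\<bar> \<le> \<delta> ^ card (\<Union>j\<in>L. e j ` {1..k})" .
  qed
  also have "\<dots> = 2 ^ card L * \<delta> ^ card (\<Union>j\<in>L. e j ` {1..k})"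
    by (simp add: card_Pow L(1))
  finally show ?thesis unfolding words_centered_expectation(2) .
qed

text \<open>A word without common letters is independent of the rest; in the expansion the terms for
  \<open>T\<close> and \<open>insert j0 T\<close> cancel in pairs.\<close>

lemma words_centered_zero:
  assumes j0: "j0 \<in> L" and dis: "\<And>j. j \<in> L - {j0} \<Longrightarrow> e j0 ` {1..k} \<inter> e j ` {1..k} = {}"
  shows "expectation (\<lambda>\<omega>. \<Prod>j\<in>L. (X j \<omega> - word_weight m (e j) {1..k})) = 0"
proof -
  let ?a = "\<lambda>j. word_weight m (e j) {1..k}"
  define L' where "L' = L - {j0}"
  have L': "L = insert j0 L'" "j0 \<notin> L'" "finite L'" using j0 L(1) by (auto simp: L'_def)
  have single: "ww {j0} = ?a j0"
  proof -
    have "expectation (\<lambda>\<omega>. \<Prod>j\<in>{j0}. X j \<omega>) = ww {j0}" by (rule words_expectation(2)) (use j0 in simp)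
    moreover have "expectation (\<lambda>\<omega>. \<Prod>i\<in>{1..k}. Y (e j0 i) \<omega>) = ?a j0"
    proof (rule word_expectation(2)[OF indep int mom])
      have "card L \<ge> 1" using j0 L(1) by (auto simp: Suc_le_eq card_gt_0_iff)
      then have "k \<le> card L * k" by simp
      from le_trans[OF this L(2)] show "card {1..k} \<le> J" by simp
      show "e j0 ` {1..k} \<subseteq> I" using eI[OF j0] by auto
    qed auto
    ultimately show ?thesis by simp
  qed
  have split: "ww (insert j0 T) = ?a j0 * ww T" if T: "T \<subseteq> L'" for T
  proof -
    have fT: "finite T" using T L'(3) finite_subset by auto
    have "ww (insert j0 T) = word_weight m (case_prod e) ({j0} \<times> {1..k} \<union> T \<times> {1..k})"
      by (rule arg_cong[of _ _ "word_weight m (case_prod e)"]) auto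
    also have "\<dots> = ww {j0} * ww T"
    proof (rule word_weight_disjoint)
      show "{j0} \<times> {1..k} \<inter> T \<times> {1..k} = {}" using T L'(2) by auto
      have "case_prod e ` ({j0} \<times> {1..k}) = e j0 ` {1..k}" by auto
      moreover have "case_prod e ` (T \<times> {1..k}) = (\<Union>j\<in>T. e j ` {1..k})" by auto
      ultimately show "case_prod e ` ({j0} \<times> {1..k}) \<inter> case_prod e ` (T \<times> {1..k}) = {}"
        using dis T unfolding L'_def by blast
    qed (use fT in auto)
    finally show ?thesis unfolding single .
  qed
  have "(\<Sum>T\<in>Pow L. ww T * (\<Prod>j\<in>L - T. - ?a j)) =
     (\<Sum>T\<in>Pow L'. ww T * (\<Prod>j\<in>L - T. - ?a j)) + (\<Sum>T\<in>insert j0 ` Pow L'. ww T * (\<Prod>j\<in>L - T. - ?a j))"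
    unfolding L'(1) Pow_insert using L' by (intro sum.union_disjoint) auto
  also have "(\<Sum>T\<in>insert j0 ` Pow L'. ww T * (\<Prod>j\<in>L - T. - ?a j)) =
    (\<Sum>T\<in>Pow L'. ww (insert j0 T) * (\<Prod>j\<in>L - insert j0 T. - ?a j))"
    by (subst sum.reindex) (use L'(2) in \<open>auto intro!: inj_onI\<close>)
  also have "\<dots> = (\<Sum>T\<in>Pow L'. - (ww T * (\<Prod>j\<in>L - T. - ?a j)))"
  proof (intro sum.cong refl)
    fix T assume "T \<in> Pow L'"
    then have T: "T \<subseteq> L'" by simp
    have "L - T = insert j0 (L' - T)" "L - insert j0 T = L' - T" "j0 \<notin> L' - T" using T L' by auto
    then show "ww (insert j0 T) * (\<Prod>j\<in>L - insert j0 T. - ?a j) = - (ww T * (\<Prod>j\<in>L - T. - ?a j))"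
      using split[OF T] L'(3) by simp
  qed
  finally show ?thesis unfolding words_centered_expectation(2) by (simp add: sum_negf)
qed

end

end

section \<open>Component counts for four walks and the fourth moment of a trace\<close>

lemma walk_union_increment:
  assumes closed: "p 0 = p k" and A: "finite A" and F: "finite F" "\<And>e. e \<in> F \<Longrightarrow> e \<subseteq> A"
  shows "card (A \<union> p ` {0..k}) + card F \<le> card A + card (F \<union> walk_edge p ` {1..k}) + 1"
    and "walk_edge p ` {1..k} \<inter> F \<noteq> {} \<Longrightarrow>
      card (A \<union> p ` {0..k}) + card F \<le> card A + card (F \<union> walk_edge p ` {1..k})"
proof -
  let ?V = "p ` {0..k}" and ?E = "walk_edge p ` {1..k}"
  have V: "card (A \<union> ?V) = card A + card (?V - A)"
    using card_Un_disjoint[of A "?V - A"] A by (metis Diff_disjoint Un_Diff_cancel finite_Diff finite_atLeastAtMost finite_imageI)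
  have E: "card (F \<union> ?E) = card F + card (?E - F)"
    using card_Un_disjoint[of F "?E - F"] F(1) by (metis Diff_disjoint Un_Diff_cancel finite_Diff finite_atLeastAtMost finite_imageI)
  have meet: "card (?V - A) \<le> card (?E - F)" if "?V \<inter> A \<noteq> {}"
    by (rule walk_new_vertices_le[OF closed that F(2)])
  show "card (A \<union> ?V) + card F \<le> card A + card (F \<union> ?E) + 1"
  proof -
    \<comment> \<open>A walk that may open a new component is made to meet the old vertices by
      adding its start to \<open>A\<close>; this one vertex is the \<open>+ 1\<close>.\<close>
    have "card (?V - insert (p 0) A) \<le> card (?E - F)"
      by (rule walk_new_vertices_le[OF closed]) (use F(2) in auto)
    moreover have "card (?V - A) \<le> Suc (card (?V - insert (p 0) A))"
    proof -
      have "card (?V - A) \<le> card (insert (p 0) (?V - insert (p 0) A))" by (rule card_mono) auto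
      also have "\<dots> \<le> Suc (card (?V - insert (p 0) A))" by (rule card_insert_le_m1) auto
      finally show ?thesis .
    qed
    ultimately show ?thesis unfolding V E by simp
  qed
  assume "?E \<inter> F \<noteq> {}"
  then obtain e where "e \<in> ?E" "e \<in> F" by blast
  then obtain i where i: "i \<in> {1..k}" "walk_edge p i \<in> F" by blast
  then have "p i \<in> ?V \<inter> A" using F(2)[OF i(2)] by (auto simp: walk_edge_def)
  then have "?V \<inter> A \<noteq> {}" by blast
  from meet[OF this] show "card (A \<union> ?V) + card F \<le> card A + card (F \<union> ?E)" unfolding V E by simp
qed

text \<open>Among four walks each of which shares an edge with another one there are at most two
  connected components.\<close>
lemma four_walks_vertices:
  fixes P :: "nat \<Rightarrow> nat \<Rightarrow> 'v"
  assumes closed: "\<And>j. j < 4 \<Longrightarrow> P j 0 = P j k"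
    and share: "\<And>j. j < 4 \<Longrightarrow> \<exists>l<4. l \<noteq> j \<and> walk_edge (P j) ` {1..k} \<inter> walk_edge (P l) ` {1..k} \<noteq> {}"
  shows "card (\<Union>j<4. P j ` {0..k}) \<le> card (\<Union>j<4. walk_edge (P j) ` {1..k}) + 2"
proof -
  define V where "V j = P j ` {0..k}" for j
  define E where "E j = walk_edge (P j) ` {1..k}" for j
  have fV: "finite (V j)" and fE: "finite (E j)" for j by (auto simp: V_def E_def)
  have sub: "e \<subseteq> V j" if "e \<in> E j" for e j using that by (auto simp: E_def V_def walk_edge_def)
  \<comment> \<open>Walk \<open>l\<close> shares an edge with walk 0 and walk \<open>b\<close> with
    one of the other three, so only walks 0 and \<open>a\<close> can open a component.\<close>
  have main: "card (V 0 \<union> V l \<union> V a \<union> V b) \<le> card (E 0 \<union> E l \<union> E a \<union> E b) + 2"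
    if lab: "l < 4" "a < 4" "b < 4" "E l \<inter> E 0 \<noteq> {}" "E b \<inter> (E 0 \<union> E l \<union> E a) \<noteq> {}" for l a b
  proof -
    have 1: "card (V 0) \<le> card (E 0) + 1"
      using walk_union_increment(1)[of "P 0" k "{}" "{}"] closed[of 0] by (simp add: V_def E_def)
    have 2: "card (V 0 \<union> V l) + card (E 0) \<le> card (V 0) + card (E 0 \<union> E l)"
      using walk_union_increment(2)[OF closed[OF lab(1)] fV[of 0] fE[of 0] sub] lab(4) unfolding V_def E_def by blast
    have 3: "card (V 0 \<union> V l \<union> V a) + card (E 0 \<union> E l) \<le> card (V 0 \<union> V l) + card (E 0 \<union> E l \<union> E a) + 1"
      unfolding V_def[of a] E_def[of a]
      by (rule walk_union_increment(1)[OF closed[OF lab(2)]]) (use fV fE sub in \<open>auto, blast+\<close>)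
    have 4: "card (V 0 \<union> V l \<union> V a \<union> V b) + card (E 0 \<union> E l \<union> E a) \<le> card (V 0 \<union> V l \<union> V a) + card (E 0 \<union> E l \<union> E a \<union> E b)"
      unfolding V_def[of b] E_def[of b]
    proof (rule walk_union_increment(2)[OF closed[OF lab(3)]])
      show "walk_edge (P b) ` {1..k} \<inter> (E 0 \<union> E l \<union> E a) \<noteq> {}" using lab(5) unfolding E_def[of b] .
      show "e \<subseteq> V 0 \<union> V l \<union> V a" if "e \<in> E 0 \<union> E l \<union> E a" for e using that sub by blast
    qed (use fV fE in auto)
    show ?thesis using 1 2 3 4 by linarith
  qed
  have sh: "\<exists>l<4. l \<noteq> j \<and> E j \<inter> E l \<noteq> {}" if "j < 4" for j using share[OF that] by (simp add: E_def)
  obtain l where l: "l < 4" "l \<noteq> 0" "E 0 \<inter> E l \<noteq> {}" using sh[of 0] by auto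
  have four: "{..<4::nat} = {0, 1, 2, 3}" by auto
  have lt4: "i = 0 \<or> i = 1 \<or> i = 2 \<or> i = 3" if "i < 4" for i :: nat using that by auto
  obtain a b where ab: "a < 4" "b < 4" "{0, l, a, b} = {..<4}" "b \<noteq> 0" "b \<noteq> l" "b \<noteq> a"
  proof -
    consider "l = 1" | "l = 2" | "l = 3" using lt4[OF l(1)] l(2) by auto
    then show ?thesis
      by cases (rule that[of 2 3], (auto simp: four)[6], rule that[of 1 3], (auto simp: four)[6], rule that[of 1 2], (auto simp: four)[6])
  qed
  obtain c where c: "c < 4" "c \<noteq> b" "E b \<inter> E c \<noteq> {}" using sh[OF ab(2)] by auto
  have "c \<in> {0, l, a, b}" unfolding ab(3) using c(1) by simp
  then have "E b \<inter> (E 0 \<union> E l \<union> E a) \<noteq> {}" using c by auto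
  then have m: "card (V 0 \<union> V l \<union> V a \<union> V b) \<le> card (E 0 \<union> E l \<union> E a \<union> E b) + 2"
    using l by (intro main[OF l(1) ab(1,2)]) auto
  have "(\<Union>j<4. V j) = V 0 \<union> V l \<union> V a \<union> V b" "(\<Union>j<4. E j) = E 0 \<union> E l \<union> E a \<union> E b"
    unfolding ab(3)[symmetric] by auto
  then show ?thesis using m unfolding V_def[symmetric] E_def[symmetric] by simp
qed

text \<open>The four walks are read as a single function on \<open>4 * Suc k\<close>
  positions.\<close>

lemma card_walk_tuples:
  fixes n k v :: nat
  defines "D \<equiv> 4 * Suc k"
  shows "card {P \<in> {..<4::nat} \<rightarrow>\<^sub>E closed_walks n k. card (\<Union>j<4. P j ` {0..k}) = v} \<le> v ^ D * n ^ v"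
proof -
  let ?S = "{..<4::nat} \<times> {0..k}"
  have cS: "card ?S = D" by (simp add: D_def card_cartesian_product)
  have "card {P \<in> {..<4::nat} \<rightarrow>\<^sub>E closed_walks n k. card (\<Union>j<4. P j ` {0..k}) = v}
    \<le> card {f \<in> ?S \<rightarrow>\<^sub>E {..<n}. card (f ` ?S) = v}"
  proof (rule card_inj_on_le[of "\<lambda>P. \<lambda>x\<in>?S. P (fst x) (snd x)"])
    show "inj_on (\<lambda>P. \<lambda>x\<in>?S. P (fst x) (snd x)) {P \<in> {..<4::nat} \<rightarrow>\<^sub>E closed_walks n k. card (\<Union>j<4. P j ` {0..k}) = v}"
    proof (rule inj_onI)
      fix P Q assume P: "P \<in> {P \<in> {..<4::nat} \<rightarrow>\<^sub>E closed_walks n k. card (\<Union>j<4. P j ` {0..k}) = v}"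
        and Q: "Q \<in> {P \<in> {..<4::nat} \<rightarrow>\<^sub>E closed_walks n k. card (\<Union>j<4. P j ` {0..k}) = v}"
        and eq: "(\<lambda>x\<in>?S. P (fst x) (snd x)) = (\<lambda>x\<in>?S. Q (fst x) (snd x))"
      have e: "P j i = Q j i" if "j < 4" "i \<le> k" for j i
        using fun_cong[OF eq, of "(j, i)"] that by simp
      have "P j = Q j" if j: "j < 4" for j
      proof
        fix i
        have "P j \<in> closed_walks n k" "Q j \<in> closed_walks n k" using P Q j by auto
        then show "P j i = Q j i" using e[OF j, of i]
          by (cases "i \<le> k") (auto simp: closed_walks_def PiE_def extensional_def)
      qed
      moreover have "P j = Q j" if "\<not> j < 4" for j
        using P Q that by (auto simp: PiE_def extensional_def)
      ultimately show "P = Q" by blast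
    qed
    show "(\<lambda>P. \<lambda>x\<in>?S. P (fst x) (snd x)) ` {P \<in> {..<4::nat} \<rightarrow>\<^sub>E closed_walks n k. card (\<Union>j<4. P j ` {0..k}) = v}
      \<subseteq> {f \<in> ?S \<rightarrow>\<^sub>E {..<n}. card (f ` ?S) = v}"
    proof
      fix f assume "f \<in> (\<lambda>P. \<lambda>x\<in>?S. P (fst x) (snd x)) ` {P \<in> {..<4::nat} \<rightarrow>\<^sub>E closed_walks n k. card (\<Union>j<4. P j ` {0..k}) = v}"
      then obtain P where P: "P \<in> {..<4::nat} \<rightarrow>\<^sub>E closed_walks n k" "card (\<Union>j<4. P j ` {0..k}) = v"
        "f = (\<lambda>x\<in>?S. P (fst x) (snd x))" by auto
      have lt: "P j i < n" if "j < 4" "i \<le> k" for j i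
      proof -
        have "P j \<in> closed_walks n k" using P(1) that by auto
        then show ?thesis using that by (auto simp: closed_walks_def PiE_def Pi_def)
      qed
      have "f ` ?S = (\<Union>j<4. P j ` {0..k})" unfolding P(3) by force
      then show "f \<in> {f \<in> ?S \<rightarrow>\<^sub>E {..<n}. card (f ` ?S) = v}" using P(2,3) lt by auto
    qed
    show "finite {f \<in> ?S \<rightarrow>\<^sub>E {..<n}. card (f ` ?S) = v}"
      by (rule finite_subset[of _ "?S \<rightarrow>\<^sub>E {..<n}"]) (auto intro: finite_PiE)
  qed
  also have "\<dots> \<le> v ^ D * n ^ v" using card_functions_small_image[of ?S n v] unfolding cS by simp
  finally show ?thesis .
qed

text \<open>The fourth power of the centred trace is a sum over quadruples of walks. A quadruple in
  which some walk shares no edge with the others has mean 0; any other has \<open>v\<close> vertices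
  and at least \<open>v - 2\<close> edges, each worth \<open>\<delta>\<close>. The 16 is
  \<open>2 ^ 4\<close> from the centring, \<open>D\<close> is the number of positions of four walks,
  and \<open>v - 2\<close> is cut off at 0.\<close>

theorem (in prob_space) trace_fourth_moment:
  fixes Y :: "nat set \<Rightarrow> 'a \<Rightarrow> real" and n k :: nat
  defines "I \<equiv> {{a, b} | a b. a < n \<and> b < n}" and "D \<equiv> 4 * Suc k"
    and "T \<equiv> \<lambda>\<omega>. \<Sum>p\<in>closed_walks n k. \<Prod>i\<in>{1..k}. Y (walk_edge p i) \<omega>"
  assumes indep: "indep_vars (\<lambda>_. borel) Y I"
    and int: "\<And>a j. a \<in> I \<Longrightarrow> 1 \<le> j \<Longrightarrow> j \<le> 4 * k \<Longrightarrow> integrable M (\<lambda>\<omega>. Y a \<omega> ^ j)"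
    and mom: "\<And>a j. a \<in> I \<Longrightarrow> 1 \<le> j \<Longrightarrow> j \<le> 4 * k \<Longrightarrow> expectation (\<lambda>\<omega>. Y a \<omega> ^ j) = m j"
    and m: "\<And>j. 1 \<le> j \<Longrightarrow> j \<le> 4 * k \<Longrightarrow> \<bar>m j\<bar> \<le> \<delta>" and \<delta>: "0 \<le> \<delta>" "\<delta> \<le> 1"
  shows "integrable M T" "expectation T = (\<Sum>p\<in>closed_walks n k. part_weight m (edge_part p k))"
    and "integrable M (\<lambda>\<omega>. (T \<omega> - expectation T) ^ 4)"
    and "expectation (\<lambda>\<omega>. (T \<omega> - expectation T) ^ 4) \<le> 16 * (\<Sum>v\<le>D. real v ^ D * real n ^ v * \<delta> ^ (v - 2))"
proof -
  let ?W = "closed_walks n k"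
  define X where "X p \<omega> = (\<Prod>i\<in>{1..k}. Y (walk_edge p i) \<omega>)" for p :: "nat \<Rightarrow> nat" and \<omega>
  define a where "a p = word_weight m (walk_edge p) {1..k}" for p :: "nat \<Rightarrow> nat"
  have edge_I: "walk_edge p i \<in> I" if "p \<in> ?W" "i \<in> {1..k}" for p i
  proof -
    have "p \<in> {0..k} \<rightarrow>\<^sub>E {..<n}" using that(1) by (simp add: closed_walks_def)
    then have "p (i - 1) < n" "p i < n" using that(2) by (auto simp: PiE_def Pi_def)
    then show ?thesis unfolding walk_edge_def I_def by blast
  qed
  have X: "integrable M (X p)" "expectation (X p) = a p" if p: "p \<in> ?W" for p
  proof -
    have s: "walk_edge p ` {1..k} \<subseteq> I" using edge_I[OF p] by auto
    show "integrable M (X p)" "expectation (X p) = a p"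
      using word_expectation[OF indep int mom _ s] unfolding X_def a_def by auto
  qed
  have T: "T = (\<lambda>\<omega>. \<Sum>p\<in>?W. X p \<omega>)" unfolding T_def X_def ..
  show intT: "integrable M T" unfolding T using X(1) by (intro Bochner_Integration.integrable_sum)
  have ET: "expectation T = (\<Sum>p\<in>?W. a p)" unfolding T using X by (simp add: Bochner_Integration.integral_sum)
  then show "expectation T = (\<Sum>p\<in>?W. part_weight m (edge_part p k))"
    by (simp only: a_def word_weight_edge_part)
  let ?PP = "{..<4::nat} \<rightarrow>\<^sub>E ?W"
  have finPP: "finite ?PP" by (intro finite_PiE finite_closed_walks) auto
  define Z where "Z P \<omega> = (\<Prod>j\<in>{..<4::nat}. (X (P j) \<omega> - a (P j)))" for P \<omega>
  have expand: "(T \<omega> - expectation T) ^ 4 = (\<Sum>P\<in>?PP. Z P \<omega>)" for \<omega>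
  proof -
    have "(T \<omega> - expectation T) ^ 4 = (\<Prod>j\<in>{..<4::nat}. \<Sum>p\<in>?W. (X p \<omega> - a p))"
      unfolding ET by (simp add: T sum_subtractf)
    also have "\<dots> = (\<Sum>P\<in>?PP. Z P \<omega>)"
      unfolding Z_def by (rule prod_sum_PiE) (auto simp: finite_closed_walks)
    finally show ?thesis .
  qed
  have W: "P j \<in> ?W" if "P \<in> ?PP" "j < 4" for P j using that by auto
  note words = indep int mom
  have intZ: "integrable M (Z P)" if P: "P \<in> ?PP" for P
    unfolding Z_def X_def
    by (rule words_centered_expectation(1)[where L = "{..<4}" and k = k and e = "\<lambda>j. walk_edge (P j)", OF words])
      (use edge_I W[OF P] in auto)
  show "integrable M (\<lambda>\<omega>. (T \<omega> - expectation T) ^ 4)"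
    unfolding expand using intZ by (intro Bochner_Integration.integrable_sum)
  define vc where "vc P = card (\<Union>j<4. P j ` {0..k})" for P :: "nat \<Rightarrow> nat \<Rightarrow> nat"
  have boundZ: "expectation (Z P) \<le> 16 * \<delta> ^ (vc P - 2)" if P: "P \<in> ?PP" for P
  proof (cases "\<exists>j0<4. \<forall>j<4. j \<noteq> j0 \<longrightarrow> walk_edge (P j0) ` {1..k} \<inter> walk_edge (P j) ` {1..k} = {}")
    case True
    then obtain j0 where j0: "j0 < 4" "\<And>j. j < 4 \<Longrightarrow> j \<noteq> j0 \<Longrightarrow> walk_edge (P j0) ` {1..k} \<inter> walk_edge (P j) ` {1..k} = {}"
      by blast
    have "expectation (Z P) = 0" unfolding Z_def X_def a_def
      by (rule words_centered_zero[where L = "{..<4}" and k = k and e = "\<lambda>j. walk_edge (P j)" and ?j0.0 = j0, OF words])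
        (use edge_I W[OF P] j0 in auto)
    then show ?thesis using \<delta> by simp
  next
    case False
    then have "vc P \<le> card (\<Union>j<4. walk_edge (P j) ` {1..k}) + 2"
      unfolding vc_def by (intro four_walks_vertices) (use W[OF P] in \<open>auto simp: closed_walks_def\<close>)
    then have le: "vc P - 2 \<le> card (\<Union>j<4. walk_edge (P j) ` {1..k})" by simp
    have "\<bar>expectation (Z P)\<bar> \<le> 2 ^ card {..<4::nat} * \<delta> ^ card (\<Union>j\<in>{..<4}. walk_edge (P j) ` {1..k})"
      unfolding Z_def X_def a_def
      by (rule words_centered_bound[where L = "{..<4}" and k = k and e = "\<lambda>j. walk_edge (P j)" and \<delta> = \<delta>, OF words])
        (use edge_I W[OF P] m \<delta> in auto)
    also have "\<dots> \<le> 16 * \<delta> ^ (vc P - 2)"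
      using power_decreasing[OF le \<delta>] by simp
    finally show ?thesis by simp
  qed
  have vcD: "vc P \<le> D" for P
  proof -
    have "vc P \<le> (\<Sum>j<4. card (P j ` {0..k}))" unfolding vc_def by (rule card_UN_le) simp
    also have "\<dots> \<le> (\<Sum>j<4::nat. Suc k)"
    proof (rule sum_mono)
      fix j show "card (P j ` {0..k}) \<le> Suc k" using card_image_le[of "{0..k}" "P j"] by simp
    qed
    finally show ?thesis by (simp add: D_def)
  qed
  have "expectation (\<lambda>\<omega>. (T \<omega> - expectation T) ^ 4) = (\<Sum>P\<in>?PP. expectation (Z P))"
    unfolding expand using intZ by (simp add: Bochner_Integration.integral_sum)
  also have "\<dots> \<le> (\<Sum>P\<in>?PP. 16 * \<delta> ^ (vc P - 2))" by (rule sum_mono) (rule boundZ)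
  also have "\<dots> = (\<Sum>v\<le>D. \<Sum>P | P \<in> ?PP \<and> vc P = v. 16 * \<delta> ^ (vc P - 2))"
    by (rule sum.group[symmetric]) (use finPP vcD in auto)
  also have "\<dots> = (\<Sum>v\<le>D. real (card {P \<in> ?PP. vc P = v}) * (16 * \<delta> ^ (v - 2)))"
    by (intro sum.cong refl) simp
  also have "\<dots> \<le> (\<Sum>v\<le>D. real v ^ D * real n ^ v * (16 * \<delta> ^ (v - 2)))"
  proof (intro sum_mono mult_right_mono)
    fix v
    have "card {P \<in> ?PP. vc P = v} \<le> v ^ D * n ^ v"
      unfolding vc_def D_def by (rule card_walk_tuples)
    then have "real (card {P \<in> ?PP. vc P = v}) \<le> real (v ^ D * n ^ v)" by (rule of_nat_mono)
    then show "real (card {P \<in> ?PP. vc P = v}) \<le> real v ^ D * real n ^ v" by simp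
  qed (use \<delta> in auto)
  also have "\<dots> = 16 * (\<Sum>v\<le>D. real v ^ D * real n ^ v * \<delta> ^ (v - 2))"
    by (simp add: sum_distrib_left mult_ac)
  finally show "expectation (\<lambda>\<omega>. (T \<omega> - expectation T) ^ 4) \<le> 16 * (\<Sum>v\<le>D. real v ^ D * real n ^ v * \<delta> ^ (v - 2))" .
qed

section \<open>From summable fourth moments to almost sure convergence\<close>

lemma AE_tendsto_0_of_summable_expectation:
  fixes U :: "nat \<Rightarrow> 'a \<Rightarrow> real"
  assumes int: "\<And>n. n \<ge> N \<Longrightarrow> integrable M (U n)" and nn: "\<And>n \<omega>. 0 \<le> U n \<omega>"
    and le: "\<And>n. n \<ge> N \<Longrightarrow> (\<integral>\<omega>. U n \<omega> \<partial>M) \<le> b n" and sm: "summable b"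
  shows "AE \<omega> in M. (\<lambda>n. U n \<omega>) \<longlonglongrightarrow> 0"
proof -
  have int': "integrable M (U (n + N))" for n by (rule int) simp
  have [measurable]: "U (n + N) \<in> borel_measurable M" for n using int'[of n] by simp
  have sm': "summable (\<lambda>n. b (n + N))" using sm by simp
  have nb: "0 \<le> b (n + N)" for n
    by (rule order_trans[OF Bochner_Integration.integral_nonneg le]) (simp_all add: nn)
  \<comment> \<open>The series of the \<open>U\<close> has finite integral, hence is finite almost
    everywhere and its terms tend to 0; the shift by \<open>N\<close> starts it where integrability
    is known.\<close>
  have "(\<integral>\<^sup>+ \<omega>. (\<Sum>n. ennreal (U (n + N) \<omega>)) \<partial>M) = (\<Sum>n. \<integral>\<^sup>+ \<omega>. ennreal (U (n + N) \<omega>) \<partial>M)"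
    by (rule nn_integral_suminf) measurable
  also have "\<dots> \<le> (\<Sum>n. ennreal (b (n + N)))"
  proof (rule suminf_le)
    fix n
    have "(\<integral>\<^sup>+ \<omega>. ennreal (U (n + N) \<omega>) \<partial>M) = ennreal (\<integral>\<omega>. U (n + N) \<omega> \<partial>M)"
      by (rule nn_integral_eq_integral[OF int']) (simp add: nn)
    also have "\<dots> \<le> ennreal (b (n + N))" by (rule ennreal_leI) (rule le, simp)
    finally show "(\<integral>\<^sup>+ \<omega>. ennreal (U (n + N) \<omega>) \<partial>M) \<le> ennreal (b (n + N))" .
  qed auto
  also have "\<dots> = ennreal (\<Sum>n. b (n + N))" by (rule suminf_ennreal2[OF nb sm'])
  finally have "(\<integral>\<^sup>+ \<omega>. (\<Sum>n. ennreal (U (n + N) \<omega>)) \<partial>M) \<noteq> \<infinity>"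
    by (auto simp: top_unique)
  then have "AE \<omega> in M. (\<Sum>n. ennreal (U (n + N) \<omega>)) \<noteq> \<infinity>"
    by (intro nn_integral_noteq_infinite) auto
  then show ?thesis
  proof eventually_elim
    case (elim \<omega>)
    then have "summable (\<lambda>n. U (n + N) \<omega>)" using nn by (intro summable_suminf_not_top) auto
    then have "(\<lambda>n. U (n + N) \<omega>) \<longlonglongrightarrow> 0" by (rule summable_LIMSEQ_zero)
    then show ?case by (rule LIMSEQ_offset)
  qed
qed

text \<open>\<open>\<alpha>\<close> is chosen so that \<open>D * (1 - \<alpha>) = 1 / 2\<close>. For
  \<open>v \<ge> 2\<close> the exponent of \<open>n\<close> is
  \<open>v * (1 - \<alpha>) + 2 * \<alpha>\<close>, at most \<open>1 / 2 + 2\<close>; for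
  \<open>v < 2\<close> the truncated exponent is 0 and \<open>n ^ v \<le> n\<close>.\<close>

lemma fourth_moment_rate:
  fixes k n :: nat
  defines "D \<equiv> 4 * Suc k" and "\<alpha> \<equiv> 1 - 1 / (8 * real (Suc k))"
  assumes n: "n \<ge> 1"
  shows "(\<Sum>v\<le>D. real v ^ D * real n ^ v * (real n powr (- \<alpha>)) ^ (v - 2))
    \<le> real (Suc D) * real D ^ D * real n powr (5 / 2)"
proof -
  have n1: "real n \<ge> 1" "real n > 0" using n by auto
  have \<alpha>: "0 \<le> \<alpha>" "\<alpha> \<le> 1" "real D * (1 - \<alpha>) = 1 / 2"
    by (auto simp: \<alpha>_def D_def field_simps)
  have "(\<Sum>v\<le>D. real v ^ D * real n ^ v * (real n powr (- \<alpha>)) ^ (v - 2))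
      \<le> (\<Sum>v\<le>D. real D ^ D * real n powr (5 / 2))"
  proof (rule sum_mono)
    fix v assume v: "v \<in> {..D}"
    have "real n ^ v * (real n powr (- \<alpha>)) ^ (v - 2) \<le> real n powr (5 / 2)"
    proof (cases "v \<ge> 2")
      case True
      have "real n ^ v * (real n powr (- \<alpha>)) ^ (v - 2) = real n powr (real v) * real n powr (- \<alpha> * real (v - 2))"
        using n1 powr_powr[of "real n" "- \<alpha>" "real (v - 2)", symmetric] by (simp only: powr_realpow powr_gt_zero)
      also have "\<dots> = real n powr (real v - \<alpha> * real (v - 2))"
        by (simp add: powr_add[symmetric])
      also have "\<dots> \<le> real n powr (5 / 2)"
      proof (rule powr_mono[OF _ n1(1)])
        have "real v - \<alpha> * real (v - 2) = real v * (1 - \<alpha>) + 2 * \<alpha>"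
          using True by (simp add: of_nat_diff algebra_simps)
        also have "\<dots> \<le> real D * (1 - \<alpha>) + 2 * 1"
          using v \<alpha> by (intro add_mono mult_right_mono mult_left_mono) auto
        finally show "real v - \<alpha> * real (v - 2) \<le> 5 / 2" using \<alpha>(3) by simp
      qed
      finally show ?thesis .
    next
      case False
      then have v0: "v - 2 = 0" by simp
      have "real n ^ v = real n powr (real v)" using n1 by (simp add: powr_realpow)
      also have "\<dots> \<le> real n powr (5 / 2)" using False by (intro powr_mono n1(1)) simp
      finally show ?thesis unfolding v0 by simp
    qed
    moreover have "real v ^ D \<le> real D ^ D" using v by (intro power_mono) auto
    ultimately have "real v ^ D * (real n ^ v * (real n powr (- \<alpha>)) ^ (v - 2)) \<le> real D ^ D * real n powr (5 / 2)"
      by (intro mult_mono) auto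
    then show "real v ^ D * real n ^ v * (real n powr (- \<alpha>)) ^ (v - 2) \<le> real D ^ D * real n powr (5 / 2)"
      by (simp only: mult.assoc)
  qed
  also have "\<dots> = real (Suc D) * real D ^ D * real n powr (5 / 2)" by simp
  finally show ?thesis .
qed

text \<open>Normalisation divides a fourth moment of order \<open>n powr (5 / 2)\<close> by
  \<open>n ^ 4\<close>, leaving the summable \<open>n powr (- 3 / 2)\<close>. Moments of the entries
  enter up to order \<open>4 * k\<close> and only for large \<open>n\<close>, with
  \<open>\<delta> = n powr (- \<alpha>)\<close>.\<close>

theorem (in prob_space) AE_normalised_trace_limit:
  fixes Y :: "nat \<Rightarrow> nat set \<Rightarrow> 'a \<Rightarrow> real" and m :: "nat \<Rightarrow> nat \<Rightarrow> real" and k :: nat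
  defines "I \<equiv> \<lambda>n. {{a, b} | a b. a < n \<and> b < n}"
    and "T \<equiv> \<lambda>n \<omega>. \<Sum>p\<in>closed_walks n k. \<Prod>i\<in>{1..k}. Y n (walk_edge p i) \<omega>"
  assumes indep: "\<And>n. indep_vars (\<lambda>_. borel) (Y n) (I n)"
    and int: "\<And>j. j \<ge> 1 \<Longrightarrow> \<forall>\<^sub>F n in sequentially. \<forall>a\<in>I n. integrable M (\<lambda>\<omega>. Y n a \<omega> ^ j)"
    and mom: "\<And>n a j. a \<in> I n \<Longrightarrow> j \<ge> 1 \<Longrightarrow> expectation (\<lambda>\<omega>. Y n a \<omega> ^ j) = m n j"
    and small: "\<And>j \<alpha>. j \<ge> 1 \<Longrightarrow> \<alpha> < 1 \<Longrightarrow> (\<lambda>n. real n powr \<alpha> * m n j) \<longlonglongrightarrow> 0"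
    and lim: "\<And>j. j \<ge> 1 \<Longrightarrow> (\<lambda>n. real n * m n (2 * j)) \<longlonglongrightarrow> C (2 * j)"
    and k: "k \<ge> 1"
  shows "AE \<omega> in M. (\<lambda>n. T n \<omega> / real n) \<longlonglongrightarrow> (\<Sum>\<sigma>\<in>SS k. part_weight C \<sigma>)"
proof -
  define D where "D = 4 * Suc k"
  define \<alpha> where "\<alpha> = 1 - 1 / (8 * real (Suc k))"
  have \<alpha>: "0 \<le> \<alpha>" "\<alpha> < 1" by (auto simp: \<alpha>_def field_simps)
  have "\<forall>\<^sub>F n in sequentially. \<forall>j\<in>{1..4 * k}. \<forall>a\<in>I n. integrable M (\<lambda>\<omega>. Y n a \<omega> ^ j)"
    using int by (intro eventually_ball_finite) auto
  moreover have "\<forall>\<^sub>F n in sequentially. \<forall>j\<in>{1..4 * k}. \<bar>real n powr \<alpha> * m n j\<bar> < 1"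
  proof (intro eventually_ball_finite ballI)
    fix j assume "j \<in> {1..4 * k}"
    then have "(\<lambda>n. real n powr \<alpha> * m n j) \<longlonglongrightarrow> 0" by (intro small \<alpha>) auto
    from tendstoD[OF this, of 1] show "\<forall>\<^sub>F n in sequentially. \<bar>real n powr \<alpha> * m n j\<bar> < 1"
      by (simp add: dist_real_def)
  qed simp
  ultimately have "\<forall>\<^sub>F n in sequentially. n \<ge> 1 \<and> (\<forall>j\<in>{1..4 * k}. \<forall>a\<in>I n. integrable M (\<lambda>\<omega>. Y n a \<omega> ^ j)) \<and>
      (\<forall>j\<in>{1..4 * k}. \<bar>real n powr \<alpha> * m n j\<bar> < 1)"
    using eventually_ge_at_top[of 1] by eventually_elim simp
  then obtain N where "\<forall>n\<ge>N. n \<ge> 1 \<and> (\<forall>j\<in>{1..4 * k}. \<forall>a\<in>I n. integrable M (\<lambda>\<omega>. Y n a \<omega> ^ j)) \<and>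
      (\<forall>j\<in>{1..4 * k}. \<bar>real n powr \<alpha> * m n j\<bar> < 1)"
    unfolding eventually_sequentially by blast
  then have N: "\<And>n. n \<ge> N \<Longrightarrow> n \<ge> 1"
    "\<And>n j a. n \<ge> N \<Longrightarrow> j \<in> {1..4 * k} \<Longrightarrow> a \<in> I n \<Longrightarrow> integrable M (\<lambda>\<omega>. Y n a \<omega> ^ j)"
    "\<And>n j. n \<ge> N \<Longrightarrow> j \<in> {1..4 * k} \<Longrightarrow> \<bar>real n powr \<alpha> * m n j\<bar> < 1"
    by blast+
  define K where "K = 16 * (real (Suc D) * real D ^ D)"
  have props: "expectation (T n) = (\<Sum>p\<in>closed_walks n k. part_weight (m n) (edge_part p k))"
    "integrable M (\<lambda>\<omega>. (T n \<omega> - expectation (T n)) ^ 4)"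
    "expectation (\<lambda>\<omega>. (T n \<omega> - expectation (T n)) ^ 4) \<le> K * real n powr (5 / 2)" if n: "n \<ge> N" for n
  proof -
    have n1: "real n > 0" "real n \<ge> 1" using N(1)[OF n] by auto
    have m: "\<bar>m n j\<bar> \<le> real n powr (- \<alpha>)" if "1 \<le> j" "j \<le> 4 * k" for j
    proof -
      have "real n powr \<alpha> * \<bar>m n j\<bar> < 1" using N(3)[OF n, of j] that by (simp add: abs_mult)
      then have "\<bar>m n j\<bar> < 1 / real n powr \<alpha>" using n1 by (simp add: pos_less_divide_eq mult.commute)
      then show ?thesis by (simp add: powr_minus_divide)
    qed
    have d: "0 \<le> real n powr (- \<alpha>)" "real n powr (- \<alpha>) \<le> 1"
      using n1 \<alpha> powr_mono[of "- \<alpha>" 0 "real n"] by auto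
    note tr = trace_fourth_moment[OF indep[of n, unfolded I_def], of k "m n" "real n powr (- \<alpha>)",
        OF _ _ m d]
    have i: "integrable M (\<lambda>\<omega>. Y n a \<omega> ^ j)" if "a \<in> {{a, b} | a b. a < n \<and> b < n}" "1 \<le> j" "j \<le> 4 * k" for a j
      using N(2)[OF n, of j a] that by (auto simp: I_def)
    have e: "expectation (\<lambda>\<omega>. Y n a \<omega> ^ j) = m n j" if "a \<in> {{a, b} | a b. a < n \<and> b < n}" "1 \<le> j" "j \<le> 4 * k" for a j
      using mom[of a n j] that by (auto simp: I_def)
    show "expectation (T n) = (\<Sum>p\<in>closed_walks n k. part_weight (m n) (edge_part p k))"
      unfolding T_def by (rule tr(2)[OF i e])
    show "integrable M (\<lambda>\<omega>. (T n \<omega> - expectation (T n)) ^ 4)" unfolding T_def by (rule tr(3)[OF i e])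
    have "expectation (\<lambda>\<omega>. (T n \<omega> - expectation (T n)) ^ 4)
       \<le> 16 * (\<Sum>v\<le>D. real v ^ D * real n ^ v * (real n powr (- \<alpha>)) ^ (v - 2))"
      unfolding D_def T_def by (rule tr(4)[OF i e])
    also have "\<dots> \<le> 16 * (real (Suc D) * real D ^ D * real n powr (5 / 2))"
      unfolding D_def \<alpha>_def by (intro mult_left_mono fourth_moment_rate N(1)[OF n]) simp
    finally show "expectation (\<lambda>\<omega>. (T n \<omega> - expectation (T n)) ^ 4) \<le> K * real n powr (5 / 2)"
      by (simp add: K_def mult.assoc)
  qed
  have dev: "AE \<omega> in M. (\<lambda>n. ((T n \<omega> - expectation (T n)) / real n) ^ 4) \<longlonglongrightarrow> 0"
  proof (rule AE_tendsto_0_of_summable_expectation[of N _ _ "\<lambda>n. K * real n powr (- 3 / 2)"])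
    fix n assume n: "n \<ge> N"
    have n1: "real n > 0" using N(1)[OF n] by simp
    show "integrable M (\<lambda>\<omega>. ((T n \<omega> - expectation (T n)) / real n) ^ 4)"
      unfolding power_divide using props(2)[OF n] by simp
    have "expectation (\<lambda>\<omega>. ((T n \<omega> - expectation (T n)) / real n) ^ 4)
        = expectation (\<lambda>\<omega>. (T n \<omega> - expectation (T n)) ^ 4) / real n ^ 4"
      unfolding power_divide by simp
    also have "\<dots> \<le> K * real n powr (5 / 2) / real n ^ 4"
      by (intro divide_right_mono props(3)[OF n]) simp
    also have "real n ^ 4 = real n powr 4" using n1 by (simp add: powr_numeral)
    also have "K * real n powr (5 / 2) / real n powr 4 = K * real n powr (5 / 2 - 4)"
      by (simp only: powr_diff times_divide_eq_right)
    also have "5 / 2 - 4 = - 3 / (2 :: real)" by simp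
    finally show "expectation (\<lambda>\<omega>. ((T n \<omega> - expectation (T n)) / real n) ^ 4) \<le> K * real n powr (- 3 / 2)" .
  next
    show "summable (\<lambda>n. K * real n powr (- 3 / 2))"
      by (intro summable_mult) (simp add: summable_real_powr_iff)
  qed simp
  have mean: "(\<lambda>n. expectation (T n) / real n) \<longlonglongrightarrow> (\<Sum>\<sigma>\<in>SS k. part_weight C \<sigma>)"
  proof (rule Lim_transform_eventually[OF mean_limit[where m = m and C = C and k = k, OF small lim k]])
    show "\<forall>\<^sub>F n in sequentially. (\<Sum>p\<in>closed_walks n k. part_weight (m n) (edge_part p k)) / real n = expectation (T n) / real n"
      using eventually_ge_at_top[of N] by eventually_elim (simp add: props(1))
  qed
  show ?thesis
    using dev
  proof eventually_elim
    case (elim \<omega>)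
    have "(\<lambda>n. root 4 (((T n \<omega> - expectation (T n)) / real n) ^ 4)) \<longlonglongrightarrow> root 4 0"
      by (intro tendsto_real_root elim)
    moreover have "root 4 (y ^ 4) = \<bar>y\<bar>" for y :: real
      using real_root_power_cancel[of 4 "\<bar>y\<bar>"] by (simp add: power_even_abs)
    ultimately have "(\<lambda>n. \<bar>(T n \<omega> - expectation (T n)) / real n\<bar>) \<longlonglongrightarrow> 0"
      by (simp only: real_root_zero)
    then have "(\<lambda>n. (T n \<omega> - expectation (T n)) / real n) \<longlonglongrightarrow> 0"
      by (rule tendsto_rabs_zero_cancel)
    from tendsto_add[OF this mean] show ?case by (simp add: diff_divide_distrib)
  qed
qed

section \<open>The limit theorem\<close>

lemma truncate_at_measurable [measurable]: "truncate_at t \<in> borel_measurable borel"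
proof -
  have "truncate_at t = (\<lambda>s. if ennreal \<bar>s\<bar> \<le> t then s else 0)"
    by (auto simp: truncate_at_def fun_eq_iff)
  moreover have "(\<lambda>s::real. if ennreal \<bar>s\<bar> \<le> t then s else 0) \<in> borel_measurable borel"
    by measurable
  ultimately show ?thesis by simp
qed

text \<open>For \<open>j = 0\<close> the left side is 1 even where \<open>s\<close> is cut
  off.\<close>

lemma truncate_at_power: "j \<ge> 1 \<Longrightarrow> truncate_at t s ^ j = s ^ j * of_bool (ennreal \<bar>s\<bar> \<le> t)"
  by (auto simp: truncate_at_def)

lemma diff_truncate_at_sq: "(truncate_at t s - s)\<^sup>2 = s\<^sup>2 * of_bool (ennreal \<bar>s\<bar> > t)"
  by (auto simp: truncate_at_def not_le)

lemma insert_Min_Max: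
  fixes a b :: "'b :: linorder" shows "{Min {a, b}, Max {a, b}} = {a, b}"
  by (cases "a \<le> b") (auto simp: min_def max_def)

text \<open>Carries independence from ordered index pairs to unordered ones along the map from
  \<open>e\<close> to \<open>(Min e, Max e)\<close>.\<close>

lemma (in prob_space) indep_vars_reindex_inj:
  assumes f: "inj_on f I" and ind: "indep_vars M' X (f ` I)"
  shows "indep_vars (\<lambda>i. M' (f i)) (\<lambda>i. X (f i)) I"
  unfolding indep_vars_def2
proof (intro conjI ballI indep_setsI)
  note ind' = ind[unfolded indep_vars_def2]
  show "X (f i) \<in> measurable M (M' (f i))" if "i \<in> I" for i using ind' that by auto
  show "{X (f i) -` A \<inter> space M | A. A \<in> sets (M' (f i))} \<subseteq> events" if "i \<in> I" for i
    using ind' that by (auto intro: measurable_sets)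
  fix A J assume J: "J \<noteq> {}" "J \<subseteq> I" "finite J"
    and A: "\<forall>j\<in>J. A j \<in> {X (f j) -` A \<inter> space M | A. A \<in> sets (M' (f j))}"
  have fJ: "inj_on f J" using f J(2) by (rule inj_on_subset)
  define B where "B j = A (inv_into J f j)" for j
  have BA: "B (f j) = A j" if "j \<in> J" for j using fJ that by (simp add: B_def)
  have "prob (\<Inter>j\<in>f ` J. B j) = (\<Prod>j\<in>f ` J. prob (B j))"
  proof (rule indep_setsD)
    show "indep_sets (\<lambda>i. {X i -` A \<inter> space M | A. A \<in> sets (M' i)}) (f ` I)" using ind' by simp
  qed (use J A BA in auto)
  then show "prob (\<Inter>j\<in>J. A j) = (\<Prod>j\<in>J. prob (A j))"
    using BA by (simp add: prod.reindex[OF fJ] cong: INF_cong_simp)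
qed

text \<open>The entries are indexed by the unordered pair of row and column, as in \<^const>\<open>walk_edge\<close>.\<close>
lemma (in prob_space) truncated_entries:
  fixes x :: "nat \<Rightarrow> nat \<Rightarrow> nat \<Rightarrow> 'a \<Rightarrow> real" and t :: "nat \<Rightarrow> ennreal"
  assumes arr: "symmetric_iid_arrays M x"
  defines "Y \<equiv> \<lambda>n e \<omega>. truncate_at (t n) (x n (Min e) (Max e) \<omega>)"
    and "I \<equiv> \<lambda>n. {{a, b} | a b. a < n \<and> b < n}"
  shows "indep_vars (\<lambda>_. borel) (Y n) (I n)"
    and "a \<in> I n \<Longrightarrow> integrable M (\<lambda>\<omega>. truncate_at (t n) (x n 0 0 \<omega>) ^ j) \<Longrightarrow> integrable M (\<lambda>\<omega>. Y n a \<omega> ^ j)"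
    and "a \<in> I n \<Longrightarrow> expectation (\<lambda>\<omega>. Y n a \<omega> ^ j) = expectation (\<lambda>\<omega>. truncate_at (t n) (x n 0 0 \<omega>) ^ j)"
    and "\<omega> \<in> space M \<Longrightarrow> i < n \<Longrightarrow> l < n \<Longrightarrow> truncate_at (t n) (x n i l \<omega>) = Y n {i, l} \<omega>"
proof -
  let ?I = "{(i, j). i \<le> j \<and> j < n}"
  have sym: "x n i j \<omega> = x n j i \<omega>" if "i < n" "j < n" "\<omega> \<in> space M" for i j \<omega>
    using arr that unfolding symmetric_iid_arrays_def by blast
  have ind: "indep_vars (\<lambda>_. borel) (\<lambda>(i, j). x n i j) ?I"
    using arr unfolding symmetric_iid_arrays_def by blast
  have distr: "distr M borel (x n i j) = distr M borel (x n 0 0)" if "i \<le> j" "j < n" for i j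
    using arr that unfolding symmetric_iid_arrays_def by blast
  let ?f = "\<lambda>e :: nat set. (Min e, Max e)"
  have f_I: "?f e \<in> ?I" if e: "e \<in> I n" for e
  proof -
    obtain a b where ab: "e = {a, b}" "a < n" "b < n" using e by (auto simp: I_def)
    then show ?thesis by (cases "a \<le> b") (auto simp: min_def max_def)
  qed
  have inj: "inj_on ?f (I n)"
  proof (rule inj_onI)
    fix e e' assume e: "e \<in> I n" "e' \<in> I n" and eq: "?f e = ?f e'"
    obtain a b c d where "e = {a, b}" "e' = {c, d}" using e by (auto simp: I_def)
    then show "e = e'" using eq insert_Min_Max[of a b] insert_Min_Max[of c d] by (metis prod.inject)
  qed
  have "indep_vars (\<lambda>_. borel) (\<lambda>ij \<omega>. truncate_at (t n) ((case ij of (i, j) \<Rightarrow> x n i j) \<omega>)) ?I"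
    by (rule indep_vars_compose2[OF ind, of "\<lambda>_. truncate_at (t n)"]) simp
  then have "indep_vars (\<lambda>_. borel) (\<lambda>ij \<omega>. truncate_at (t n) ((case ij of (i, j) \<Rightarrow> x n i j) \<omega>)) (?f ` I n)"
    by (rule indep_vars_subset) (use f_I in auto)
  from indep_vars_reindex_inj[OF inj this] show "indep_vars (\<lambda>_. borel) (Y n) (I n)"
    unfolding Y_def by simp
  have rv: "x n i j \<in> borel_measurable M" if "i \<le> j" "j < n" for i j
    using ind that unfolding indep_vars_def by auto
  {
    assume a: "a \<in> I n"
    then have le: "Min a \<le> Max a" "Max a < n" using f_I[OF a] by auto
    have z: "0 \<le> (0::nat)" "0 < n" using le by auto
    have [measurable]: "x n (Min a) (Max a) \<in> borel_measurable M" "x n 0 0 \<in> borel_measurable M"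
      using rv[OF le] rv[OF z] .
    have I1: "integrable M (\<lambda>\<omega>. truncate_at (t n) (x n i l \<omega>) ^ j) \<longleftrightarrow>
        integrable (distr M borel (x n i l)) (\<lambda>s. truncate_at (t n) s ^ j)" if "x n i l \<in> borel_measurable M" for i l
      by (subst integrable_distr_eq) (use that in auto)
    have I2: "expectation (\<lambda>\<omega>. truncate_at (t n) (x n i l \<omega>) ^ j) =
        (\<integral>s. truncate_at (t n) s ^ j \<partial>distr M borel (x n i l))" if "x n i l \<in> borel_measurable M" for i l
      by (subst integral_distr) (use that in auto)
    show "integrable M (\<lambda>\<omega>. Y n a \<omega> ^ j)" if "integrable M (\<lambda>\<omega>. truncate_at (t n) (x n 0 0 \<omega>) ^ j)"
      using that I1[of 0 0] I1[of "Min a" "Max a"] distr[OF le] unfolding Y_def by simp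
    show "expectation (\<lambda>\<omega>. Y n a \<omega> ^ j) = expectation (\<lambda>\<omega>. truncate_at (t n) (x n 0 0 \<omega>) ^ j)"
      using I2[of 0 0] I2[of "Min a" "Max a"] distr[OF le] unfolding Y_def by simp
  }
  assume "\<omega> \<in> space M" "i < n" "l < n"
  then show "truncate_at (t n) (x n i l \<omega>) = Y n {i, l} \<omega>"
    using sym[of i l \<omega>] unfolding Y_def by (cases "i \<le> l") (auto simp: min_def max_def)
qed

section \<open>From the truncated to the full matrix\<close>

lemma continuity_point_near:
  assumes "real_distribution \<mu>" "isCont (cdf \<mu>) s" "e > 0"
  obtains s1 s2 where "s1 < s" "s < s2" "isCont (cdf \<mu>) s1" "isCont (cdf \<mu>) s2"
    "\<bar>cdf \<mu> s1 - cdf \<mu> s\<bar> < e" "\<bar>cdf \<mu> s2 - cdf \<mu> s\<bar> < e"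
proof -
  interpret real_distribution \<mu> by fact
  have mono: "mono (cdf \<mu>)" by (rule monoI) (rule cdf_nondecreasing)
  obtain d where d: "d > 0" "\<And>y. \<bar>y - s\<bar> < d \<Longrightarrow> \<bar>cdf \<mu> y - cdf \<mu> s\<bar> < e"
    using assms(2,3) unfolding continuous_at_eps_delta dist_real_def by blast
  \<comment> \<open>A monotone function has only countably many discontinuities, so every nonempty
    open interval contains continuity points.\<close>
  note ctbl = mono_ctble_discont[OF mono]
  obtain s1 where s1: "s1 \<in> {s - d<..<s} - {a. \<not> isCont (cdf \<mu>) a}"
    using open_minus_countable[OF ctbl, of "{s - d<..<s}"] d(1) by (auto simp: ex_in_conv)
  obtain s2 where s2: "s2 \<in> {s<..<s + d} - {a. \<not> isCont (cdf \<mu>) a}"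
    using open_minus_countable[OF ctbl, of "{s<..<s + d}"] d(1) by (auto simp: ex_in_conv)
  show ?thesis
  proof (rule that[of s1 s2])
    show "\<bar>cdf \<mu> s1 - cdf \<mu> s\<bar> < e" "\<bar>cdf \<mu> s2 - cdf \<mu> s\<bar> < e" using s1 s2 by (auto intro!: d(2))
  qed (use s1 s2 in auto)
qed

text \<open>Deterministic form of the comparison, shared by the almost sure and the in-probability
  statements. The error \<open>3 * e\<close> is one \<open>e\<close> for the perturbation, one for
  the distance of the spectral distribution function from \<open>cdf \<mu>\<close> at
  \<open>s1\<close> or \<open>s2\<close>, and one for the oscillation of \<open>cdf \<mu>\<close>
  near \<open>s\<close>.\<close>

lemma cdf_perturbation_sandwich:
  assumes "real_distribution \<mu>" "isCont (cdf \<mu>) s" "e > 0"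
  obtains s1 s2 c where "isCont (cdf \<mu>) s1" "isCont (cdf \<mu>) s2" "c > 0"
    "\<And>(A :: real Matrix.mat) B n. n > 0 \<Longrightarrow> A \<in> carrier_mat n n \<Longrightarrow> B \<in> carrier_mat n n \<Longrightarrow>
      (\<And>i j. i < n \<Longrightarrow> j < n \<Longrightarrow> A $$ (i, j) = A $$ (j, i)) \<Longrightarrow>
      (\<And>i j. i < n \<Longrightarrow> j < n \<Longrightarrow> B $$ (i, j) = B $$ (j, i)) \<Longrightarrow>
      (1 / real n) * (\<Sum>i<n. \<Sum>j<n. (A $$ (i, j) - B $$ (i, j))\<^sup>2) \<le> c \<Longrightarrow>
      \<bar>cdf (esd A) s1 - cdf \<mu> s1\<bar> \<le> e \<Longrightarrow> \<bar>cdf (esd A) s2 - cdf \<mu> s2\<bar> \<le> e \<Longrightarrow>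
      \<bar>cdf (esd B) s - cdf \<mu> s\<bar> \<le> 3 * e"
proof -
  obtain s1 s2 where s: "s1 < s" "s < s2" "isCont (cdf \<mu>) s1" "isCont (cdf \<mu>) s2"
    "\<bar>cdf \<mu> s1 - cdf \<mu> s\<bar> < e" "\<bar>cdf \<mu> s2 - cdf \<mu> s\<bar> < e"
    by (rule continuity_point_near[OF assms])
  \<comment> \<open>The perturbation errors are at most \<open>c\<close> over the squared distances
    from \<open>s\<close> to \<open>s1\<close> and \<open>s2\<close>; the minimum keeps both at most
    \<open>e\<close>.\<close>
  define c where "c = min (e * (s - s1)\<^sup>2) (e * (s2 - s)\<^sup>2)"
  show ?thesis
  proof (rule that[OF s(3,4), of c])
    show "c > 0" using s(1,2) assms(3) by (simp add: c_def)
    fix A B :: "real Matrix.mat" and n :: nat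
    assume n: "n > 0" and A: "A \<in> carrier_mat n n" and B: "B \<in> carrier_mat n n"
      and sA: "\<And>i j. i < n \<Longrightarrow> j < n \<Longrightarrow> A $$ (i, j) = A $$ (j, i)"
      and sB: "\<And>i j. i < n \<Longrightarrow> j < n \<Longrightarrow> B $$ (i, j) = B $$ (j, i)"
      and R: "(1 / real n) * (\<Sum>i<n. \<Sum>j<n. (A $$ (i, j) - B $$ (i, j))\<^sup>2) \<le> c"
      and e: "\<bar>cdf (esd A) s1 - cdf \<mu> s1\<bar> \<le> e" "\<bar>cdf (esd A) s2 - cdf \<mu> s2\<bar> \<le> e"
    let ?F = "\<Sum>i<n. \<Sum>j<n. (A $$ (i, j) - B $$ (i, j))\<^sup>2"
    have F': "(\<Sum>i<n. \<Sum>j<n. (B $$ (i, j) - A $$ (i, j))\<^sup>2) = ?F"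
      by (intro sum.cong refl) (rule power2_commute)
    have bound: "?F / (real n * d\<^sup>2) \<le> e" if "d > 0" "c \<le> e * d\<^sup>2" for d
    proof -
      have "?F / (real n * d\<^sup>2) = ((1 / real n) * ?F) / d\<^sup>2" by simp
      also have "\<dots> \<le> (e * d\<^sup>2) / d\<^sup>2" using R that by (intro divide_right_mono) auto
      also have "\<dots> = e" using that by simp
      finally show ?thesis .
    qed
    have "cdf (esd A) s1 \<le> cdf (esd B) (s1 + (s - s1)) + ?F / (real n * (s - s1)\<^sup>2)"
      by (rule cdf_esd_perturbation[OF A sA B sB n]) (use s in auto)
    moreover have "?F / (real n * (s - s1)\<^sup>2) \<le> e" by (rule bound) (use s in \<open>auto simp: c_def\<close>)
    moreover have "cdf (esd B) s \<le> cdf (esd A) (s + (s2 - s)) + ?F / (real n * (s2 - s)\<^sup>2)"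
      using cdf_esd_perturbation[OF B sB A sA n, of "s2 - s" s] s unfolding F' by simp
    moreover have "?F / (real n * (s2 - s)\<^sup>2) \<le> e" by (rule bound) (use s in \<open>auto simp: c_def\<close>)
    ultimately show "\<bar>cdf (esd B) s - cdf \<mu> s\<bar> \<le> 3 * e" using e s(5,6) by simp
  qed
qed

text \<open>Dominated convergence for the indicators of the bad events.\<close>

lemma (in prob_space) AE_tendsto_imp_in_prob:
  fixes X :: "nat \<Rightarrow> 'a \<Rightarrow> real"
  assumes meas: "\<And>n. X n \<in> borel_measurable M" and conv: "AE \<omega> in M. (\<lambda>n. X n \<omega>) \<longlonglongrightarrow> L" and e: "e > 0"
  shows "(\<lambda>n. prob {\<omega> \<in> space M. e < \<bar>X n \<omega> - L\<bar>}) \<longlonglongrightarrow> 0"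
proof -
  note [measurable] = meas
  have "(\<lambda>n. \<integral>\<omega>. indicator {\<omega> \<in> space M. e < \<bar>X n \<omega> - L\<bar>} \<omega> \<partial>M) \<longlonglongrightarrow> (\<integral>\<omega>. 0 \<partial>M :: real)"
  proof (rule integral_dominated_convergence[where w = "\<lambda>_. 1"])
    show "AE \<omega> in M. (\<lambda>n. indicator {\<omega> \<in> space M. e < \<bar>X n \<omega> - L\<bar>} \<omega> :: real) \<longlonglongrightarrow> 0"
      using conv
    proof eventually_elim
      case (elim \<omega>)
      from tendstoD[OF this e] have "\<forall>\<^sub>F n in sequentially. indicator {\<omega> \<in> space M. e < \<bar>X n \<omega> - L\<bar>} \<omega> = (0::real)"
        by eventually_elim (auto simp: indicator_def dist_real_def)
      then show ?case by (rule tendsto_eventually)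
    qed
  qed (auto simp: indicator_def)
  moreover have "(\<integral>\<omega>. indicator {\<omega> \<in> space M. e < \<bar>X n \<omega> - L\<bar>} \<omega> \<partial>M) = prob {\<omega> \<in> space M. e < \<bar>X n \<omega> - L\<bar>}" for n
    by (subst Bochner_Integration.integral_indicator) (auto intro!: arg_cong[of _ _ prob])
  ultimately show ?thesis by simp
qed

theorem corollary2p1:
  fixes M :: "'a measure"
    and x :: "nat \<Rightarrow> nat \<Rightarrow> nat \<Rightarrow> 'a \<Rightarrow> real"
    and t :: "nat \<Rightarrow> ennreal"
    and C :: "nat \<Rightarrow> real"
    and G :: "real measure"
  defines "Z \<equiv> \<lambda>n \<omega>. Matrix.mat n n (\<lambda>(i, j). truncate_at (t n) (x n i j \<omega>))"
    and "W \<equiv> \<lambda>n \<omega>. Matrix.mat n n (\<lambda>(i, j). x n i j \<omega>)"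
    and "R \<equiv> \<lambda>n \<omega>. (1 / real n) *
           (\<Sum>i<n. \<Sum>j<n. (x n i j \<omega>)\<^sup>2 * of_bool (ennreal \<bar>x n i j \<omega>\<bar> > t n))"
  assumes "prob_space M"
    and "symmetric_iid_arrays M x"
    and even_integrable: "\<And>k. k \<ge> 1 \<Longrightarrow> \<forall>\<^sub>F n in sequentially.
           integrable M (\<lambda>\<omega>. x n 0 0 \<omega> ^ (2 * k) * of_bool (ennreal \<bar>x n 0 0 \<omega>\<bar> \<le> t n))"
    and even_moments: "\<And>k. k \<ge> 1 \<Longrightarrow>
           (\<lambda>n. real n * (\<integral>\<omega>. x n 0 0 \<omega> ^ (2 * k) * of_bool (ennreal \<bar>x n 0 0 \<omega>\<bar> \<le> t n) \<partial>M))
             \<longlonglongrightarrow> C (2 * k)"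
    and odd_moments: "\<And>k \<alpha>. k \<ge> 1 \<Longrightarrow> \<alpha> < 1 \<Longrightarrow>
           (\<lambda>n. real n powr \<alpha> *
             (\<integral>\<omega>. x n 0 0 \<omega> ^ (2 * k - 1) * of_bool (ennreal \<bar>x n 0 0 \<omega>\<bar> \<le> t n) \<partial>M))
             \<longlonglongrightarrow> 0"
    and "real_distribution G"
    and "has_cumulants G (\<lambda>k. if even k then C k else 0)"
    and "carleman (moment G)"
  shows "\<exists>\<mu>. real_distribution \<mu> \<and> all_moments_finite \<mu> \<and>
           (\<forall>k\<ge>1. moment \<mu> k = (if even k then \<Sum>\<sigma>\<in>SS k. part_weight C \<sigma> else 0)) \<and>
           (AE \<omega> in M. weak_conv_m (\<lambda>n. esd (Z n \<omega>)) \<mu>) \<and>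
           ((AE \<omega> in M. (\<lambda>n. R n \<omega>) \<longlonglongrightarrow> 0) \<longrightarrow>
              (AE \<omega> in M. weak_conv_m (\<lambda>n. esd (W n \<omega>)) \<mu>)) \<and>
           (tendsto_in_prob M R 0 \<longrightarrow> weak_conv_in_prob M (\<lambda>n \<omega>. esd (W n \<omega>)) \<mu>)"
proof -
  interpret prob_space M by fact
  note arr = \<open>symmetric_iid_arrays M x\<close>
  define Y where "Y n e \<omega> = truncate_at (t n) (x n (Min e) (Max e) \<omega>)" for n e \<omega>
  define I where "I n = {{a, b} | a b. a < n \<and> b < n}" for n :: nat
  define m where "m n j = expectation (\<lambda>\<omega>. truncate_at (t n) (x n 0 0 \<omega>) ^ j)" for n j
  note te = truncated_entries[where t = t, OF arr, folded Y_def I_def, folded m_def]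
  have rv: "x n i j \<in> borel_measurable M" if "i < n" "j < n" for n i j
  proof -
    have A: "x n a b \<in> borel_measurable M" if "a \<le> b" "b < n" for a b
    proof -
      have "indep_vars (\<lambda>_. borel) (\<lambda>(i, j). x n i j) {(i, j). i \<le> j \<and> j < n}"
        using arr unfolding symmetric_iid_arrays_def by blast
      then show ?thesis using that unfolding indep_vars_def by auto
    qed
    show ?thesis
    proof (cases "i \<le> j")
      case True then show ?thesis using A that by blast
    next
      case False
      have "x n i j \<omega> = x n j i \<omega>" if "\<omega> \<in> space M" for \<omega>
        using arr \<open>i < n\<close> \<open>j < n\<close> that unfolding symmetric_iid_arrays_def by blast
      then show ?thesis using A[of j i] False that by (subst measurable_cong[of M "x n i j" "x n j i"]) auto
    qed
  qed
  have m_trunc: "m n j = expectation (\<lambda>\<omega>. x n 0 0 \<omega> ^ j * of_bool (ennreal \<bar>x n 0 0 \<omega>\<bar> \<le> t n))" if "j \<ge> 1" for n j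
    unfolding m_def truncate_at_power[OF that] ..
  have lim: "(\<lambda>n. real n * m n (2 * j)) \<longlonglongrightarrow> C (2 * j)" if "j \<ge> 1" for j
    using even_moments[OF that] m_trunc[of "2 * j"] that by simp
  have small: "(\<lambda>n. real n powr \<alpha> * m n j) \<longlonglongrightarrow> 0" if j: "j \<ge> 1" and \<alpha>: "\<alpha> < 1" for j \<alpha>
  proof (cases "even j")
    case False
    then obtain i where i: "j = 2 * i + 1" by (elim oddE)
    then have "2 * (i + 1) - 1 = j" by simp
    then show ?thesis using odd_moments[of "i + 1" \<alpha>] \<alpha> m_trunc[OF j] by simp
  next
    case True
    then obtain i where i: "j = 2 * i" by (elim evenE)
    \<comment> \<open>For even orders the decay is inherited from the convergence of
      \<open>n * m n j\<close>, as \<open>n powr (\<alpha> - 1)\<close> tends to 0.\<close>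
    have "(\<lambda>n. real n powr (\<alpha> - 1)) \<longlonglongrightarrow> 0"
      using \<alpha> by (intro tendsto_neg_powr filterlim_real_sequentially) simp
    from tendsto_mult[OF this lim[of i]] j i
    have "(\<lambda>n. real n powr (\<alpha> - 1) * (real n * m n j)) \<longlonglongrightarrow> 0" by simp
    moreover have "\<forall>\<^sub>F n in sequentially. real n powr (\<alpha> - 1) * (real n * m n j) = real n powr \<alpha> * m n j"
      using eventually_gt_at_top[of 0]
    proof eventually_elim
      case (elim n)
      then have "real n powr (\<alpha> - 1) * real n = real n powr \<alpha>" by (simp add: powr_diff)
      then show ?case by (simp only: mult.assoc[symmetric])
    qed
    ultimately show ?thesis by (rule Lim_transform_eventually)
  qed
  \<comment> \<open>Integrability at order \<open>2 * j\<close> is used for order \<open>j\<close>,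
    which covers odd \<open>j\<close>.\<close>
  have int: "\<forall>\<^sub>F n in sequentially. \<forall>a\<in>I n. integrable M (\<lambda>\<omega>. Y n a \<omega> ^ j)" if j: "j \<ge> 1" for j
    using even_integrable[OF j] eventually_gt_at_top[of 0]
  proof eventually_elim
    case (elim n)
    have [measurable]: "x n 0 0 \<in> borel_measurable M" using rv elim(2) by auto
    have "integrable M (\<lambda>\<omega>. truncate_at (t n) (x n 0 0 \<omega>) ^ (2 * j))"
      using elim(1) truncate_at_power[of "2 * j"] j by simp
    then have "integrable M (\<lambda>\<omega>. truncate_at (t n) (x n 0 0 \<omega>) ^ j)"
      by (rule integrable_power_of_double[OF prob_space_axioms, rotated]) measurable
    then show ?case using te(2) by blast
  qed
  define T where "T k n \<omega> = (\<Sum>p\<in>closed_walks n k. \<Prod>i\<in>{1..k}. Y n (walk_edge p i) \<omega>)" for k n \<omega>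
  have ZWdim: "Z n \<omega> \<in> carrier_mat n n" "W n \<omega> \<in> carrier_mat n n" for n \<omega> by (auto simp: Z_def W_def)
  have Zent: "Z n \<omega> $$ (i, j) = Y n {i, j} \<omega>" if "\<omega> \<in> space M" "i < n" "j < n" for n \<omega> i j
    using te(4)[OF that] that by (simp add: Z_def)
  have Zsym: "Z n \<omega> $$ (i, j) = Z n \<omega> $$ (j, i)" if "\<omega> \<in> space M" "i < n" "j < n" for n \<omega> i j
    using Zent that by (simp add: insert_commute)
  have Wsym: "W n \<omega> $$ (i, j) = W n \<omega> $$ (j, i)" if "\<omega> \<in> space M" "i < n" "j < n" for n \<omega> i j
    using arr that unfolding symmetric_iid_arrays_def W_def by simp
  have momZ: "all_moments_finite (esd (Z n \<omega>))" "moment (esd (Z n \<omega>)) k = T k n \<omega> / real n"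
    if \<omega>: "\<omega> \<in> space M" and n: "n > 0" for n \<omega> k
  proof -
    show "all_moments_finite (esd (Z n \<omega>))" by (rule moment_esd(1)[OF ZWdim(1) Zsym[OF \<omega>] n])
    have "moment (esd (Z n \<omega>)) k = mat_tr (Z n \<omega> ^\<^sub>m k) / real n"
      by (rule moment_esd(2)[OF ZWdim(1) Zsym[OF \<omega>] n])
    also have "mat_tr (Z n \<omega> ^\<^sub>m k) = T k n \<omega>"
      unfolding mat_tr_pow[OF ZWdim(1)] T_def
    proof (intro sum.cong prod.cong refl)
      fix p i assume "p \<in> closed_walks n k" "i \<in> {1..k}"
      then have "p (i - 1) < n" "p i < n" by (auto simp: closed_walks_def PiE_def Pi_def)
      then show "Z n \<omega> $$ (p (i - 1), p i) = Y n (walk_edge p i) \<omega>"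
        using Zent[OF \<omega>] by (simp add: walk_edge_def)
    qed
    finally show "moment (esd (Z n \<omega>)) k = T k n \<omega> / real n" .
  qed
  \<comment> \<open>Order 0 is set apart because \<open>SS 0\<close> is empty and the sum would give
    0 instead of the total mass 1.\<close>
  define L where "L k = (if k = 0 then 1 else \<Sum>\<sigma>\<in>SS k. part_weight C \<sigma>)" for k
  have AET: "AE \<omega> in M. \<forall>k\<ge>1. (\<lambda>n. T k n \<omega> / real n) \<longlonglongrightarrow> L k"
  proof -
    have "AE \<omega> in M. (\<lambda>n. T k n \<omega> / real n) \<longlonglongrightarrow> L k" if k: "k \<ge> 1" for k
      using AE_normalised_trace_limit[of Y m C k, folded I_def, OF te(1) int te(3) small lim k] k
      unfolding T_def L_def by simp
    then have "AE \<omega> in M. k \<ge> 1 \<longrightarrow> (\<lambda>n. T k n \<omega> / real n) \<longlonglongrightarrow> L k" for k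
      by (cases "k \<ge> 1") auto
    then show ?thesis by (simp add: AE_all_countable)
  qed
  \<comment> \<open>The sequence is shifted by one, since \<open>esd\<close> of the empty matrix at
    \<open>n = 0\<close> is unspecified and its moments need not be finite.\<close>
  have mlim: "(\<lambda>n. moment (esd (Z (Suc n) \<omega>)) k) \<longlonglongrightarrow> L k"
    if \<omega>: "\<omega> \<in> space M" "\<forall>k\<ge>1. (\<lambda>n. T k n \<omega> / real n) \<longlonglongrightarrow> L k" for \<omega> k
  proof (cases "k = 0")
    case True
    have "moment (esd A) 0 = 1" for A
    proof -
      interpret E: real_distribution "esd A" by (rule real_distribution_esd)
      show ?thesis using E.prob_space by (simp add: moment_def)
    qed
    then show ?thesis using True by (simp add: L_def)
  next
    case False
    then have "(\<lambda>n. T k (Suc n) \<omega> / real (Suc n)) \<longlonglongrightarrow> L k"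
      using \<omega>(2) LIMSEQ_Suc[of "\<lambda>n. T k n \<omega> / real n" "L k"] by simp
    then show ?thesis using momZ(2)[OF \<omega>(1)] by simp
  qed
  \<comment> \<open>An almost sure event is nonempty, and one sample point is enough to produce the
    deterministic limit law.\<close>
  obtain \<omega>0 where \<omega>0: "\<omega>0 \<in> space M" "\<forall>k\<ge>1. (\<lambda>n. T k n \<omega>0 / real n) \<longlonglongrightarrow> L k"
  proof (rule ccontr)
    assume "\<not> thesis"
    then have "AE \<omega> in M. \<not> (\<forall>k\<ge>1. (\<lambda>n. T k n \<omega> / real n) \<longlonglongrightarrow> L k)"
      using that by (intro AE_I2) blast
    with AET have "AE \<omega> in M. False" by eventually_elim simp
    then show False by (simp add: AE_False)
  qed
  obtain \<mu> where \<mu>: "real_distribution \<mu>" "all_moments_finite \<mu>" "\<And>k. moment \<mu> k = L k"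
    by (rule moment_limit_exists[of "\<lambda>n. esd (Z (Suc n) \<omega>0)" L])
      (use real_distribution_esd momZ(1)[OF \<omega>0(1)] mlim[OF \<omega>0] in auto)
  have C_nonneg: "C (2 * j) \<ge> 0" if "j \<ge> 1" for j
  proof (rule LIMSEQ_le_const[OF lim[OF that]], intro exI allI impI)
    fix n
    have "m n (2 * j) \<ge> 0" unfolding m_def by (intro Bochner_Integration.integral_nonneg) simp
    then show "0 \<le> real n * m n (2 * j)" by simp
  qed
  let ?C = "\<lambda>k. if even k then C k else 0"
  \<comment> \<open>\<open>SS (2 * k)\<close> is part of the set of all partitions and the omitted
    terms are nonnegative, so the limiting moments lie below those of \<open>G\<close>, for which
    Carleman's condition is given. Blocks in \<open>SS\<close> are even, so \<open>C\<close> and the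
    cumulants of \<open>G\<close> agree on them.\<close>
  have L_le: "L (2 * k) \<le> moment G (2 * k)" if k: "k > 0" for k
  proof -
    have k2: "2 * k \<ge> 1" using k by simp
    have "part_weight C \<sigma> = part_weight ?C \<sigma>" if \<sigma>: "\<sigma> \<in> SS (2 * k)" for \<sigma>
      unfolding part_weight_def
    proof (rule prod.cong[OF refl])
      fix V assume "V \<in> \<sigma>"
      then obtain j where "card V = 2 * j" by (rule SS_block_even[OF \<sigma> k2])
      then show "C (card V) = ?C (card V)" by simp
    qed
    then have "L (2 * k) = (\<Sum>\<sigma>\<in>SS (2 * k). part_weight ?C \<sigma>)"
      unfolding L_def using k by (auto intro!: sum.cong)
    also have "\<dots> \<le> (\<Sum>\<sigma> | partition_on {1..2 * k} \<sigma>. part_weight ?C \<sigma>)"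
    proof (rule sum_mono2)
      show "finite {\<sigma>. partition_on {1..2 * k} \<sigma>}" by (rule finitely_many_partition_on) simp
      show "SS (2 * k) \<subseteq> {\<sigma>. partition_on {1..2 * k} \<sigma>}" by (auto simp: SS_def)
      fix \<sigma> assume "\<sigma> \<in> {\<sigma>. partition_on {1..2 * k} \<sigma>} - SS (2 * k)"
      then have part: "partition_on {1..2 * k} \<sigma>" by simp
      show "0 \<le> part_weight ?C \<sigma>" unfolding part_weight_def
      proof (rule prod_nonneg)
        fix V assume V: "V \<in> \<sigma>"
        have "V \<subseteq> {1..2 * k}" using V partition_onD1[OF part] by auto
        then have "finite V" by (rule finite_subset) simp
        moreover have "V \<noteq> {}" using V partition_onD3[OF part] by metis
        ultimately have "card V > 0" by (simp add: card_gt_0_iff)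
        then show "0 \<le> ?C (card V)" using C_nonneg[of "card V div 2"] by (auto elim!: evenE)
      qed
    qed
    also have "\<dots> = moment G (2 * k)"
      using \<open>has_cumulants G ?C\<close> k2 unfolding has_cumulants_def by simp
    finally show ?thesis .
  qed
  have det: "moment_determinate \<mu>"
    unfolding moment_determinate_def
  proof (intro allI impI)
    fix \<nu> assume \<nu>: "real_distribution \<nu>" "all_moments_finite \<nu>" "\<forall>k. moment \<nu> k = moment \<mu> k"
    show "\<nu> = \<mu>"
      by (rule carleman_determinate[OF \<nu>(1,2) \<mu>(1,2) _ _ \<open>carleman (moment G)\<close>])
        (use \<nu>(3) \<mu>(3) L_le in auto)
  qed
  have wcZ: "AE \<omega> in M. weak_conv_m (\<lambda>n. esd (Z n \<omega>)) \<mu>"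
    using AET AE_space
  proof eventually_elim
    case (elim \<omega>)
    have "weak_conv_m (\<lambda>n. esd (Z (Suc n) \<omega>)) \<mu>"
      by (rule method_of_moments[OF real_distribution_esd _ \<mu>(1) det])
        (use momZ(1)[OF elim(2)] mlim[OF elim(2,1)] \<mu>(3) in auto)
    then show ?case unfolding weak_conv_m_def weak_conv_def
      using LIMSEQ_imp_Suc[of "\<lambda>n. cdf (esd (Z n \<omega>)) _"] by blast
  qed
  \<comment> \<open>The entries removed by the truncation are those of \<open>W - Z\<close>, so
    \<open>R\<close> is the squared cost in the coupling of the two spectra.\<close>
  have R_eq: "R n \<omega> = (1 / real n) * (\<Sum>i<n. \<Sum>j<n. (Z n \<omega> $$ (i, j) - W n \<omega> $$ (i, j))\<^sup>2)" for n \<omega>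
    unfolding R_def Z_def W_def
    by (intro arg_cong[of _ _ "\<lambda>s. 1 / real n * s"] sum.cong refl) (simp add: diff_truncate_at_sq)
  have sandwich: thesis
    if s: "isCont (cdf \<mu>) s" and e: "e > 0"
      and *: "\<And>s1 s2 c. isCont (cdf \<mu>) s1 \<Longrightarrow> isCont (cdf \<mu>) s2 \<Longrightarrow> c > 0 \<Longrightarrow>
        (\<And>n \<omega>. n > 0 \<Longrightarrow> \<omega> \<in> space M \<Longrightarrow> R n \<omega> \<le> c \<Longrightarrow> \<bar>cdf (esd (Z n \<omega>)) s1 - cdf \<mu> s1\<bar> \<le> e \<Longrightarrow>
          \<bar>cdf (esd (Z n \<omega>)) s2 - cdf \<mu> s2\<bar> \<le> e \<Longrightarrow> \<bar>cdf (esd (W n \<omega>)) s - cdf \<mu> s\<bar> \<le> 3 * e) \<Longrightarrow> thesis"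
    for s e thesis
  proof (rule cdf_perturbation_sandwich[OF \<mu>(1) s e], goal_cases)
    case (1 s1 s2 c)
    show ?case
    proof (rule *[OF 1(1-3)])
      fix n \<omega> assume n: "n > 0" and \<omega>: "\<omega> \<in> space M" and R: "R n \<omega> \<le> c"
        and close: "\<bar>cdf (esd (Z n \<omega>)) s1 - cdf \<mu> s1\<bar> \<le> e" "\<bar>cdf (esd (Z n \<omega>)) s2 - cdf \<mu> s2\<bar> \<le> e"
      show "\<bar>cdf (esd (W n \<omega>)) s - cdf \<mu> s\<bar> \<le> 3 * e"
        by (rule 1(4)[OF n ZWdim Zsym[OF \<omega>] Wsym[OF \<omega>] R[unfolded R_eq] close])
    qed
  qed
  have wcW: "AE \<omega> in M. weak_conv_m (\<lambda>n. esd (W n \<omega>)) \<mu>" if "AE \<omega> in M. (\<lambda>n. R n \<omega>) \<longlonglongrightarrow> 0"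
    using wcZ that AE_space
  proof eventually_elim
    case (elim \<omega>)
    show ?case unfolding weak_conv_m_def weak_conv_def
    proof (intro allI impI tendstoI)
      fix s e :: real assume s: "isCont (cdf \<mu>) s" and e: "e > 0"
      \<comment> \<open>With \<open>e / 4\<close> the sandwich gives \<open>3 * (e / 4)\<close>,
        strictly below \<open>e\<close> as convergence demands.\<close>
      obtain s1 s2 c where *: "isCont (cdf \<mu>) s1" "isCont (cdf \<mu>) s2" "c > 0"
        "\<And>n \<omega>. n > 0 \<Longrightarrow> \<omega> \<in> space M \<Longrightarrow> R n \<omega> \<le> c \<Longrightarrow> \<bar>cdf (esd (Z n \<omega>)) s1 - cdf \<mu> s1\<bar> \<le> e / 4 \<Longrightarrow>
          \<bar>cdf (esd (Z n \<omega>)) s2 - cdf \<mu> s2\<bar> \<le> e / 4 \<Longrightarrow> \<bar>cdf (esd (W n \<omega>)) s - cdf \<mu> s\<bar> \<le> 3 * (e / 4)"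
        by (rule sandwich[OF s, of "e / 4"]) (use e that in auto)
      have e4: "e / 4 > 0" using e by simp
      have "(\<lambda>n. cdf (esd (Z n \<omega>)) s1) \<longlonglongrightarrow> cdf \<mu> s1" "(\<lambda>n. cdf (esd (Z n \<omega>)) s2) \<longlonglongrightarrow> cdf \<mu> s2"
        using elim(1) *(1,2) unfolding weak_conv_m_def weak_conv_def by auto
      from tendstoD[OF this(1) e4] tendstoD[OF this(2) e4] tendstoD[OF elim(2) *(3)] eventually_gt_at_top[of 0]
      show "\<forall>\<^sub>F n in sequentially. dist (cdf (esd (W n \<omega>)) s) (cdf \<mu> s) < e"
      proof eventually_elim
        case (elim n)
        have "\<bar>R n \<omega>\<bar> < c" using elim(3) by (simp add: dist_real_def)
        then have "\<bar>cdf (esd (W n \<omega>)) s - cdf \<mu> s\<bar> \<le> 3 * (e / 4)"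
          by (intro *(4)[OF elim(4) \<open>\<omega> \<in> space M\<close>]) (use elim in \<open>auto simp: dist_real_def\<close>)
        then show ?case using e by (simp add: dist_real_def)
      qed
    qed
  qed
  have T_meas: "(\<lambda>\<omega>. T k n \<omega> / real n) \<in> borel_measurable M" for k n
  proof -
    have Ym: "Y n a \<in> borel_measurable M" if "a \<in> I n" for a
      using te(1)[of n] that unfolding indep_vars_def by auto
    have "(\<lambda>\<omega>. T k n \<omega>) \<in> borel_measurable M"
      unfolding T_def
    proof (intro borel_measurable_sum borel_measurable_prod Ym)
      fix p i assume "p \<in> closed_walks n k" "i \<in> {1..k}"
      then have "p (i - 1) < n" "p i < n" by (auto simp: closed_walks_def PiE_def Pi_def)
      then show "walk_edge p i \<in> I n" unfolding walk_edge_def I_def by blast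
    qed
    then show ?thesis by simp
  qed
  have R_meas: "R n \<in> borel_measurable M" for n
  proof -
    have entry: "(\<lambda>\<omega>. (x n i j \<omega>)\<^sup>2 * of_bool (ennreal \<bar>x n i j \<omega>\<bar> > t n)) \<in> borel_measurable M" if "i < n" "j < n" for i j
    proof -
      note [measurable] = rv[OF that]
      have "(\<lambda>\<omega>. (truncate_at (t n) (x n i j \<omega>) - x n i j \<omega>)\<^sup>2) \<in> borel_measurable M" by measurable
      then show ?thesis unfolding diff_truncate_at_sq .
    qed
    have "(\<lambda>\<omega>. \<Sum>i<n. \<Sum>j<n. (x n i j \<omega>)\<^sup>2 * of_bool (ennreal \<bar>x n i j \<omega>\<bar> > t n)) \<in> borel_measurable M"
      by (intro borel_measurable_sum entry) auto
    then show ?thesis unfolding R_def by (intro borel_measurable_times borel_measurable_const)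
  qed
  have inprob: "weak_conv_in_prob M (\<lambda>n \<omega>. esd (W n \<omega>)) \<mu>" if Rp: "tendsto_in_prob M R 0"
    unfolding weak_conv_in_prob_def tendsto_in_prob_def
  proof (intro allI impI)
    fix s e :: real assume s: "isCont (cdf \<mu>) s" and e: "e > 0"
    \<comment> \<open>With \<open>e / 3\<close> the sandwich gives at most \<open>e\<close>, which
      contradicts the strict inequality in the bad event.\<close>
    have e3: "e / 3 > 0" using e by simp
    obtain s1 s2 c where *: "isCont (cdf \<mu>) s1" "isCont (cdf \<mu>) s2" "c > 0"
      "\<And>n \<omega>. n > 0 \<Longrightarrow> \<omega> \<in> space M \<Longrightarrow> R n \<omega> \<le> c \<Longrightarrow> \<bar>cdf (esd (Z n \<omega>)) s1 - cdf \<mu> s1\<bar> \<le> e / 3 \<Longrightarrow>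
        \<bar>cdf (esd (Z n \<omega>)) s2 - cdf \<mu> s2\<bar> \<le> e / 3 \<Longrightarrow> \<bar>cdf (esd (W n \<omega>)) s - cdf \<mu> s\<bar> \<le> 3 * (e / 3)"
      by (rule sandwich[OF s e3]) (use that in auto)
    obtain K1 \<eta>1 where K1: "\<eta>1 > 0" "\<And>\<nu>. real_distribution \<nu> \<Longrightarrow> all_moments_finite \<nu> \<Longrightarrow>
      (\<forall>k\<le>K1. \<bar>moment \<nu> k - moment \<mu> k\<bar> \<le> \<eta>1) \<Longrightarrow> \<bar>cdf \<nu> s1 - cdf \<mu> s1\<bar> \<le> e / 3"
      by (rule cdf_close_of_moments_close[OF \<mu>(1) det *(1) e3]) (use that in auto)
    obtain K2 \<eta>2 where K2: "\<eta>2 > 0" "\<And>\<nu>. real_distribution \<nu> \<Longrightarrow> all_moments_finite \<nu> \<Longrightarrow>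
      (\<forall>k\<le>K2. \<bar>moment \<nu> k - moment \<mu> k\<bar> \<le> \<eta>2) \<Longrightarrow> \<bar>cdf \<nu> s2 - cdf \<mu> s2\<bar> \<le> e / 3"
      by (rule cdf_close_of_moments_close[OF \<mu>(1) det *(2) e3]) (use that in auto)
    define K where "K = max K1 K2"
    define \<eta> where "\<eta> = min \<eta>1 \<eta>2"
    have \<eta>: "\<eta> > 0" using K1(1) K2(1) by (simp add: \<eta>_def)
    define D where "D k n = {\<omega> \<in> space M. \<eta> < \<bar>T k n \<omega> / real n - L k\<bar>}" for k n
    define RB where "RB n = {\<omega> \<in> space M. c < \<bar>R n \<omega> - 0\<bar>}" for n
    have D_ev: "D k n \<in> events" for k n unfolding D_def using T_meas[of k n] by measurable
    have RB_ev: "RB n \<in> events" for n unfolding RB_def using R_meas[of n] by measurable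
    let ?B = "\<lambda>n. {\<omega> \<in> space M. e < \<bar>cdf (esd (W n \<omega>)) s - cdf \<mu> s\<bar>}"
    \<comment> \<open>The bad event of \<open>W\<close> is covered by events about \<open>R\<close>
      and finitely many normalised traces, which are measurable; \<open>K\<close> and
      \<open>\<eta>\<close> serve the points \<open>s1\<close> and \<open>s2\<close> at
      once.\<close>
    have sub: "?B n \<subseteq> RB n \<union> (\<Union>k\<in>{1..K}. D k n)" if n: "n > 0" for n
    proof (rule subsetI, rule ccontr)
      fix \<omega> assume \<omega>: "\<omega> \<in> ?B n" "\<omega> \<notin> RB n \<union> (\<Union>k\<in>{1..K}. D k n)"
      have sp: "\<omega> \<in> space M" using \<omega>(1) by simp
      have close: "\<bar>moment (esd (Z n \<omega>)) k - moment \<mu> k\<bar> \<le> \<eta>" if "k \<le> K" for k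
      proof (cases "k = 0")
        case True
        interpret E: real_distribution "esd (Z n \<omega>)" by (rule real_distribution_esd)
        have "moment (esd (Z n \<omega>)) 0 = 1" using E.prob_space by (simp add: moment_def)
        then show ?thesis using True \<mu>(3)[of 0] \<eta> by (simp add: L_def)
      next
        case False
        then have "\<omega> \<notin> D k n" using \<omega>(2) that by auto
        then show ?thesis using sp momZ(2)[OF sp n] \<mu>(3) by (simp add: D_def not_less)
      qed
      have c1: "\<bar>cdf (esd (Z n \<omega>)) s1 - cdf \<mu> s1\<bar> \<le> e / 3"
        by (rule K1(2)[OF real_distribution_esd momZ(1)[OF sp n]])
          (use close in \<open>fastforce simp: K_def \<eta>_def\<close>)
      have c2: "\<bar>cdf (esd (Z n \<omega>)) s2 - cdf \<mu> s2\<bar> \<le> e / 3"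
        by (rule K2(2)[OF real_distribution_esd momZ(1)[OF sp n]])
          (use close in \<open>fastforce simp: K_def \<eta>_def\<close>)
      have "R n \<omega> \<le> c" using \<omega>(2) sp by (auto simp: RB_def)
      then have "\<bar>cdf (esd (W n \<omega>)) s - cdf \<mu> s\<bar> \<le> 3 * (e / 3)"
        by (rule *(4)[OF n sp _ c1 c2])
      then show False using \<omega>(1) by simp
    qed
    have Dlim: "(\<lambda>n. prob (D k n)) \<longlonglongrightarrow> 0" if "k \<in> {1..K}" for k
      unfolding D_def
    proof (rule AE_tendsto_imp_in_prob[OF T_meas _ \<eta>])
      show "AE \<omega> in M. (\<lambda>n. T k n \<omega> / real n) \<longlonglongrightarrow> L k"
        using AET by eventually_elim (use that in auto)
    qed
    have Rlim: "(\<lambda>n. prob (RB n)) \<longlonglongrightarrow> 0"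
      using Rp *(3) unfolding tendsto_in_prob_def RB_def by blast
    have "(\<lambda>n. prob (RB n) + (\<Sum>k\<in>{1..K}. prob (D k n))) \<longlonglongrightarrow> 0 + (\<Sum>k\<in>{1..K}. 0)"
      by (intro tendsto_add tendsto_sum Rlim Dlim)
    then have up: "(\<lambda>n. prob (RB n) + (\<Sum>k\<in>{1..K}. prob (D k n))) \<longlonglongrightarrow> 0" by simp
    show "(\<lambda>n. prob (?B n)) \<longlonglongrightarrow> 0"
    proof (rule Lim_null_comparison[OF _ up])
      show "\<forall>\<^sub>F n in sequentially. norm (prob (?B n)) \<le> prob (RB n) + (\<Sum>k\<in>{1..K}. prob (D k n))"
        using eventually_gt_at_top[of 0]
      proof eventually_elim
        case (elim n)
        \<comment> \<open>Monotonicity asks for measurability of the covering set only, so nothing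
          has to be known about \<open>?B n\<close> itself.\<close>
        have "prob (?B n) \<le> prob (RB n \<union> (\<Union>k\<in>{1..K}. D k n))"
          by (intro finite_measure_mono sub[OF elim] sets.Un RB_ev sets.finite_UN D_ev) auto
        also have "\<dots> \<le> prob (RB n) + prob (\<Union>k\<in>{1..K}. D k n)"
          by (intro measure_Un_le RB_ev sets.finite_UN D_ev) auto
        also have "prob (\<Union>k\<in>{1..K}. D k n) \<le> (\<Sum>k\<in>{1..K}. prob (D k n))"
          by (intro measure_UNION_le D_ev) auto
        finally show ?case by simp
      qed
    qed
  qed
  show ?thesis
  proof (intro exI[of _ \<mu>] conjI impI \<mu>(1,2) wcZ)
    show "\<forall>k\<ge>1. moment \<mu> k = (if even k then \<Sum>\<sigma>\<in>SS k. part_weight C \<sigma> else 0)"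
      using \<mu>(3) SS_odd_empty by (auto simp: L_def)
  qed (use wcW inprob in auto)
qed

end
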